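(* Let $n\ge1$, let $T\subset\mathbb{R}^{n+1}$ be a regular polytope with symmetry group $\mathcal{S}_T$, let $f$ be a measurable $\mathcal{S}_T$-invariant function on $\mathbb{S}^n$ with $c_1\le f\le c_2$ for positive constants $c_1,c_2$, and let $(p,q)\in\mathbb{R}^2$ with $pq\neq0$. (1) If $T$ is tangential to $\mathbb{S}^n$, there exists a local maximizer $\Omega^{(p,q)}$ of the functional $V_q$ such that, when $q>0$, $\Omega^{(p,q)}$ converges to $T$ as $p\to-\infty$. (2) When $p\neq0$, there exists a local maximizer $\Omega^{(p,q)}$ of $V_q$ which converges to a regular polytope similar to $T$ as $q\to+\infty$. Here a local maximizer of $V_q$ means a maximizer of $V_q$ over the family of $\mathcal{S}_T$-invariant convex bodies $\Omega$ containing the origin with $\int_{\mathbb{S}^n}fh_\Omega^p=\int_{\mathbb{S}^n}fh_T^p$ and Hausdorff distance to $T$ less than $\delta$, for some small $\delta>0$.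
   Context: $V_q(\Omega)=\int_{\mathbb{S}^n}r_\Omega^q(y)\,dy$ where $r_\Omega(y)=\sup\{\lambda>0:\lambda y\in\Omega\}$ is the radial function; $h_\Omega$ is the support function. A polytope is regular if its symmetry group $\mathcal{S}_T\subset O(n+1)$ acts transitively on its flags; it is tangential to $\mathbb{S}^n$ if every facet is tangent to $\mathbb{S}^n$. Convergence is in Hausdorff distance. *)

theory Defs
  imports "HOL-Analysis.Analysis"
begin

text \<open>Surface (spherical Lebesgue) measure on the unit sphere of a Euclidean space,
  defined by the cone construction: sigma(A) = dim * lebesgue({t y : 0 < t < 1, y in A}).\<close>
definition sphere_measure :: "'a::euclidean_space measure" where
  "sphere_measure =
     scale_measure (of_nat DIM('a))
       (distr (restrict_space lborel (ball 0 1 - {0})) (restrict_space borel (sphere 0 1))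
              (\<lambda>x. x /\<^sub>R norm x))"

definition radial_fun :: "'a::euclidean_space set \<Rightarrow> 'a \<Rightarrow> real" where
  "radial_fun \<Omega> y = Sup {t. t > 0 \<and> t *\<^sub>R y \<in> \<Omega>}"

definition support_fun :: "'a::euclidean_space set \<Rightarrow> 'a \<Rightarrow> real" where
  "support_fun \<Omega> y = Sup ((\<lambda>x. x \<bullet> y) ` \<Omega>)"

text \<open>Hausdorff distance (for nonempty compact sets).\<close>
definition hausdist :: "'a::metric_space set \<Rightarrow> 'a set \<Rightarrow> real" where
  "hausdist S T = max (SUP x\<in>S. infdist x T) (SUP y\<in>T. infdist y S)"

definition convex_body :: "'a::euclidean_space set \<Rightarrow> bool" where
  "convex_body K \<longleftrightarrow> compact K \<and> convex K \<and> interior K \<noteq> {}"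

definition sym_group :: "'a::euclidean_space set \<Rightarrow> ('a \<Rightarrow> 'a) set" where
  "sym_group T = {g. orthogonal_transformation g \<and> g ` T = T}"

definition is_flag :: "'a::euclidean_space set \<Rightarrow> (nat \<Rightarrow> 'a set) \<Rightarrow> bool" where
  "is_flag T F \<longleftrightarrow>
     (\<forall>i < DIM('a). F i face_of T \<and> aff_dim (F i) = int i) \<and>
     (\<forall>i. Suc i < DIM('a) \<longrightarrow> F i \<subseteq> F (Suc i))"

definition regular_polytope :: "'a::euclidean_space set \<Rightarrow> bool" where
  "regular_polytope T \<longleftrightarrow> polytope T \<and> interior T \<noteq> {} \<and>
     (\<forall>F G. is_flag T F \<longrightarrow> is_flag T G \<longrightarrow>
        (\<exists>g \<in> sym_group T. \<forall>i < DIM('a). g ` (F i) = G i))"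

definition tangential :: "'a::euclidean_space set \<Rightarrow> bool" where
  "tangential T \<longleftrightarrow>
     (\<forall>F. F facet_of T \<longrightarrow> (\<exists>y. affine hull F \<inter> sphere 0 1 = {y} \<and> y \<in> F))"

definition similar_to :: "'a::euclidean_space set \<Rightarrow> 'a set \<Rightarrow> bool" where
  "similar_to P T \<longleftrightarrow>
     (\<exists>c a g. c > 0 \<and> orthogonal_transformation g \<and> P = (\<lambda>x. a + c *\<^sub>R g x) ` T)"

definition Vq :: "real \<Rightarrow> 'a::euclidean_space set \<Rightarrow> ennreal" where
  "Vq q \<Omega> = (\<integral>\<^sup>+ y. ennreal (radial_fun \<Omega> y powr q) \<partial>sphere_measure)"

definition Ipf :: "('a::euclidean_space \<Rightarrow> real) \<Rightarrow> real \<Rightarrow> 'a set \<Rightarrow> ennreal" where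
  "Ipf f p \<Omega> = (\<integral>\<^sup>+ y. ennreal (f y * support_fun \<Omega> y powr p) \<partial>sphere_measure)"

definition admissible ::
  "'a::euclidean_space set \<Rightarrow> ('a \<Rightarrow> real) \<Rightarrow> real \<Rightarrow> real \<Rightarrow> 'a set \<Rightarrow> bool" where
  "admissible T f p \<delta> \<Omega> \<longleftrightarrow>
     convex_body \<Omega> \<and> 0 \<in> interior \<Omega> \<and> (\<forall>g \<in> sym_group T. g ` \<Omega> = \<Omega>) \<and>
     Ipf f p \<Omega> = Ipf f p T \<and> hausdist \<Omega> T < \<delta>"

definition local_maximizer ::
  "'a::euclidean_space set \<Rightarrow> ('a \<Rightarrow> real) \<Rightarrow> real \<Rightarrow> real \<Rightarrow> 'a set \<Rightarrow> bool" where
  "local_maximizer T f p q \<Omega> \<longleftrightarrow>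
     (\<exists>\<delta> > 0. admissible T f p \<delta> \<Omega> \<and>
        (\<forall>\<Omega>'. admissible T f p \<delta> \<Omega>' \<longrightarrow> Vq q \<Omega>' \<le> Vq q \<Omega>))"

end

theory Submission
  imports Defs "HOL-Complex_Analysis.Great_Picard"
begin

text \<open>
  Write \<open>H\<^sub>x(y) = max\<^sub>g (g x) \<bullet> y\<close> for the support function of the orbit of \<open>x\<close> under the symmetry
  group. If \<open>v\<close> is a vertex and \<open>a\<close> a facet normal of \<open>T\<close> (scaled so that the facet lies in \<open>a \<bullet> x = 1\<close>),
  then \<open>H\<^sub>v\<close> is the support function and \<open>H\<^sub>a\<close> the gauge \<open>1/r\<^sub>T\<close> of \<open>T\<close>. By flag transitivity the
  stabilizer of \<open>v\<close> (or \<open>a\<close>) fixes only the line through \<open>v\<close> (or \<open>a\<close>). Hence moving \<open>v\<close> orthogonally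
  by \<open>u\<close> increases \<open>H\<^sub>v\<close> to first order in \<open>u\<close>, while rescaling back to the sphere through \<open>v\<close> costs
  only second order: among orbits of nearby points that are not shorter than \<open>v\<close>, the orbit of \<open>v\<close>
  itself is strictly extremal for \<open>\<integral> f H\<^sup>s\<close>.

  As \<open>q \<rightarrow> \<infinity>\<close> the condition \<open>V\<^sub>q(\<Omega>) \<ge> V\<^sub>q(T)\<close> forces limits \<open>\<Omega>\<close> of bodies near \<open>T\<close> to contain a point
  \<open>w\<close> with \<open>|w| \<ge> |v|\<close>, so \<open>h\<^sub>\<Omega> \<ge> H\<^sub>w\<close> and the constraint gives \<open>\<Omega> = T\<close>. As \<open>p \<rightarrow> -\<infinity>\<close> the constraint forces
  \<open>h\<^sub>\<Omega>(y) \<le> 1\<close> for some unit \<open>y\<close>, so \<open>1/r\<^sub>\<Omega> \<ge> H\<^sub>y\<close> and \<open>V\<^sub>q(\<Omega>) \<ge> V\<^sub>q(T)\<close> gives \<open>\<Omega> = T\<close>. In both regimes the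
  maximizers in a fixed neighbourhood of \<open>T\<close> therefore exist and converge to \<open>T\<close>; elsewhere the
  irreducibility of the group bounds all competitors, and a global maximizer exists by compactness.
\<close>

subsection \<open>Surface measure and power integrals\<close>

text \<open>Admissible bodies are cut out by a strict Hausdorff inequality, so a maximizing sequence
  may run into the boundary of the neighbourhood. The cure is a localization statement: at extreme
  exponents every competitor at least as good as \<open>T\<close> lies well inside. That statement
  already contains the asserted convergence, so existence and convergence come together.

  Exponents of both signs occur. Inequalities between integrals of powers are therefore multiplied
  by \<open>sgn s\<close>, and V_q is rewritten through the gauge with exponent -q. The two limits
  become dual instances of one rigidity statement, with data (f, p, v) for the support function and
  (1, -q, a) for the gauge; tangency to the sphere enters as |a| = 1.

  The first-order gain comes from averaging: the images under the stabilizer of a vector u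
  orthogonal to v sum to zero, so one of them has inner product at least |u . y| / |G| with a given
  y. Compactness uses closeness up to dilation, which homogeneity turns into bounds on power
  integrals.\<close>

lemma space_sphere_measure [simp]: "space (sphere_measure :: 'a::euclidean_space measure) = sphere 0 1"
  by (simp add: sphere_measure_def space_scale_measure space_restrict_space)

lemma sets_sphere_measure [measurable_cong]:
  "sets (sphere_measure :: 'a::euclidean_space measure) = sets (restrict_space borel (sphere 0 1))"
  by (simp add: sphere_measure_def)

lemma continuous_on_measurable_sphere_measure:
  fixes \<phi> :: "'a::euclidean_space \<Rightarrow> 'b::topological_space"
  assumes "continuous_on (sphere 0 1) \<phi>"
  shows "\<phi> \<in> borel_measurable sphere_measure"
  using borel_measurable_continuous_on_restrict[OF assms]
  by (simp add: measurable_cong_sets[OF sets_sphere_measure refl])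

lemma radial_projection_measurable:
  "(\<lambda>x. x /\<^sub>R norm x) \<in>
     measurable (restrict_space lborel (ball 0 1 - {0::'a::euclidean_space})) (restrict_space borel (sphere 0 1))"
proof (rule measurable_restrict_space2)
  show "(\<lambda>x. x /\<^sub>R norm x) \<in> space (restrict_space lborel (ball 0 1 - {0::'a})) \<rightarrow> sphere 0 1"
    by (auto simp: space_restrict_space)
  have "continuous_on (ball 0 1 - {0::'a}) (\<lambda>x. x /\<^sub>R norm x)"
    by (intro continuous_intros) auto
  from borel_measurable_continuous_on_restrict[OF this]
  show "(\<lambda>x. x /\<^sub>R norm x) \<in> borel_measurable (restrict_space lborel (ball 0 1 - {0::'a}))"
    by (simp add: measurable_cong_sets[OF sets_restrict_space_cong[OF sets_lborel] refl])
qed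

lemma emeasure_sphere_measure:
  assumes "A \<in> sets (restrict_space borel (sphere (0::'a::euclidean_space) 1))"
  shows "emeasure sphere_measure A =
    of_nat DIM('a) * emeasure lborel ({x. x /\<^sub>R norm x \<in> A} \<inter> (ball 0 1 - {0}))"
proof -
  let ?M = "restrict_space lborel (ball 0 1 - {0::'a})"
  have "emeasure sphere_measure A = of_nat DIM('a) * emeasure ?M ((\<lambda>x. x /\<^sub>R norm x) -` A \<inter> space ?M)"
    using assms by (simp add: sphere_measure_def emeasure_distr[OF radial_projection_measurable])
  also have "(\<lambda>x. x /\<^sub>R norm x) -` A \<inter> space ?M = {x. x /\<^sub>R norm x \<in> A} \<inter> (ball 0 1 - {0})"
    by (auto simp: space_restrict_space)
  also have "emeasure ?M \<dots> = emeasure lborel ({x. x /\<^sub>R norm x \<in> A} \<inter> (ball 0 1 - {0}))"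
    by (rule emeasure_restrict_space) auto
  finally show ?thesis .
qed

lemma finite_measure_sphere_measure: "finite_measure (sphere_measure :: 'a::euclidean_space measure)"
proof
  have "emeasure lborel ({x. x /\<^sub>R norm x \<in> sphere (0::'a) 1} \<inter> (ball 0 1 - {0})) \<le> emeasure lborel (ball (0::'a) 1)"
    by (rule emeasure_mono) auto
  then show "emeasure (sphere_measure :: 'a measure) (space sphere_measure) \<noteq> \<infinity>"
    using emeasure_sphere_measure[of "sphere (0::'a) 1"] emeasure_lborel_ball_finite[of "0::'a" 1]
    by (auto simp: sets_restrict_space_iff ennreal_mult_eq_top_iff top_unique)
qed

lemma emeasure_open_lborel_pos:
  fixes W :: "'a::euclidean_space set"
  assumes "open W" "W \<noteq> {}"
  shows "emeasure lborel W > 0"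
proof -
  have "emeasure lborel W \<noteq> 0"
    using open_not_negligible[OF assms] assms(1)
    by (auto simp: negligible_iff_null_sets completion.null_sets_outer null_sets_def)
  then show ?thesis by (simp add: zero_less_iff_neq_zero)
qed

text \<open>The truncated cone over \<open>W\<close>, without its apex, is a nonempty open subset of
  the ambient space, and its Lebesgue measure determines the measure of \<open>W\<close>.\<close>

lemma emeasure_sphere_measure_open_pos:
  fixes W :: "'a::euclidean_space set"
  assumes "openin (top_of_set (sphere 0 1)) W" "W \<noteq> {}"
  shows "emeasure sphere_measure W > 0"
proof -
  obtain W' where W': "open W'" "W = sphere 0 1 \<inter> W'" using assms(1) by (auto simp: openin_open)
  obtain y where y: "y \<in> W" using assms by auto
  let ?V = "{x. x /\<^sub>R norm x \<in> W} \<inter> (ball 0 1 - {0})"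
  have "?V = {x \<in> ball 0 1 - {0}. x /\<^sub>R norm x \<in> W'}"
    using W' by auto
  moreover have "openin (top_of_set (ball 0 1 - {0})) {x \<in> ball 0 1 - {0::'a}. x /\<^sub>R norm x \<in> W'}"
  proof -
    have "continuous_on (ball 0 1 - {0::'a}) (\<lambda>x. x /\<^sub>R norm x)"
      by (intro continuous_intros) auto
    from continuous_openin_preimage_gen[OF this W'(1)] show ?thesis
      by (simp add: vimage_def Int_def conj_commute)
  qed
  moreover have "open (ball 0 1 - {0::'a})" by (simp add: open_delete)
  ultimately have "open ?V" by (simp add: openin_open_eq)
  moreover have "(1/2) *\<^sub>R y \<in> ?V" using y W' by auto
  ultimately have "emeasure lborel ?V > 0" using emeasure_open_lborel_pos by blast
  moreover have "W \<in> sets (restrict_space borel (sphere 0 1))"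
    using W' by (auto simp: sets_restrict_space_iff)
  ultimately show ?thesis
    by (simp add: emeasure_sphere_measure ennreal_zero_less_mult_iff)
qed

lemma integral_sphere_measure_pos:
  fixes u :: "'a::euclidean_space \<Rightarrow> real"
  assumes int: "integrable sphere_measure u" and nn: "\<And>y. norm y = 1 \<Longrightarrow> u y \<ge> 0"
    and W: "openin (top_of_set (sphere 0 1)) W" "W \<noteq> {}" and pos: "\<And>y. y \<in> W \<Longrightarrow> u y > 0"
  shows "(LINT y|sphere_measure. u y) > 0"
proof -
  have "(LINT y|sphere_measure. u y) \<ge> 0"
    by (rule integral_nonneg_AE) (use nn in \<open>auto intro!: AE_I2\<close>)
  moreover have "(LINT y|sphere_measure. u y) \<noteq> 0"
  proof
    assume "(LINT y|sphere_measure. u y) = 0"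
    then have "AE y in sphere_measure. u y = 0"
      by (subst (asm) integral_nonneg_eq_0_iff_AE[OF int]) (use nn in \<open>auto intro!: AE_I2\<close>)
    then have "AE y in sphere_measure. y \<notin> W"
      by eventually_elim (use pos in force)
    moreover have "W \<in> sets sphere_measure"
      using W by (auto simp: sets_sphere_measure sets_restrict_space_iff openin_open)
    moreover have "{y \<in> space sphere_measure. \<not> y \<notin> W} = W"
      using openin_imp_subset[OF W(1)] by auto
    ultimately have "emeasure sphere_measure W = 0"
      by (simp add: AE_iff_measurable)
    then show False using emeasure_sphere_measure_open_pos[OF W] by simp
  qed
  ultimately show ?thesis by linarith
qed

section \<open>Weighted integrals of real powers over the sphere\<close>

definition weight :: "real \<Rightarrow> real \<Rightarrow> ('a::euclidean_space \<Rightarrow> real) \<Rightarrow> bool" where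
  "weight c1 c2 f \<longleftrightarrow> f \<in> borel_measurable sphere_measure \<and> 0 < c1 \<and> (\<forall>y. norm y = 1 \<longrightarrow> c1 \<le> f y \<and> f y \<le> c2)"

text \<open>The class in which all integrands live: real powers of either sign stay continuous,
  hence bounded, on the sphere.\<close>

definition cont_pos_sphere :: "('a::euclidean_space \<Rightarrow> real) \<Rightarrow> bool" where
  "cont_pos_sphere \<phi> \<longleftrightarrow> continuous_on (sphere 0 1) \<phi> \<and> (\<forall>y. norm y = 1 \<longrightarrow> 0 < \<phi> y)"

text \<open>One form for both functionals: the constraint is the case of the support function with
  \<open>s = p\<close>, the volume V_q the case of the gauge with weight 1 and
  \<open>s = -q\<close>.\<close>

definition power_integral :: "('a::euclidean_space \<Rightarrow> real) \<Rightarrow> real \<Rightarrow> ('a \<Rightarrow> real) \<Rightarrow> real" where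
  "power_integral f s \<phi> = (LINT y|sphere_measure. f y * \<phi> y powr s)"

lemma weight_pos: "weight c1 c2 f \<Longrightarrow> norm y = 1 \<Longrightarrow> f y > 0"
  unfolding weight_def by (meson less_le_trans)

lemma weight_one: "weight 1 1 (\<lambda>_. 1)" by (simp add: weight_def)

lemma ex_norm_one: "\<exists>y::'a::euclidean_space. norm y = 1"
  using nonempty_Basis norm_Basis by blast

lemma power_integral_cong:
  fixes \<phi> \<psi> :: "'a::euclidean_space \<Rightarrow> real"
  assumes "\<And>y. norm y = 1 \<Longrightarrow> \<phi> y = \<psi> y"
  shows "power_integral f s \<phi> = power_integral f s \<psi>"
  unfolding power_integral_def by (rule Bochner_Integration.integral_cong) (use assms in auto)

lemma cont_pos_sphere_cong:
  fixes \<phi> \<psi> :: "'a::euclidean_space \<Rightarrow> real"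
  assumes "cont_pos_sphere \<phi>" "\<And>y. norm y = 1 \<Longrightarrow> \<phi> y = \<psi> y"
  shows "cont_pos_sphere \<psi>"
proof -
  have "continuous_on (sphere 0 1) \<phi> \<longleftrightarrow> continuous_on (sphere 0 1) \<psi>"
    by (rule continuous_on_cong[OF refl]) (use assms(2) in simp)
  then show ?thesis using assms unfolding cont_pos_sphere_def by metis
qed

lemma cont_pos_sphere_scale:
  "cont_pos_sphere \<phi> \<Longrightarrow> c > 0 \<Longrightarrow> cont_pos_sphere (\<lambda>y. c * \<phi> y)"
  unfolding cont_pos_sphere_def by (auto intro!: continuous_intros)

lemma cont_pos_sphere_bounds:
  fixes \<phi> :: "'a::euclidean_space \<Rightarrow> real"
  assumes "cont_pos_sphere \<phi>"
  obtains a b where "0 < a" "\<And>y. norm y = 1 \<Longrightarrow> a \<le> \<phi> y" "\<And>y. norm y = 1 \<Longrightarrow> \<phi> y \<le> b"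
proof -
  have c: "continuous_on (sphere 0 1) \<phi>" and ne: "sphere (0::'a) 1 \<noteq> {}"
    using assms ex_norm_one by (auto simp: cont_pos_sphere_def)
  obtain y1 where y1: "y1 \<in> sphere 0 1" "\<forall>y\<in>sphere 0 1. \<phi> y1 \<le> \<phi> y"
    using continuous_attains_inf[OF compact_sphere ne c] by blast
  obtain y2 where y2: "y2 \<in> sphere 0 1" "\<forall>y\<in>sphere 0 1. \<phi> y \<le> \<phi> y2"
    using continuous_attains_sup[OF compact_sphere ne c] by blast
  show ?thesis by (rule that[of "\<phi> y1" "\<phi> y2"]) (use y1 y2 assms in \<open>auto simp: cont_pos_sphere_def\<close>)
qed

lemma continuous_on_powr_sphere:
  "cont_pos_sphere \<phi> \<Longrightarrow> continuous_on (sphere 0 1) (\<lambda>y. \<phi> y powr s)"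
  unfolding cont_pos_sphere_def by (intro continuous_intros) (auto simp: order_less_imp_not_eq2)

lemma integrable_weight_continuous:
  fixes f :: "'a::euclidean_space \<Rightarrow> real"
  assumes f: "weight c1 c2 f" and u: "continuous_on (sphere 0 1) u"
  shows "integrable sphere_measure (\<lambda>y. f y * u y)"
proof -
  interpret finite_measure "sphere_measure :: 'a measure" by (rule finite_measure_sphere_measure)
  have "compact (u ` sphere 0 1)" by (rule compact_continuous_image[OF u compact_sphere])
  then obtain B where B: "\<And>y. norm y = 1 \<Longrightarrow> \<bar>u y\<bar> \<le> B"
    by (force dest!: compact_imp_bounded simp: bounded_iff)
  have [measurable]: "f \<in> borel_measurable sphere_measure" "u \<in> borel_measurable sphere_measure"
    using f continuous_on_measurable_sphere_measure[OF u] by (auto simp: weight_def)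
  show ?thesis
  proof (rule integrable_const_bound[where B = "c2 * B"])
    show "AE y in sphere_measure. norm (f y * u y) \<le> c2 * B"
    proof (intro AE_I2)
      fix y :: 'a assume "y \<in> space sphere_measure"
      then have "norm y = 1" by simp
      then have "0 < f y" "f y \<le> c2" "\<bar>u y\<bar> \<le> B" using f B weight_pos[OF f] by (auto simp: weight_def)
      then show "norm (f y * u y) \<le> c2 * B" by (auto simp: abs_mult intro!: mult_mono)
    qed
  qed measurable
qed

lemma integrable_power_integral:
  assumes "weight c1 c2 f" "cont_pos_sphere \<phi>"
  shows "integrable sphere_measure (\<lambda>y. f y * \<phi> y powr s)"
  by (rule integrable_weight_continuous[OF assms(1) continuous_on_powr_sphere[OF assms(2)]])

lemma nn_integral_power_integral:
  assumes f: "weight c1 c2 f" and \<phi>: "cont_pos_sphere \<phi>"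
  shows "(\<integral>\<^sup>+ y. ennreal (f y * \<phi> y powr s) \<partial>sphere_measure) = ennreal (power_integral f s \<phi>)"
  unfolding power_integral_def
  by (rule nn_integral_eq_integral[OF integrable_power_integral[OF assms]])
     (use weight_pos[OF f] in \<open>auto intro!: AE_I2 mult_nonneg_nonneg simp: less_imp_le\<close>)

lemma power_integral_pos:
  assumes f: "weight c1 c2 f" and \<phi>: "cont_pos_sphere \<phi>"
  shows "power_integral f s \<phi> > 0"
  unfolding power_integral_def
  by (rule integral_sphere_measure_pos[OF integrable_power_integral[OF assms], where W = "sphere 0 1"])
     (use weight_pos[OF f] \<phi> ex_norm_one in \<open>auto simp: cont_pos_sphere_def less_imp_le\<close>)

lemma power_integral_scale:
  assumes "c > 0" "\<And>y. norm y = 1 \<Longrightarrow> \<phi> y \<ge> 0"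
  shows "power_integral f s (\<lambda>y. c * \<phi> y) = c powr s * power_integral f s \<phi>"
proof -
  have "power_integral f s (\<lambda>y. c * \<phi> y) = (LINT y|sphere_measure. c powr s * (f y * \<phi> y powr s))"
    unfolding power_integral_def
    by (rule Bochner_Integration.integral_cong) (use assms in \<open>auto simp: powr_mult\<close>)
  then show ?thesis by (simp add: power_integral_def)
qed

text \<open>The factor \<open>sgn s\<close> makes the power nondecreasing whatever the sign of
  \<open>s\<close>, so that later comparisons treat both signs at once; at \<open>s = 0\<close> both
  sides vanish.\<close>

lemma sgn_powr_mono:
  fixes a b s :: real
  assumes "0 < a" "a \<le> b"
  shows "sgn s * a powr s \<le> sgn s * b powr s"
  using assms powr_mono2[of s a b] powr_mono2'[of s a b] by (cases s "0::real" rule: linorder_cases) auto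

lemma sgn_powr_strict_mono:
  fixes a b s :: real
  assumes "0 < a" "a < b" "s \<noteq> 0"
  shows "sgn s * a powr s < sgn s * b powr s"
  using assms powr_less_mono2[of s a b] powr_less_mono2_neg[of s a b] by (cases s "0::real" rule: linorder_cases) auto

lemma power_integral_mono:
  fixes f :: "'a::euclidean_space \<Rightarrow> real"
  assumes f: "weight c1 c2 f" and \<phi>: "cont_pos_sphere \<phi>" and \<psi>: "cont_pos_sphere \<psi>"
    and le: "\<And>y. norm y = 1 \<Longrightarrow> \<phi> y \<le> \<psi> y"
  shows "sgn s * power_integral f s \<phi> \<le> sgn s * power_integral f s \<psi>"
proof -
  have "(LINT y|sphere_measure. sgn s * (f y * \<phi> y powr s)) \<le> (LINT y|sphere_measure. sgn s * (f y * \<psi> y powr s))"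
  proof (rule integral_mono[OF integrable_mult_right[OF integrable_power_integral[OF f \<phi>]] integrable_mult_right[OF integrable_power_integral[OF f \<psi>]]])
    fix y :: 'a assume "y \<in> space sphere_measure"
    then have y: "norm y = 1" by simp
    have "f y * (sgn s * \<phi> y powr s) \<le> f y * (sgn s * \<psi> y powr s)"
      by (rule mult_left_mono[OF sgn_powr_mono]) (use y weight_pos[OF f y] \<phi> le in \<open>auto simp: cont_pos_sphere_def\<close>)
    then show "sgn s * (f y * \<phi> y powr s) \<le> sgn s * (f y * \<psi> y powr s)" by (simp add: mult_ac)
  qed
  then show ?thesis by (simp add: power_integral_def)
qed

text \<open>Equality case of monotonicity: a strict inequality at one point spreads by continuity to
  an open piece of the sphere, which has positive measure.\<close>

lemma power_integral_eq_imp_eq: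
  fixes f :: "'a::euclidean_space \<Rightarrow> real"
  assumes f: "weight c1 c2 f" and \<phi>: "cont_pos_sphere \<phi>" and \<psi>: "cont_pos_sphere \<psi>"
    and le: "\<And>y. norm y = 1 \<Longrightarrow> \<phi> y \<le> \<psi> y"
    and eq: "sgn s * power_integral f s \<psi> \<le> sgn s * power_integral f s \<phi>" and s: "s \<noteq> 0" and y: "norm y = 1"
  shows "\<phi> y = \<psi> y"
proof (rule ccontr)
  assume "\<phi> y \<noteq> \<psi> y"
  define u where "u y = sgn s * (f y * \<psi> y powr s) - sgn s * (f y * \<phi> y powr s)" for y
  let ?W = "{y \<in> sphere 0 1. \<phi> y < \<psi> y}"
  have int: "integrable sphere_measure u"
    unfolding u_def by (intro Bochner_Integration.integrable_diff integrable_mult_right integrable_power_integral[OF f] \<phi> \<psi>)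
  have u_eq: "u y = f y * (sgn s * \<psi> y powr s - sgn s * \<phi> y powr s)" for y
    by (simp add: u_def algebra_simps)
  have "(LINT y|sphere_measure. u y) > 0"
  proof (rule integral_sphere_measure_pos[OF int, where W = ?W])
    show "u y \<ge> 0" if "norm y = 1" for y
      using sgn_powr_mono[of "\<phi> y" "\<psi> y" s] that \<phi> le[OF that] weight_pos[OF f that]
      by (auto simp: cont_pos_sphere_def u_eq)
    show "u y > 0" if "y \<in> ?W" for y
      using sgn_powr_strict_mono[of "\<phi> y" "\<psi> y" s] that \<phi> weight_pos[OF f] s
      by (auto simp: cont_pos_sphere_def u_eq)
    show "?W \<noteq> {}" using y le[OF y] \<open>\<phi> y \<noteq> \<psi> y\<close> by (auto simp: less_le)
    have "continuous_on (sphere 0 1) (\<lambda>y. \<psi> y - \<phi> y)"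
      using \<phi> \<psi> by (auto simp: cont_pos_sphere_def intro!: continuous_intros)
    from continuous_openin_preimage_gen[OF this open_greaterThan[of 0]]
    show "openin (top_of_set (sphere 0 1)) ?W"
      by (simp add: vimage_def Int_def conj_commute)
  qed
  moreover have "(LINT y|sphere_measure. u y) = sgn s * power_integral f s \<psi> - sgn s * power_integral f s \<phi>"
    unfolding u_def power_integral_def
    by (subst Bochner_Integration.integral_diff)
       (auto intro!: integrable_mult_right integrable_power_integral[OF f] \<phi> \<psi>)
  ultimately show False using eq by linarith
qed

text \<open>Large negative exponents see only the smallest values. A function below \<open>A\<close>
  on an open cap has an integral at least of order \<open>A powr (-q)\<close>, a function with
  values at least \<open>B\<close> has one at most of order \<open>B powr (-q)\<close>, and the
  quotient of these orders tends to 0. The threshold on \<open>q\<close> does not depend on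
  \<open>\<phi>\<close>, so \<open>\<phi>\<close> may vary with \<open>q\<close>.\<close>

lemma power_integral_large_exponent:
  fixes f :: "'a::euclidean_space \<Rightarrow> real"
  assumes f: "weight c1 c2 f" and \<theta>: "cont_pos_sphere \<theta>"
    and y0: "norm y0 = 1" "\<theta> y0 < A" and AB: "A < B"
  shows "\<exists>q0. \<forall>q\<ge>q0. \<forall>\<phi>. cont_pos_sphere \<phi> \<longrightarrow> (\<forall>y. norm y = 1 \<longrightarrow> B \<le> \<phi> y) \<longrightarrow>
    power_integral f (-q) \<phi> < power_integral f (-q) \<theta>"
proof -
  let ?W = "{y \<in> sphere 0 1. \<theta> y < A}"
  have A: "A > 0" using \<theta> y0 by (force simp: cont_pos_sphere_def)
  interpret finite_measure "sphere_measure :: 'a measure" by (rule finite_measure_sphere_measure)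
  have "continuous_on (sphere 0 1) \<theta>" using \<theta> by (simp add: cont_pos_sphere_def)
  from continuous_openin_preimage_gen[OF this open_lessThan[of A]]
  have W: "openin (top_of_set (sphere 0 1)) ?W" by (simp add: vimage_def Int_def conj_commute)
  have Wm: "?W \<in> sets sphere_measure"
    using W by (auto simp: sets_sphere_measure sets_restrict_space_iff openin_open)
  have Wne: "?W \<noteq> {}" using y0 by auto
  define m where "m = measure sphere_measure ?W"
  have "emeasure sphere_measure ?W > 0" by (rule emeasure_sphere_measure_open_pos[OF W Wne])
  then have m: "m > 0" by (simp add: m_def emeasure_eq_measure)
  define S where "S = measure sphere_measure (sphere (0::'a) 1)"
  have c1: "c1 > 0" "c1 \<le> c2" using f y0 by (force simp: weight_def)+
  have lower: "c1 * m * A powr (-q) \<le> power_integral f (-q) \<theta>" if "q \<ge> 0" for q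
  proof -
    have "(LINT y|(sphere_measure::'a measure). c1 * A powr (-q) * indicator ?W y) \<le> (LINT y|sphere_measure. f y * \<theta> y powr (-q))"
    proof (rule integral_mono[OF _ integrable_power_integral[OF f \<theta>]])
      show "integrable sphere_measure (\<lambda>y. c1 * A powr (-q) * indicat_real ?W y)"
        using Wm by (auto intro!: integrable_real_indicator simp: emeasure_eq_measure)
      fix y :: 'a assume "y \<in> space sphere_measure"
      then have y: "norm y = 1" by simp
      show "c1 * A powr (-q) * indicator ?W y \<le> f y * \<theta> y powr (-q)"
      proof (cases "y \<in> ?W")
        case True
        have "c1 * A powr (-q) \<le> f y * \<theta> y powr (-q)"
          by (rule mult_mono) (use f y True that \<theta> weight_pos[OF f y] in \<open>auto simp: weight_def cont_pos_sphere_def intro!: powr_mono2'\<close>)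
        then show ?thesis using True by simp
      next
        case False then show ?thesis using weight_pos[OF f y] by simp
      qed
    qed
    moreover have "?W \<inter> sphere 0 1 = ?W" by auto
    ultimately show ?thesis using Wm by (simp add: power_integral_def m_def mult_ac)
  qed
  have upper: "power_integral f (-q) \<phi> \<le> c2 * S * B powr (-q)"
    if "q \<ge> 0" "cont_pos_sphere \<phi>" "\<And>y. norm y = 1 \<Longrightarrow> B \<le> \<phi> y" for q \<phi>
  proof -
    have "(LINT y|sphere_measure. f y * \<phi> y powr (-q)) \<le> (LINT y|(sphere_measure :: 'a measure). c2 * B powr (-q))"
    proof (rule integral_mono[OF integrable_power_integral[OF f that(2)]])
      show "integrable (sphere_measure :: 'a measure) (\<lambda>y. c2 * B powr (-q))" by simp
      fix y :: 'a assume "y \<in> space sphere_measure"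
      then have y: "norm y = 1" by simp
      show "f y * \<phi> y powr (-q) \<le> c2 * B powr (-q)"
        by (rule mult_mono) (use f y that A AB c1 in \<open>auto simp: weight_def intro!: powr_mono2'\<close>)
    qed
    then show ?thesis by (simp add: power_integral_def S_def mult_ac)
  qed

  have "((\<lambda>q. (A / B) powr q) \<longlongrightarrow> 0) at_top"
  proof -
    have "filterlim (\<lambda>q. ln (A / B) * q) at_bot at_top"
      by (rule filterlim_tendsto_neg_mult_at_bot[OF tendsto_const _ filterlim_ident]) (use A AB in simp)
    from filterlim_compose[OF exp_at_bot this] show ?thesis
      using A AB by (simp add: powr_def mult.commute)
  qed
  then have "((\<lambda>q. c2 * S * (A / B) powr q) \<longlongrightarrow> c2 * S * 0) at_top"
    by (intro tendsto_intros)
  then have "eventually (\<lambda>q. c2 * S * (A / B) powr q < c1 * m) at_top"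
    by (rule order_tendstoD(2)) (use c1 m in simp)
  then obtain q1 where q1: "\<And>q. q \<ge> q1 \<Longrightarrow> c2 * S * (A / B) powr q < c1 * m"
    by (auto simp: eventually_at_top_linorder)
  show ?thesis
  proof (intro exI[of _ "max q1 0"] allI impI)
    fix q :: real and \<phi> :: "'a \<Rightarrow> real" assume q: "max q1 0 \<le> q" and \<phi>: "cont_pos_sphere \<phi>" "\<forall>y. norm y = 1 \<longrightarrow> B \<le> \<phi> y"
    have "c2 * S * B powr (-q) = c2 * S * (A / B) powr q * A powr (-q)"
      using A AB by (simp add: powr_divide powr_minus field_simps)
    also have "\<dots> < c1 * m * A powr (-q)" by (rule mult_strict_right_mono) (use q q1 A in auto)
    finally show "power_integral f (-q) \<phi> < power_integral f (-q) \<theta>"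
      using lower[of q] upper[OF _ \<phi>(1), of q] \<phi>(2) q by auto
  qed
qed

subsection \<open>Support and gauge functions of convex bodies\<close>

definition origin_body :: "'a::euclidean_space set \<Rightarrow> bool" where
  "origin_body K \<longleftrightarrow> convex_body K \<and> 0 \<in> interior K"

text \<open>For a body around the origin this is the Minkowski gauge. Unlike the radial function it
  is sublinear, and for a polytope it is a maximum of linear functionals, just like the support
  function.\<close>

definition gauge_fun :: "'a::euclidean_space set \<Rightarrow> 'a \<Rightarrow> real" where
  "gauge_fun K y = 1 / radial_fun K y"

lemma origin_body_compact: "origin_body K \<Longrightarrow> compact K"
  and origin_body_convex: "origin_body K \<Longrightarrow> convex K"
  and origin_body_zero: "origin_body K \<Longrightarrow> 0 \<in> K"
  using interior_subset by (auto simp: origin_body_def convex_body_def)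

lemma origin_bodyI:
  assumes "compact K" "convex K" "r > 0" "cball 0 r \<subseteq> K"
  shows "origin_body K"
proof -
  have "0 \<in> interior K" using assms by (meson ball_subset_cball centre_in_ball mem_interior subset_trans)
  then show ?thesis using assms by (auto simp: origin_body_def convex_body_def)
qed

lemma origin_body_inball:
  assumes "origin_body K"
  obtains r where "r > 0" "cball 0 r \<subseteq> K"
  using assms by (auto simp: origin_body_def mem_interior_cball)

lemma origin_body_outball:
  assumes "origin_body K"
  obtains R where "R > 0" "K \<subseteq> cball 0 R"
proof -
  obtain R where "R > 0" "\<forall>x\<in>K. norm x \<le> R"
    using compact_imp_bounded[OF origin_body_compact[OF assms]] by (auto simp: bounded_pos)
  then show ?thesis by (intro that[of R]) auto
qed

lemma bdd_above_inner_image: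
  fixes K :: "'a::euclidean_space set"
  assumes "compact K" shows "bdd_above ((\<lambda>x. x \<bullet> y) ` K)"
  by (intro bounded_imp_bdd_above compact_imp_bounded compact_continuous_image continuous_intros assms)

lemma inner_le_support_fun: "compact K \<Longrightarrow> x \<in> K \<Longrightarrow> x \<bullet> y \<le> support_fun K y"
  unfolding support_fun_def by (rule cSup_upper[OF _ bdd_above_inner_image]) auto

lemma support_fun_le: "K \<noteq> {} \<Longrightarrow> (\<And>x. x \<in> K \<Longrightarrow> x \<bullet> y \<le> c) \<Longrightarrow> support_fun K y \<le> c"
  unfolding support_fun_def by (rule cSup_least) auto

lemma support_fun_attained:
  assumes "compact K" "K \<noteq> {}"
  obtains x where "x \<in> K" "support_fun K y = x \<bullet> y"
proof -
  have "continuous_on K (\<lambda>x. x \<bullet> y)" by (intro continuous_intros)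
  then obtain x where x: "x \<in> K" "\<forall>z\<in>K. z \<bullet> y \<le> x \<bullet> y"
    using continuous_attains_sup[OF assms] by blast
  then have "support_fun K y = x \<bullet> y"
    using assms by (intro antisym support_fun_le inner_le_support_fun) auto
  with x show ?thesis using that by blast
qed

lemma support_fun_diff_le:
  assumes "compact K" "K \<noteq> {}" "K \<subseteq> cball 0 R"
  shows "support_fun K y - support_fun K z \<le> R * norm (y - z)"
proof -
  obtain x where x: "x \<in> K" "support_fun K y = x \<bullet> y" using support_fun_attained[OF assms(1,2)] by blast
  have "x \<bullet> y - x \<bullet> z \<le> norm x * norm (y - z)" by (metis inner_diff_right norm_cauchy_schwarz)
  also have "\<dots> \<le> R * norm (y - z)" using x assms by (intro mult_right_mono) auto
  finally show ?thesis using x inner_le_support_fun[OF assms(1) x(1), of z] by linarith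
qed

lemma support_fun_Lipschitz:
  assumes "compact K" "K \<noteq> {}" "K \<subseteq> cball 0 R"
  shows "\<bar>support_fun K y - support_fun K z\<bar> \<le> R * norm (y - z)"
  using support_fun_diff_le[OF assms, of y z] support_fun_diff_le[OF assms, of z y]
  by (simp add: norm_minus_commute abs_le_iff)

lemma continuous_on_Lipschitz_real:
  fixes u :: "'a::real_normed_vector \<Rightarrow> real"
  assumes "\<And>y z. y \<in> S \<Longrightarrow> z \<in> S \<Longrightarrow> \<bar>u y - u z\<bar> \<le> L * norm (y - z)"
  shows "continuous_on S u"
proof (rule continuous_on_iff[THEN iffD2], intro ballI allI impI)
  fix x and e :: real assume "x \<in> S" "e > 0"
  show "\<exists>d>0. \<forall>x'\<in>S. dist x' x < d \<longrightarrow> dist (u x') (u x) < e"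
  proof (intro exI conjI ballI impI)
    show "e / (\<bar>L\<bar> + 1) > 0" using \<open>e > 0\<close> by simp
    fix x' assume x': "x' \<in> S" "dist x' x < e / (\<bar>L\<bar> + 1)"
    have "\<bar>u x' - u x\<bar> \<le> (\<bar>L\<bar> + 1) * norm (x' - x)"
      by (rule order_trans[OF assms[OF x'(1) \<open>x \<in> S\<close>]]) (auto intro!: mult_right_mono)
    also have "\<dots> < e" using x' by (simp add: dist_norm field_simps pos_less_divide_eq)
    finally show "dist (u x') (u x) < e" by (simp add: dist_real_def)
  qed
qed

lemma support_fun_ge:
  assumes "compact K" "cball 0 r \<subseteq> K" "r \<ge> 0"
  shows "r * norm y \<le> support_fun K y"
proof (cases "y = 0")
  case True
  have "0 \<in> K" using assms by auto
  from inner_le_support_fun[OF assms(1) this, of y] show ?thesis using True by simp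
next
  case False
  have "(r / norm y) *\<^sub>R y \<in> K" using assms False by (auto intro!: subsetD[OF assms(2)])
  from inner_le_support_fun[OF assms(1) this, of y]
  show ?thesis using False by (simp add: dot_square_norm power2_eq_square)
qed

lemma support_fun_cont_pos_sphere:
  assumes "origin_body K"
  shows "cont_pos_sphere (support_fun K)"
proof -
  obtain r where r: "r > 0" "cball 0 r \<subseteq> K" using origin_body_inball[OF assms] .
  obtain R where R: "R > 0" "K \<subseteq> cball 0 R" using origin_body_outball[OF assms] .
  have K: "compact K" "K \<noteq> {}" using origin_body_compact[OF assms] origin_body_zero[OF assms] by auto
  have "continuous_on (sphere 0 1) (support_fun K)"
    by (rule continuous_on_Lipschitz_real[of _ _ R]) (rule support_fun_Lipschitz[OF K R(2)])
  moreover have "0 < support_fun K y" if "norm y = 1" for y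
    using support_fun_ge[OF K(1) r(2), of y] r that by simp
  ultimately show ?thesis by (simp add: cont_pos_sphere_def)
qed

lemma mem_iff_support_fun:
  assumes "compact K" "convex K" "K \<noteq> {}"
  shows "x \<in> K \<longleftrightarrow> (\<forall>y. norm y = 1 \<longrightarrow> x \<bullet> y \<le> support_fun K y)"
proof
  show "x \<in> K \<Longrightarrow> \<forall>y. norm y = 1 \<longrightarrow> x \<bullet> y \<le> support_fun K y"
    using inner_le_support_fun[OF assms(1)] by blast
  show "x \<in> K" if *: "\<forall>y. norm y = 1 \<longrightarrow> x \<bullet> y \<le> support_fun K y"
  proof (rule ccontr)
    assume "x \<notin> K"
    then obtain a b where ab: "a \<bullet> x < b" "\<forall>z\<in>K. b < a \<bullet> z"
      using separating_hyperplane_closed_point[OF assms(2) compact_imp_closed[OF assms(1)]] by blast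
    have a: "a \<noteq> 0" using ab assms(3) by auto
    \<comment> \<open>The separating functional is larger on \<open>K\<close> than at
      \<open>x\<close>, so the violated support inequality belongs to its negative.\<close>
    define y where "y = - (a /\<^sub>R norm a)"
    obtain z where z: "z \<in> K" "support_fun K y = z \<bullet> y" using support_fun_attained[OF assms(1,3)] by blast
    have "norm y = 1" using a by (simp add: y_def)
    then have "x \<bullet> y \<le> z \<bullet> y" using * z by metis
    then have "a \<bullet> z \<le> a \<bullet> x" using a by (simp add: y_def inner_commute divide_inverse mult_le_cancel_left)
    then show False using ab z by force
  qed
qed

lemma support_fun_eq_imp_eq:
  assumes "origin_body K" "origin_body L" "\<And>y. norm y = 1 \<Longrightarrow> support_fun K y = support_fun L y"
  shows "K = L"
proof -
  have "x \<in> K \<longleftrightarrow> x \<in> L" for x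
    using assms by (subst (1 2) mem_iff_support_fun) (auto dest: origin_body_compact origin_body_convex origin_body_zero)
  then show ?thesis by blast
qed

section \<open>Radial function and gauge\<close>

lemma scale_down_mem:
  assumes "origin_body K" "x \<in> K" "0 \<le> t" "t \<le> 1"
  shows "t *\<^sub>R x \<in> K"
  using convexD_alt[OF origin_body_convex[OF assms(1)] origin_body_zero[OF assms(1)] assms(2-4)] by simp

lemma radial_fun_ge_iff:
  assumes K: "origin_body K" and y: "y \<noteq> 0" and t: "t > 0"
  shows "t *\<^sub>R y \<in> K \<longleftrightarrow> t \<le> radial_fun K y"
proof -
  let ?S = "{t. t > 0 \<and> t *\<^sub>R y \<in> K}"
  obtain r where r: "r > 0" "cball 0 r \<subseteq> K" using origin_body_inball[OF K] .
  obtain R where R: "R > 0" "K \<subseteq> cball 0 R" using origin_body_outball[OF K] .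
  have "s \<le> R / norm y" if "s \<in> ?S" for s using that R y by (auto simp: field_simps)
  then have bdd: "bdd_above ?S" by (auto simp: bdd_above_def)
  have ne: "r / norm y \<in> ?S" using r y by (auto intro!: subsetD[OF r(2)])
  show ?thesis
  proof
    show "t *\<^sub>R y \<in> K \<Longrightarrow> t \<le> radial_fun K y"
      unfolding radial_fun_def using t bdd by (intro cSup_upper) auto
    assume le: "t \<le> radial_fun K y"
    have "s *\<^sub>R y \<in> K" if s: "0 < s" "s < t" for s
    proof -
      obtain s' where s': "s' \<in> ?S" "s < s'"
        using less_cSup_iff[OF _ bdd, of s] ne le s(2) unfolding radial_fun_def by force
      have "(s / s') *\<^sub>R (s' *\<^sub>R y) \<in> K"
        by (rule scale_down_mem[OF K]) (use s' s in auto)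
      then show ?thesis using s' s by simp
    qed
    \<comment> \<open>The shift by 2 keeps the factors strictly between 0 and 1 from
      \<open>n = 0\<close> on, while they still tend to 1; closedness of \<open>K\<close> then gives
      the endpoint.\<close>
    then have *: "\<And>n. (t * (1 - 1 / real (n + 2))) *\<^sub>R y \<in> K"
      by this (use t in \<open>auto simp: mult_less_cancel_left2\<close>)
    have "(\<lambda>n. 1 / real (n + 2)) \<longlonglongrightarrow> 0"
      using LIMSEQ_ignore_initial_segment[OF lim_1_over_n, of 2] by simp
    then have "(\<lambda>n. (t * (1 - 1 / real (n + 2))) *\<^sub>R y) \<longlonglongrightarrow> (t * (1 - 0)) *\<^sub>R y"
      by (intro tendsto_intros)
    then show "t *\<^sub>R y \<in> K"
      using closed_sequentially[OF compact_imp_closed[OF origin_body_compact[OF K]] *] by simp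
  qed
qed

lemma radial_fun_pos:
  assumes K: "origin_body K" and y: "y \<noteq> 0"
  shows "radial_fun K y > 0"
proof -
  obtain r where r: "r > 0" "cball 0 r \<subseteq> K" using origin_body_inball[OF K] .
  have "(r / norm y) *\<^sub>R y \<in> K" using r y by (auto intro!: subsetD[OF r(2)])
  then have "r / norm y \<le> radial_fun K y" using radial_fun_ge_iff[OF K y, of "r / norm y"] r y by simp
  then show ?thesis using r y by (meson divide_pos_pos less_le_trans zero_less_norm_iff)
qed

lemma gauge_fun_pos: "origin_body K \<Longrightarrow> y \<noteq> 0 \<Longrightarrow> gauge_fun K y > 0"
  by (simp add: gauge_fun_def radial_fun_pos)

lemma gauge_fun_le_iff:
  assumes "origin_body K" "y \<noteq> 0" "c > 0"
  shows "gauge_fun K y \<le> c \<longleftrightarrow> y /\<^sub>R c \<in> K"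
  using radial_fun_ge_iff[OF assms(1,2), of "inverse c"] radial_fun_pos[OF assms(1,2)] assms(3)
  by (simp add: gauge_fun_def field_simps)

lemma gauge_fun_mem: "origin_body K \<Longrightarrow> y \<noteq> 0 \<Longrightarrow> y /\<^sub>R gauge_fun K y \<in> K"
  using gauge_fun_le_iff gauge_fun_pos by blast

text \<open>Subadditivity of the gauge: \<open>z\<close> lies in \<open>m\<close> times
  \<open>K\<close> and \<open>y - z\<close> in \<open>d\<close> times \<open>K\<close>, so by
  convexity \<open>y\<close> lies in \<open>m + d\<close> times \<open>K\<close>. The inscribed ball
  provides \<open>d\<close>.\<close>

lemma gauge_fun_diff_le:
  assumes K: "origin_body K" and r: "r > 0" "cball 0 r \<subseteq> K" and yz: "y \<noteq> 0" "z \<noteq> 0"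
  shows "gauge_fun K y - gauge_fun K z \<le> norm (y - z) / r"
proof (cases "y = z")
  case False
  define m where "m = gauge_fun K z"
  define d where "d = norm (y - z) / r"
  have m: "m > 0" and d: "d > 0" using gauge_fun_pos[OF K yz(2)] r False by (auto simp: m_def d_def)
  have 1: "z /\<^sub>R m \<in> K" unfolding m_def by (rule gauge_fun_mem[OF K yz(2)])
  have 2: "(y - z) /\<^sub>R d \<in> K" using r False by (auto simp: d_def intro!: subsetD[OF r(2)])
  have "(m / (m + d)) *\<^sub>R (z /\<^sub>R m) + (d / (m + d)) *\<^sub>R ((y - z) /\<^sub>R d) \<in> K"
    by (rule convexD[OF origin_body_convex[OF K] 1 2]) (use m d in \<open>auto simp: add_divide_distrib[symmetric]\<close>)
  moreover have "(m / (m + d)) *\<^sub>R (z /\<^sub>R m) + (d / (m + d)) *\<^sub>R ((y - z) /\<^sub>R d) = y /\<^sub>R (m + d)"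
  proof -
    have "(m / (m + d)) *\<^sub>R (z /\<^sub>R m) = z /\<^sub>R (m + d)" "(d / (m + d)) *\<^sub>R ((y - z) /\<^sub>R d) = (y - z) /\<^sub>R (m + d)"
      using m d by (simp_all add: divide_inverse mult.commute)
    then show ?thesis by (simp only: flip: scaleR_right_distrib) simp
  qed
  ultimately have "gauge_fun K y \<le> m + d" using gauge_fun_le_iff[OF K yz(1), of "m + d"] m d by simp
  then show ?thesis by (simp add: m_def d_def)
qed simp

lemma gauge_fun_cont_pos_sphere:
  assumes K: "origin_body K"
  shows "cont_pos_sphere (gauge_fun K)"
proof -
  obtain r where r: "r > 0" "cball 0 r \<subseteq> K" using origin_body_inball[OF K] .
  have "continuous_on (sphere 0 1) (gauge_fun K)"
  proof (rule continuous_on_Lipschitz_real[of _ _ "1 / r"])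
    fix y z :: 'a assume "y \<in> sphere 0 1" "z \<in> sphere 0 1"
    then have "y \<noteq> 0" "z \<noteq> 0" by auto
    then show "\<bar>gauge_fun K y - gauge_fun K z\<bar> \<le> 1 / r * norm (y - z)"
      using gauge_fun_diff_le[OF K r, of y z] gauge_fun_diff_le[OF K r, of z y]
      by (simp add: abs_le_iff norm_minus_commute)
  qed
  moreover have "0 < gauge_fun K y" if "norm y = 1" for y
    using that by (intro gauge_fun_pos[OF K]) auto
  ultimately show ?thesis by (simp add: cont_pos_sphere_def)
qed

lemma Ipf_eq_power_integral:
  "weight c1 c2 f \<Longrightarrow> origin_body K \<Longrightarrow> Ipf f p K = ennreal (power_integral f p (support_fun K))"
  unfolding Ipf_def by (rule nn_integral_power_integral[OF _ support_fun_cont_pos_sphere])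

lemma Vq_eq_power_integral:
  fixes K :: "'a::euclidean_space set"
  assumes K: "origin_body K"
  shows "Vq q K = ennreal (power_integral (\<lambda>_. 1) (-q) (gauge_fun K))"
proof -
  have "Vq q K = (\<integral>\<^sup>+ y. ennreal (1 * gauge_fun K y powr (-q)) \<partial>sphere_measure)"
    unfolding Vq_def
  proof (rule nn_integral_cong)
    fix y :: 'a assume "y \<in> space sphere_measure"
    then have "y \<noteq> 0" by auto
    then show "ennreal (radial_fun K y powr q) = ennreal (1 * gauge_fun K y powr (-q))"
      using radial_fun_pos[OF K, of y] by (simp add: gauge_fun_def powr_minus powr_divide)
  qed
  then show ?thesis
    using nn_integral_power_integral[OF weight_one gauge_fun_cont_pos_sphere[OF K]] by simp
qed

lemma gauge_fun_eq_imp_eq: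
  assumes K: "origin_body K" and L: "origin_body L" and eq: "\<And>y. norm y = 1 \<Longrightarrow> gauge_fun K y = gauge_fun L y"
  shows "K = L"
proof -
  have "x \<in> K \<longleftrightarrow> x \<in> L" for x
  proof (cases "x = 0")
    case True then show ?thesis using origin_body_zero K L by auto
  next
    case False
    define y where "y = x /\<^sub>R norm x"
    have y: "norm y = 1" "y \<noteq> 0" "y /\<^sub>R (1 / norm x) = x" using False by (auto simp: y_def)
    show ?thesis
      using gauge_fun_le_iff[OF K y(2), of "1 / norm x"] gauge_fun_le_iff[OF L y(2), of "1 / norm x"] eq[OF y(1)] y(3) False
      by simp
  qed
  then show ?thesis by blast
qed

subsection \<open>Multiplicative closeness of bodies\<close>

text \<open>Closeness up to a common dilation. Dilations act on support functions and on gauges by a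
  scalar, so this form passes to both at once, whereas an additive distance would first have to be
  compared with the inradius.\<close>

definition mult_close :: "real \<Rightarrow> 'a::real_vector set \<Rightarrow> 'a set \<Rightarrow> bool" where
  "mult_close e A B \<longleftrightarrow> (\<forall>x\<in>A. x /\<^sub>R (1 + e) \<in> B) \<and> (\<forall>x\<in>B. x /\<^sub>R (1 + e) \<in> A)"

lemma mult_close_sym: "mult_close e A B \<longleftrightarrow> mult_close e B A"
  by (auto simp: mult_close_def)

lemma mult_close_support_fun:
  assumes "mult_close e A B" "origin_body A" "origin_body B" "e > 0"
  shows "support_fun A y \<le> (1 + e) * support_fun B y"
proof (rule support_fun_le)
  show "A \<noteq> {}" using origin_body_zero assms by auto
  fix x assume "x \<in> A"
  then have "(x /\<^sub>R (1 + e)) \<bullet> y \<le> support_fun B y"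
    using assms by (intro inner_le_support_fun) (auto simp: mult_close_def origin_body_compact)
  then show "x \<bullet> y \<le> (1 + e) * support_fun B y" using assms by (simp add: field_simps)
qed

lemma mult_close_gauge_fun:
  assumes "mult_close e A B" "origin_body A" "origin_body B" "e > 0" "y \<noteq> 0"
  shows "gauge_fun A y \<le> (1 + e) * gauge_fun B y"
proof -
  have "(y /\<^sub>R gauge_fun B y) /\<^sub>R (1 + e) \<in> A"
    using assms gauge_fun_mem[of B y] by (auto simp: mult_close_def)
  then show ?thesis
    using assms gauge_fun_pos[of B y] by (subst gauge_fun_le_iff) (auto simp: mult_ac)
qed

definition mult_converges :: "(nat \<Rightarrow> 'a::real_vector set) \<Rightarrow> 'a set \<Rightarrow> bool" where
  "mult_converges A B \<longleftrightarrow> (\<forall>e>0. \<forall>\<^sub>F n in sequentially. mult_close e (A n) B)"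

text \<open>Homogeneity replaces dominated convergence: functions within a factor
  \<open>1 + e\<close> of each other have integrals within the factor
  \<open>(1 + e) powr \<bar>s\<bar>\<close> of each other, and this factor tends to 1.\<close>

lemma tendsto_power_integral_mult:
  fixes f :: "'a::euclidean_space \<Rightarrow> real"
  assumes f: "weight c1 c2 f" and \<phi>: "cont_pos_sphere \<phi>" and \<phi>n: "\<And>n. cont_pos_sphere (\<phi>n n)"
    and close: "\<And>e. e > 0 \<Longrightarrow> \<forall>\<^sub>F n in sequentially. \<forall>y. norm y = 1 \<longrightarrow>
                  \<phi>n n y \<le> (1 + e) * \<phi> y \<and> \<phi> y \<le> (1 + e) * \<phi>n n y"
  shows "(\<lambda>n. power_integral f s (\<phi>n n)) \<longlonglongrightarrow> power_integral f s \<phi>"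
proof -
  define P where "P = power_integral f s"
  have P: "P \<psi> > 0" if "cont_pos_sphere \<psi>" for \<psi> unfolding P_def by (rule power_integral_pos[OF f that])
  have bound: "sgn s * P \<alpha> \<le> (1 + e) powr s * (sgn s * P \<beta>)"
    if "cont_pos_sphere \<alpha>" "cont_pos_sphere \<beta>" "e > 0" "\<And>y. norm y = 1 \<Longrightarrow> \<alpha> y \<le> (1 + e) * \<beta> y" for \<alpha> \<beta> e
  proof -
    have "sgn s * P \<alpha> \<le> sgn s * P (\<lambda>y. (1 + e) * \<beta> y)"
      unfolding P_def by (rule power_integral_mono[OF f that(1) cont_pos_sphere_scale[OF that(2)]]) (use that in auto)
    also have "P (\<lambda>y. (1 + e) * \<beta> y) = (1 + e) powr s * P \<beta>"
      unfolding P_def by (rule power_integral_scale) (use that in \<open>auto simp: cont_pos_sphere_def less_imp_le\<close>)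
    finally show ?thesis by (simp add: mult_ac)
  qed
  have two_sided: "P \<alpha> \<le> (1 + e) powr \<bar>s\<bar> * P \<beta>"
    if ab: "cont_pos_sphere \<alpha>" "cont_pos_sphere \<beta>" "e > 0" "\<And>y. norm y = 1 \<Longrightarrow> \<alpha> y \<le> (1 + e) * \<beta> y"
      "\<And>y. norm y = 1 \<Longrightarrow> \<beta> y \<le> (1 + e) * \<alpha> y" for \<alpha> \<beta> e
  proof (cases s "0::real" rule: linorder_cases)
    case less
    have "- P \<beta> \<le> (1 + e) powr s * (- P \<alpha>)" using bound[OF ab(2,1,3,5)] less by simp
    then show ?thesis using less ab(3) by (simp add: powr_minus field_simps)
  next
    \<comment> \<open>Here \<open>sgn s\<close> is 0 and \<open>bound\<close> carries no
      information; the integrals agree because positive numbers to the power 0 are 1.\<close>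
    case equal
    have "P \<gamma> = P \<beta>" if "cont_pos_sphere \<gamma>" for \<gamma>
      unfolding P_def power_integral_def equal
      by (rule Bochner_Integration.integral_cong) (use that ab in \<open>auto simp: cont_pos_sphere_def powr_zero_eq_one order_less_imp_not_eq2\<close>)
    from this[OF ab(1)] show ?thesis using equal ab by simp
  next
    case greater
    then show ?thesis using bound[OF ab(1,2,3,4)] by simp
  qed
  have lim: "((\<lambda>e. (1 + e) powr \<bar>s\<bar>) \<longlongrightarrow> (1 + 0) powr \<bar>s\<bar>) (at_right 0)"
    by (intro tendsto_intros) auto
  have "(\<lambda>n. P (\<phi>n n)) \<longlonglongrightarrow> P \<phi>"
  proof (rule order_tendstoI)
    fix a assume a: "P \<phi> < a"
    have "((\<lambda>e. (1 + e) powr \<bar>s\<bar> * P \<phi>) \<longlongrightarrow> (1 + 0) powr \<bar>s\<bar> * P \<phi>) (at_right 0)"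
      by (intro tendsto_intros lim)
    then have "\<forall>\<^sub>F e in at_right 0. (1 + e) powr \<bar>s\<bar> * P \<phi> < a"
      by (rule order_tendstoD(2)) (use a in simp)
    then obtain e where e: "e > 0" "(1 + e) powr \<bar>s\<bar> * P \<phi> < a"
      using eventually_conj[OF eventually_at_right_less] eventually_happens'[OF trivial_limit_at_right_real] by blast
    show "\<forall>\<^sub>F n in sequentially. P (\<phi>n n) < a"
      using close[OF e(1)]
    proof eventually_elim
      case (elim n)
      have "P (\<phi>n n) \<le> (1 + e) powr \<bar>s\<bar> * P \<phi>" by (rule two_sided[OF \<phi>n \<phi> e(1)]) (use elim in auto)
      then show ?case using e by linarith
    qed
  next
    fix a assume a: "a < P \<phi>"
    have "((\<lambda>e. P \<phi> / (1 + e) powr \<bar>s\<bar>) \<longlongrightarrow> P \<phi> / (1 + 0) powr \<bar>s\<bar>) (at_right 0)"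
      by (intro tendsto_intros lim) auto
    then have "\<forall>\<^sub>F e in at_right 0. a < P \<phi> / (1 + e) powr \<bar>s\<bar>"
      by (rule order_tendstoD(1)) (use a in simp)
    then obtain e where e: "e > 0" "a < P \<phi> / (1 + e) powr \<bar>s\<bar>"
      using eventually_conj[OF eventually_at_right_less] eventually_happens'[OF trivial_limit_at_right_real] by blast
    show "\<forall>\<^sub>F n in sequentially. a < P (\<phi>n n)"
      using close[OF e(1)]
    proof eventually_elim
      case (elim n)
      have "P \<phi> \<le> (1 + e) powr \<bar>s\<bar> * P (\<phi>n n)" by (rule two_sided[OF \<phi> \<phi>n e(1)]) (use elim in auto)
      then have "P \<phi> / (1 + e) powr \<bar>s\<bar> \<le> P (\<phi>n n)" using e(1) by (simp add: field_simps)
      then show ?case using e by linarith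
    qed
  qed
  then show ?thesis by (simp add: P_def)
qed

lemma tendsto_power_integral_support_fun:
  assumes f: "weight c1 c2 f" and "\<And>n. origin_body (A n)" "origin_body B" "mult_converges A B"
  shows "(\<lambda>n. power_integral f s (support_fun (A n))) \<longlonglongrightarrow> power_integral f s (support_fun B)"
proof (rule tendsto_power_integral_mult[OF f])
  fix e :: real assume e: "e > 0"
  have "\<forall>\<^sub>F n in sequentially. mult_close e (A n) B" using assms e by (simp add: mult_converges_def)
  then show "\<forall>\<^sub>F n in sequentially. \<forall>y. norm y = 1 \<longrightarrow>
     support_fun (A n) y \<le> (1 + e) * support_fun B y \<and> support_fun B y \<le> (1 + e) * support_fun (A n) y"
    by eventually_elim (use assms e mult_close_support_fun mult_close_sym in blast)
qed (use assms support_fun_cont_pos_sphere in auto)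

lemma tendsto_power_integral_gauge_fun:
  assumes f: "weight c1 c2 f" and "\<And>n. origin_body (A n)" "origin_body B" "mult_converges A B"
  shows "(\<lambda>n. power_integral f s (gauge_fun (A n))) \<longlonglongrightarrow> power_integral f s (gauge_fun B)"
proof (rule tendsto_power_integral_mult[OF f])
  fix e :: real assume e: "e > 0"
  have "\<forall>\<^sub>F n in sequentially. mult_close e (A n) B" using assms e by (simp add: mult_converges_def)
  then show "\<forall>\<^sub>F n in sequentially. \<forall>y. norm y = 1 \<longrightarrow>
     gauge_fun (A n) y \<le> (1 + e) * gauge_fun B y \<and> gauge_fun B y \<le> (1 + e) * gauge_fun (A n) y"
  proof eventually_elim
    case (elim n)
    then show ?case
      using assms e mult_close_gauge_fun[of e "A n" B] mult_close_gauge_fun[of e B "A n"] mult_close_sym[of e "A n" B]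
      by (metis norm_zero zero_neq_one)
  qed
qed (use assms gauge_fun_cont_pos_sphere in auto)

text \<open>Arzela-Ascoli for the support functions, which are \<open>R\<close>-Lipschitz and
  bounded by \<open>R\<close> on the sphere. The common inscribed ball upgrades uniform convergence
  to convergence up to dilation: an error \<open>e * r\<close> is at most \<open>e\<close> times any
  of these functions.\<close>

lemma Blaschke_selection:
  fixes A :: "nat \<Rightarrow> 'a::euclidean_space set"
  assumes A: "\<And>n. origin_body (A n)" and r: "r > 0" "\<And>n. cball 0 r \<subseteq> A n" and R: "\<And>n. A n \<subseteq> cball 0 R"
  obtains k B where "strict_mono (k :: nat \<Rightarrow> nat)" "origin_body B" "mult_converges (A \<circ> k) B"
proof -
  have AC: "compact (A n)" "convex (A n)" "A n \<noteq> {}" for n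
    using A[of n] origin_body_compact origin_body_convex origin_body_zero by auto
  have R0: "R > 0"
  proof -
    obtain x :: 'a where "norm x = r" using r(1) vector_choose_size[of r] by auto
    then have "x \<in> cball 0 R" using r(2) R by fastforce
    then show ?thesis using \<open>norm x = r\<close> r(1) by simp
  qed
  have h_lo: "r \<le> support_fun (A n) y" and h_hi: "\<bar>support_fun (A n) y\<bar> \<le> R" if "norm y = 1" for n y
  proof -
    show 1: "r \<le> support_fun (A n) y" using support_fun_ge[OF AC(1)[of n] r(2)[of n], of y] r that by simp
    have "support_fun (A n) 0 = 0" using support_fun_attained[OF AC(1)[of n] AC(3)[of n], of 0] by force
    then show "\<bar>support_fun (A n) y\<bar> \<le> R"
      using support_fun_Lipschitz[OF AC(1)[of n] AC(3)[of n] R[of n], of y 0] that by simp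
  qed
  obtain g k where g: "continuous_on (sphere 0 1) g" and k: "strict_mono (k :: nat \<Rightarrow> nat)"
    and lim: "\<And>e. 0 < e \<Longrightarrow> \<exists>N. \<forall>n x. n \<ge> N \<and> x \<in> sphere 0 1 \<longrightarrow> norm (support_fun (A (k n)) x - g x) < e"
  proof (rule Arzela_Ascoli[of "sphere (0::'a) 1" "\<lambda>n. support_fun (A n)" R])
    show "norm (support_fun (A n) x) \<le> R" if "x \<in> sphere 0 1" for n x using h_hi that by simp
    show "\<exists>d>0. \<forall>n y. y \<in> sphere 0 1 \<and> norm (x - y) < d \<longrightarrow> norm (support_fun (A n) x - support_fun (A n) y) < e"
      if "x \<in> sphere 0 1" "0 < e" for x e
    proof (intro exI[of _ "e / R"] conjI allI impI)
      show "e / R > 0" using that R0 by simp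
      fix n y assume "y \<in> sphere 0 1 \<and> norm (x - y) < e / R"
      then have "R * norm (x - y) < e" using R0 by (simp add: field_simps)
      then show "norm (support_fun (A n) x - support_fun (A n) y) < e"
        using support_fun_Lipschitz[OF AC(1)[of n] AC(3)[of n] R[of n], of x y] by simp
    qed
  qed (auto intro: that)
  have g_lo: "r \<le> g y" if y: "norm y = 1" for y
  proof (rule field_le_epsilon)
    fix e :: real assume "e > 0"
    then obtain N where "norm (support_fun (A (k N)) y - g y) < e" using lim y by fastforce
    then show "r \<le> g y + e" using h_lo[OF y, of "k N"] by simp
  qed
  have g_hi: "g y \<le> R" if y: "norm y = 1" for y
  proof (rule field_le_epsilon)
    fix e :: real assume "e > 0"
    then obtain N where "norm (support_fun (A (k N)) y - g y) < e" using lim y by fastforce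
    then show "g y \<le> R + e" using h_hi[OF y, of "k N"] by simp
  qed
  \<comment> \<open>The limit body is the intersection of the half-spaces prescribed by the limit
    function. Comparing \<open>g\<close> with the support functions in both directions gives the two
    inclusions up to dilation.\<close>
  define B where "B = (\<Inter>y\<in>sphere 0 1. {x. y \<bullet> x \<le> g y})"
  have memB: "x \<in> B \<longleftrightarrow> (\<forall>y. norm y = 1 \<longrightarrow> x \<bullet> y \<le> g y)" for x
    by (auto simp: B_def inner_commute)
  have "closed B" "convex B"
    unfolding B_def by (auto intro!: closed_INT convex_INT closed_halfspace_le convex_halfspace_le)
  moreover have "B \<subseteq> cball 0 R"
  proof
    fix x assume x: "x \<in> B"
    show "x \<in> cball 0 R"
    proof (cases "x = 0")
      case False
      have "norm (x /\<^sub>R norm x) = 1" using False by simp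
      then have "x \<bullet> (x /\<^sub>R norm x) \<le> g (x /\<^sub>R norm x)" using x memB by blast
      also have "\<dots> \<le> R" using False by (intro g_hi) simp
      finally show ?thesis using False by (simp add: dot_square_norm power2_eq_square field_simps)
    qed (use R0 in simp)
  qed
  moreover have "cball 0 r \<subseteq> B"
  proof
    fix x :: 'a assume x: "x \<in> cball 0 r"
    have "x \<bullet> y \<le> g y" if "norm y = 1" for y
    proof -
      have "x \<bullet> y \<le> norm x * norm y" by (rule norm_cauchy_schwarz)
      also have "\<dots> \<le> r" using x that by simp
      finally show ?thesis using g_lo[OF that] by simp
    qed
    then show "x \<in> B" by (simp add: memB)
  qed
  ultimately have B: "origin_body B"
    by (intro origin_bodyI[of _ r] r) (auto simp: compact_eq_bounded_closed intro: bounded_subset[OF bounded_cball])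
  have "\<forall>\<^sub>F n in sequentially. mult_close e ((A \<circ> k) n) B" if e: "e > 0" for e
  proof -
    have "0 < e * r" using e r by simp
    then obtain N where N: "\<forall>n x. n \<ge> N \<and> x \<in> sphere 0 1 \<longrightarrow> norm (support_fun (A (k n)) x - g x) < e * r"
      using lim by blast
    have "mult_close e (A (k n)) B" if n: "n \<ge> N" for n
    proof -
      have d: "\<bar>support_fun (A (k n)) y - g y\<bar> < e * r" if "norm y = 1" for y
        using N n that by (simp add: real_norm_def)
      have 1: "support_fun (A (k n)) y \<le> (1 + e) * g y" if y: "norm y = 1" for y
      proof -
        have "e * r \<le> e * g y" using e g_lo[OF y] by simp
        then show ?thesis using d[OF y] by (simp add: algebra_simps abs_less_iff)
      qed
      have 2: "g y \<le> (1 + e) * support_fun (A (k n)) y" if y: "norm y = 1" for y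
      proof -
        have "e * r \<le> e * support_fun (A (k n)) y" using e h_lo[OF y] by simp
        then show ?thesis using d[OF y] by (simp add: algebra_simps abs_less_iff)
      qed
      have "x /\<^sub>R (1 + e) \<in> B" if x: "x \<in> A (k n)" for x
        unfolding memB
      proof (intro allI impI)
        fix y :: 'a assume y: "norm y = 1"
        have "x \<bullet> y \<le> (1 + e) * g y" using inner_le_support_fun[OF AC(1) x, of y] 1[OF y] by linarith
        then show "(x /\<^sub>R (1 + e)) \<bullet> y \<le> g y" using e by (simp add: field_simps)
      qed
      moreover have "x /\<^sub>R (1 + e) \<in> A (k n)" if x: "x \<in> B" for x
        unfolding mem_iff_support_fun[OF AC]
      proof (intro allI impI)
        fix y :: 'a assume y: "norm y = 1"
        have "x \<bullet> y \<le> g y" using x y memB by blast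
        then have "x \<bullet> y \<le> (1 + e) * support_fun (A (k n)) y" using 2[OF y] by linarith
        then show "(x /\<^sub>R (1 + e)) \<bullet> y \<le> support_fun (A (k n)) y" using e by (simp add: field_simps)
      qed
      ultimately show ?thesis by (simp add: mult_close_def)
    qed
    then show ?thesis by (auto simp: eventually_sequentially)
  qed
  then have "mult_converges (A \<circ> k) B" by (simp add: mult_converges_def)
  with k B show ?thesis using that by blast
qed

text \<open>A point of \<open>B\<close> is shrunk into some \<open>A n\<close>, moved by
  \<open>g\<close> there, and shrunk again into \<open>B\<close>. The factor \<open>1 + e\<close> is
  paid twice, hence \<open>c m * c m\<close>; closedness of \<open>B\<close> removes it in the
  limit.\<close>

lemma mult_converges_invariant:
  assumes g: "linear g" and inv: "\<And>n. g ` A n \<subseteq> A n" and lim: "mult_converges A B" and B: "origin_body B"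
  shows "g ` B \<subseteq> B"
proof
  fix z assume "z \<in> g ` B"
  then obtain x where x: "x \<in> B" "z = g x" by auto
  define c where "c m = 1 + inverse (real (Suc m))" for m
  have mem: "z /\<^sub>R (c m * c m) \<in> B" for m
  proof -
    define e where "e = inverse (real (Suc m))"
    have "\<forall>\<^sub>F n in sequentially. mult_close e (A n) B" using lim by (simp add: mult_converges_def e_def)
    then obtain n where n: "mult_close e (A n) B" by (meson eventually_happens' sequentially_bot)
    have "x /\<^sub>R (1 + e) \<in> A n" using n x by (simp add: mult_close_def)
    then have "g (x /\<^sub>R (1 + e)) \<in> A n" using inv by blast
    then have "g (x /\<^sub>R (1 + e)) /\<^sub>R (1 + e) \<in> B" using n by (simp add: mult_close_def)
    then show ?thesis by (simp add: linear_cmul[OF g] x e_def c_def)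
  qed
  have "c \<longlonglongrightarrow> 1 + 0" unfolding c_def by (intro tendsto_intros LIMSEQ_inverse_real_of_nat)
  then have "(\<lambda>m. z /\<^sub>R (c m * c m)) \<longlonglongrightarrow> z /\<^sub>R ((1 + 0) * (1 + 0))"
    by (intro tendsto_intros) auto
  then show "z \<in> B"
    using closed_sequentially[OF compact_imp_closed[OF origin_body_compact[OF B]] mem] by simp
qed

subsection \<open>Hausdorff distance\<close>

lemma hausdist_leI:
  assumes "A \<noteq> {}" "B \<noteq> {}" "\<And>x. x \<in> A \<Longrightarrow> \<exists>y\<in>B. dist x y \<le> e" "\<And>y. y \<in> B \<Longrightarrow> \<exists>x\<in>A. dist x y \<le> e"
  shows "hausdist A B \<le> e"
proof -
  have "infdist x B \<le> e" if "x \<in> A" for x using assms(3)[OF that] by (meson infdist_le2)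
  moreover have "infdist y A \<le> e" if "y \<in> B" for y using assms(4)[OF that] by (metis infdist_le2 dist_commute)
  ultimately show ?thesis using assms(1,2) by (auto simp: hausdist_def intro!: cSUP_least)
qed

lemma bdd_above_infdist:
  assumes "bounded A" "B \<noteq> {}" shows "bdd_above ((\<lambda>x. infdist x B) ` A)"
proof -
  obtain b where b: "b \<in> B" using assms by auto
  obtain c where c: "\<And>x. x \<in> A \<Longrightarrow> dist b x \<le> c" using assms(1) bounded_any_center[of A b] by auto
  show ?thesis by (rule bdd_aboveI2[of _ _ c]) (metis b c infdist_le2 dist_commute)
qed

lemma hausdist_commute: "hausdist A B = hausdist B A"
  by (simp add: hausdist_def max.commute)

text \<open>Compactness is used twice: it bounds the set of distances, so that the real
  \<open>SUP\<close> is a true supremum, and it makes the distance to \<open>B\<close>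
  attained.\<close>

lemma hausdistD:
  fixes A B :: "'a::heine_borel set"
  assumes "compact A" "compact B" "B \<noteq> {}" "x \<in> A"
  obtains y where "y \<in> B" "dist x y \<le> hausdist A B"
proof -
  have "infdist x B \<le> (SUP x\<in>A. infdist x B)"
    by (rule cSUP_upper[OF assms(4) bdd_above_infdist]) (use assms compact_imp_bounded in auto)
  also have "\<dots> \<le> hausdist A B" by (simp add: hausdist_def)
  finally show ?thesis
    using infdist_attains_inf[OF compact_imp_closed[OF assms(2)] assms(3), of x] that by metis
qed

lemma hausdist_triangle:
  fixes A B C :: "'a::heine_borel set"
  assumes A: "compact A" "A \<noteq> {}" and B: "compact B" "B \<noteq> {}" and C: "compact C" "C \<noteq> {}"
  shows "hausdist A C \<le> hausdist A B + hausdist B C"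
proof (rule hausdist_leI[OF A(2) C(2)])
  fix x assume "x \<in> A"
  obtain y where y: "y \<in> B" "dist x y \<le> hausdist A B" using hausdistD[OF A(1) B \<open>x \<in> A\<close>] .
  obtain z where z: "z \<in> C" "dist y z \<le> hausdist B C" using hausdistD[OF B(1) C y(1)] .
  show "\<exists>z\<in>C. dist x z \<le> hausdist A B + hausdist B C"
    using y z dist_triangle[of x z y] by (intro bexI[of _ z]) auto
next
  fix z assume "z \<in> C"
  obtain y where y: "y \<in> B" "dist z y \<le> hausdist C B" using hausdistD[OF C(1) B \<open>z \<in> C\<close>] .
  obtain x where x: "x \<in> A" "dist y x \<le> hausdist B A" using hausdistD[OF B(1) A y(1)] .
  show "\<exists>x\<in>A. dist x z \<le> hausdist A B + hausdist B C"
    using x y dist_triangle[of z x y] by (intro bexI[of _ x]) (auto simp: dist_commute hausdist_commute)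
qed

text \<open>Shrinking by \<open>1 + e\<close> moves a point by at most \<open>e\<close> times its
  norm, so closeness up to dilation controls the Hausdorff distance in a fixed ball.\<close>

lemma hausdist_mult_close_le:
  assumes "mult_close e A B" "origin_body A" "origin_body B" "e > 0" "A \<subseteq> cball 0 R" "B \<subseteq> cball 0 R"
  shows "hausdist A B \<le> e * R"
proof -
  have *: "dist x (x /\<^sub>R (1 + e)) \<le> e * R" if "norm x \<le> R" for x :: 'a
  proof -
    have "x - x /\<^sub>R (1 + e) = (e / (1 + e)) *\<^sub>R x"
      using assms(4) by (simp add: scaleR_left_diff_distrib[of 1, symmetric, simplified] field_simps)
    then have "dist x (x /\<^sub>R (1 + e)) = e / (1 + e) * norm x" using assms(4) by (simp add: dist_norm)
    also have "\<dots> \<le> e * R" by (rule mult_mono) (use assms(4) that in \<open>auto simp: field_simps\<close>)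
    finally show ?thesis .
  qed
  show ?thesis
  proof (rule hausdist_leI)
    show "A \<noteq> {}" "B \<noteq> {}" using assms origin_body_zero by auto
    show "\<exists>y\<in>B. dist x y \<le> e * R" if "x \<in> A" for x
      using * that assms by (intro bexI[of _ "x /\<^sub>R (1 + e)"]) (auto simp: mult_close_def)
    show "\<exists>x\<in>A. dist x y \<le> e * R" if "y \<in> B" for y
      using *[of y] that assms by (intro bexI[of _ "y /\<^sub>R (1 + e)"]) (auto simp: mult_close_def dist_commute)
  qed
qed

subsection \<open>Orbit maxima of finite orthogonal groups\<close>

locale finite_orthogonal_group =
  fixes G :: "('a::euclidean_space \<Rightarrow> 'a) set"
  assumes fin: "finite G"
    and orth: "g \<in> G \<Longrightarrow> orthogonal_transformation g"
    and id_mem: "(\<lambda>x. x) \<in> G"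
    and comp_mem: "g \<in> G \<Longrightarrow> h \<in> G \<Longrightarrow> (\<lambda>x. g (h x)) \<in> G"
    and inv_mem: "g \<in> G \<Longrightarrow> inv g \<in> G"
begin

definition orbit_max :: "'a \<Rightarrow> 'a \<Rightarrow> real" where
  "orbit_max x y = Max ((\<lambda>g. g x \<bullet> y) ` G)"

definition stab :: "'a \<Rightarrow> ('a \<Rightarrow> 'a) set" where
  "stab v = {g \<in> G. g v = v}"

lemma lin: "g \<in> G \<Longrightarrow> linear g" using orth by (simp add: orthogonal_transformation_linear)
lemma norm_act [simp]: "g \<in> G \<Longrightarrow> norm (g x) = norm x" using orth by (simp add: orthogonal_transformation_norm)
lemma inner_act: "g \<in> G \<Longrightarrow> g x \<bullet> g y = x \<bullet> y" using orth by (simp add: orthogonal_transformation_def)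
lemma act_inv: "g \<in> G \<Longrightarrow> g (inv g x) = x"
  by (meson orth orthogonal_transformation_surj surj_f_inv_f)
lemma inv_act: "g \<in> G \<Longrightarrow> inv g (g x) = x"
  by (meson orth orthogonal_transformation_inj inv_f_f)
lemma inner_act_inv: "g \<in> G \<Longrightarrow> g x \<bullet> y = x \<bullet> inv g y"
  by (metis inner_act act_inv)

lemma orbit_max_ge: "g \<in> G \<Longrightarrow> g x \<bullet> y \<le> orbit_max x y"
  unfolding orbit_max_def using fin by (intro Max_ge) auto

lemma orbit_max_attained: obtains g where "g \<in> G" "orbit_max x y = g x \<bullet> y"
proof -
  have "orbit_max x y \<in> (\<lambda>g. g x \<bullet> y) ` G"
    unfolding orbit_max_def using fin id_mem by (intro Max_in) auto
  then show ?thesis using that by auto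
qed

lemma orbit_max_le_iff: "orbit_max x y \<le> c \<longleftrightarrow> (\<forall>g\<in>G. g x \<bullet> y \<le> c)"
  using orbit_max_ge orbit_max_attained by (metis order_trans)

lemma orbit_max_scale:
  assumes "c \<ge> 0" shows "orbit_max (c *\<^sub>R x) y = c * orbit_max x y"
proof (rule antisym)
  show "orbit_max (c *\<^sub>R x) y \<le> c * orbit_max x y"
    unfolding orbit_max_le_iff using orbit_max_ge assms by (auto simp: linear_cmul[OF lin] mult_left_mono)
  obtain g where "g \<in> G" "orbit_max x y = g x \<bullet> y" by (rule orbit_max_attained)
  then show "c * orbit_max x y \<le> orbit_max (c *\<^sub>R x) y"
    using orbit_max_ge[of g "c *\<^sub>R x" y] by (simp add: linear_cmul[OF lin])
qed

lemma orbit_max_le_norm: "orbit_max x y \<le> norm x * norm y"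
  unfolding orbit_max_le_iff using norm_cauchy_schwarz by (metis norm_act)

lemma orbit_max_diff_le: "orbit_max x y - orbit_max x' y' \<le> norm x * norm (y - y') + norm (x - x') * norm y'"
proof -
  obtain g where g: "g \<in> G" "orbit_max x y = g x \<bullet> y" by (rule orbit_max_attained)
  have "g x \<bullet> y - g x' \<bullet> y' = g x \<bullet> (y - y') + g (x - x') \<bullet> y'"
    by (simp add: linear_diff[OF lin[OF g(1)]] inner_diff_left inner_diff_right)
  also have "\<dots> \<le> norm x * norm (y - y') + norm (x - x') * norm y'"
    using norm_cauchy_schwarz[of "g x" "y - y'"] norm_cauchy_schwarz[of "g (x - x')" y'] g(1) by simp
  finally show ?thesis using g orbit_max_ge[OF g(1), of x' y'] by linarith
qed

lemma continuous_on_orbit_max: "continuous_on S (orbit_max x)"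
proof (rule continuous_on_Lipschitz_real[of _ _ "norm x"])
  fix y z
  show "\<bar>orbit_max x y - orbit_max x z\<bar> \<le> norm x * norm (y - z)"
    using orbit_max_diff_le[of x y x z] orbit_max_diff_le[of x z x y] by (simp add: norm_minus_commute abs_le_iff)
qed

text \<open>Composition with \<open>h\<close> on the left permutes the stabilizer.\<close>

lemma sum_stab_fixed:
  assumes h: "h \<in> stab v" shows "h (\<Sum>g\<in>stab v. g u) = (\<Sum>g\<in>stab v. g u)"
proof -
  have hG: "h \<in> G" "h v = v" using h by (auto simp: stab_def)
  have ih: "inv h v = v" using inv_act[OF hG(1), of v] hG by simp
  have "h (\<Sum>g\<in>stab v. g u) = (\<Sum>g\<in>stab v. h (g u))" using lin[OF hG(1)] by (simp add: linear_sum)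
  also have "\<dots> = (\<Sum>g\<in>stab v. g u)"
    by (rule sum.reindex_bij_witness[of _ "\<lambda>g x. inv h (g x)" "\<lambda>g x. h (g x)"])
       (use hG ih comp_mem[OF inv_mem[OF hG(1)]] comp_mem[OF hG(1)] in \<open>auto simp: stab_def inv_act act_inv\<close>)
  finally show ?thesis .
qed

lemma finite_stab: "finite (stab v)" and id_stab: "(\<lambda>x. x) \<in> stab v"
  using fin id_mem by (auto simp: stab_def)

text \<open>The sum is fixed by the stabilizer, hence a multiple of \<open>v\<close>; it is also
  orthogonal to \<open>v\<close>, because stabilizer elements preserve the inner product with
  \<open>v\<close>.\<close>

lemma sum_stab_eq_0:
  assumes fixv: "\<And>x. (\<And>g. g \<in> stab v \<Longrightarrow> g x = x) \<Longrightarrow> x \<in> span {v}" and u: "u \<bullet> v = 0"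
  shows "(\<Sum>g\<in>stab v. g u) = 0"
proof -
  let ?z = "\<Sum>g\<in>stab v. g u"
  have "?z \<in> span {v}" using fixv sum_stab_fixed by blast
  then obtain c where c: "?z = c *\<^sub>R v" by (auto simp: span_singleton)
  have "?z \<bullet> v = (\<Sum>g\<in>stab v. g u \<bullet> v)" by (simp add: inner_sum_left)
  also have "\<dots> = 0"
  proof (rule sum.neutral, intro ballI)
    fix g assume g: "g \<in> stab v"
    then show "g u \<bullet> v = 0" using inner_act[of g u v] u by (simp add: stab_def)
  qed
  finally have "c * (v \<bullet> v) = 0" using c by simp
  then show ?thesis using c by auto
qed

text \<open>The numbers \<open>g u \<bullet> y\<close> sum to zero over the stabilizer. If the
  identity contributes a negative number, the others, at most \<open>card G - 1\<close> of them,
  must compensate for it, which is impossible if none exceeds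
  \<open>\<bar>u \<bullet> y\<bar> / card G\<close>.\<close>

lemma stab_inner_ge:
  assumes fixv: "\<And>x. (\<And>g. g \<in> stab v \<Longrightarrow> g x = x) \<Longrightarrow> x \<in> span {v}" and u: "u \<bullet> v = 0"
  obtains h where "h \<in> stab v" "h u \<bullet> y \<ge> \<bar>u \<bullet> y\<bar> / card G"
proof -
  have N: "card G > 0" using fin id_mem by (auto simp: card_gt_0_iff)
  have s0: "(\<Sum>g\<in>stab v. g u \<bullet> y) = 0"
    using sum_stab_eq_0[OF assms] by (simp flip: inner_sum_left)
  note * = that
  show ?thesis
  proof (cases "u \<bullet> y \<ge> 0")
    case True
    have "\<bar>u \<bullet> y\<bar> / card G \<le> u \<bullet> y" using True N by (simp add: field_simps mult_le_cancel_left1)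
    then show ?thesis using that[OF id_stab] by simp
  next
    case False
    show ?thesis
    proof (rule ccontr)
      assume "\<not> thesis"
      then have lt: "h u \<bullet> y \<le> \<bar>u \<bullet> y\<bar> / card G" if "h \<in> stab v" for h
        using that * by (meson le_cases)
      have "0 = u \<bullet> y + (\<Sum>g\<in>stab v - {\<lambda>x. x}. g u \<bullet> y)"
        using s0 sum.remove[OF finite_stab id_stab, of "\<lambda>g. g u \<bullet> y"] by simp
      also have "(\<Sum>g\<in>stab v - {\<lambda>x. x}. g u \<bullet> y) \<le> (\<Sum>g\<in>stab v - {\<lambda>x. x}. \<bar>u \<bullet> y\<bar> / card G)"
        by (rule sum_mono) (use lt in auto)
      also have "\<dots> = real (card (stab v - {\<lambda>x. x})) * (\<bar>u \<bullet> y\<bar> / card G)" by simp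
      also have "\<dots> \<le> real (card G - 1) * (\<bar>u \<bullet> y\<bar> / card G)"
      proof (rule mult_right_mono)
        have "card (stab v - {\<lambda>x. x}) \<le> card (G - {\<lambda>x. x})"
          by (rule card_mono) (use fin in \<open>auto simp: stab_def\<close>)
        then show "real (card (stab v - {\<lambda>x. x})) \<le> real (card G - 1)" using id_mem fin by simp
      qed simp
      also have "\<dots> < card G * (\<bar>u \<bullet> y\<bar> / card G)"
        using N False by (intro mult_strict_right_mono divide_pos_pos) auto
      also have "\<dots> = \<bar>u \<bullet> y\<bar>" using N by simp
      finally show False using False by simp
    qed
  qed
qed

text \<open>An element \<open>g\<close> optimal for \<open>v\<close> is composed with some
  \<open>h\<close> in the stabilizer of \<open>v\<close>: then \<open>g (h (v + u))\<close> equals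
  \<open>g v\<close> plus \<open>g (h u)\<close>, and \<open>h\<close> can be chosen to make the
  second term contribute nonnegatively. Where \<open>v\<close> itself is optimal, \<open>h\<close>
  alone yields a gain proportional to \<open>\<bar>u \<bullet> y\<bar>\<close>.\<close>

lemma orbit_max_add_ge:
  assumes fixv: "\<And>x. (\<And>g. g \<in> stab v \<Longrightarrow> g x = x) \<Longrightarrow> x \<in> span {v}" and u: "u \<bullet> v = 0"
  shows "orbit_max v y \<le> orbit_max (v + u) y"
    and "orbit_max v y = v \<bullet> y \<Longrightarrow> orbit_max v y + \<bar>u \<bullet> y\<bar> / card G \<le> orbit_max (v + u) y"
proof -
  obtain g where g: "g \<in> G" "orbit_max v y = g v \<bullet> y" by (rule orbit_max_attained)
  obtain h where h: "h \<in> stab v" "h u \<bullet> inv g y \<ge> \<bar>u \<bullet> inv g y\<bar> / card G" using stab_inner_ge[OF assms] .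
  have hG: "h \<in> G" "h v = v" using h by (auto simp: stab_def)
  have "g (h (v + u)) \<bullet> y = g v \<bullet> y + h u \<bullet> inv g y"
    by (simp add: linear_add[OF lin[OF hG(1)]] linear_add[OF lin[OF g(1)]] hG inner_add_left inner_act_inv[OF g(1), of "h u"])
  moreover have "0 \<le> h u \<bullet> inv g y" using h(2) by (meson divide_nonneg_nonneg abs_ge_zero of_nat_0_le_iff order_trans)
  ultimately show "orbit_max v y \<le> orbit_max (v + u) y"
    using orbit_max_ge[OF comp_mem[OF g(1) hG(1)], of "v + u" y] g by simp
next
  assume eq: "orbit_max v y = v \<bullet> y"
  obtain h where h: "h \<in> stab v" "h u \<bullet> y \<ge> \<bar>u \<bullet> y\<bar> / card G" using stab_inner_ge[OF assms] .
  have hG: "h \<in> G" "h v = v" using h by (auto simp: stab_def)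
  show "orbit_max v y + \<bar>u \<bullet> y\<bar> / card G \<le> orbit_max (v + u) y"
    using orbit_max_ge[OF hG(1), of "v + u" y] h(2) eq
    by (simp add: linear_add[OF lin[OF hG(1)]] hG inner_add_left)
qed

end

text \<open>Mean value theorem: the signed power has derivative
  \<open>\<bar>s\<bar> * z powr (s - 1)\<close>. Which end of the interval minimizes it depends on
  the sign of \<open>s - 1\<close>, hence the \<open>min\<close>.\<close>

lemma sgn_powr_increment:
  fixes a b s a0 B :: real
  assumes "0 < a0" "a0 \<le> a" "0 \<le> b" "a + b \<le> B"
  shows "sgn s * a powr s + \<bar>s\<bar> * min (a0 powr (s - 1)) (B powr (s - 1)) * b \<le> sgn s * (a + b) powr s"
proof (cases "b = 0")
  case False
  have "\<exists>z>a. z < a + b \<and> (a + b) powr s - a powr s = (a + b - a) * (s * z powr (s - 1))"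
    by (rule MVT2) (use assms False in \<open>auto intro!: derivative_eq_intros\<close>)
  then obtain z where z: "a < z" "z < a + b" "(a + b) powr s - a powr s = b * (s * z powr (s - 1))" by auto
  have m: "min (a0 powr (s - 1)) (B powr (s - 1)) \<le> z powr (s - 1)"
  proof (cases "s \<ge> 1")
    case True
    have "a0 powr (s - 1) \<le> z powr (s - 1)" using True z assms by (intro powr_mono2) auto
    then show ?thesis by simp
  next
    case False
    have "B powr (s - 1) \<le> z powr (s - 1)" using False z assms by (intro powr_mono2') auto
    then show ?thesis by simp
  qed
  have "sgn s * (a + b) powr s - sgn s * a powr s = sgn s * (b * (s * z powr (s - 1)))"
    by (simp only: z(3)[symmetric] right_diff_distrib)
  also have "\<dots> = \<bar>s\<bar> * z powr (s - 1) * b" by (simp add: abs_sgn mult_ac)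
  finally show ?thesis using mult_right_mono[OF mult_left_mono[OF m, of "\<bar>s\<bar>"], of b] assms by linarith
qed simp

text \<open>The integral is continuous and positively homogeneous in \<open>u\<close>, so its
  minimum over unit vectors serves as \<open>C\<close>. It is positive because no nonempty open
  piece of the sphere lies in a hyperplane through the origin.\<close>

lemma cap_integral_lower_bound:
  fixes W :: "'a::euclidean_space set"
  assumes W: "openin (top_of_set (sphere 0 1)) W" "W \<noteq> {}"
  obtains C where "C > 0" "\<And>u. C * norm u \<le> (LINT y|sphere_measure. indicator W y * \<bar>u \<bullet> y\<bar>)"
proof -
  interpret finite_measure "sphere_measure :: 'a measure" by (rule finite_measure_sphere_measure)
  let ?m = "\<lambda>u. LINT y|sphere_measure. indicator W y * \<bar>u \<bullet> y\<bar>"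
  have Wm: "W \<in> sets sphere_measure"
    using W by (auto simp: sets_sphere_measure sets_restrict_space_iff openin_open)
  have meas: "(\<lambda>y. u \<bullet> y) \<in> borel_measurable sphere_measure" for u :: 'a
    by (rule continuous_on_measurable_sphere_measure) (intro continuous_intros)
  have int: "integrable sphere_measure (\<lambda>y. indicator W y * \<bar>u \<bullet> y\<bar>)" for u
  proof (rule integrable_const_bound[where B = "norm u"])
    show "AE y in sphere_measure. norm (indicat_real W y * \<bar>u \<bullet> y\<bar>) \<le> norm u"
    proof (intro AE_I2)
      fix y :: 'a assume "y \<in> space sphere_measure"
      then have "\<bar>u \<bullet> y\<bar> \<le> norm u" using Cauchy_Schwarz_ineq2[of u y] by simp
      then show "norm (indicat_real W y * \<bar>u \<bullet> y\<bar>) \<le> norm u" by (auto simp: indicator_def)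
    qed
    show "(\<lambda>y. indicat_real W y * \<bar>u \<bullet> y\<bar>) \<in> borel_measurable sphere_measure"
      using Wm meas[of u] by measurable
  qed
  let ?S = "measure (sphere_measure :: 'a measure) (sphere 0 1)"
  have diff: "?m u - ?m u' \<le> ?S * norm (u - u')" for u u'
  proof -
    have "?m u - ?m u' = (LINT y|sphere_measure. indicator W y * \<bar>u \<bullet> y\<bar> - indicator W y * \<bar>u' \<bullet> y\<bar>)"
      by (rule Bochner_Integration.integral_diff[OF int int, symmetric])
    also have "\<dots> \<le> (LINT y|(sphere_measure :: 'a measure). norm (u - u'))"
    proof (rule integral_mono[OF Bochner_Integration.integrable_diff[OF int int]])
      fix y :: 'a assume "y \<in> space sphere_measure"
      then have "\<bar>(u - u') \<bullet> y\<bar> \<le> norm (u - u')" using Cauchy_Schwarz_ineq2[of "u - u'" y] by simp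
      then show "indicator W y * \<bar>u \<bullet> y\<bar> - indicator W y * \<bar>u' \<bullet> y\<bar> \<le> norm (u - u')"
        by (auto simp: indicator_def inner_diff_left)
    qed simp
    finally show ?thesis by (simp add: mult_ac)
  qed
  have "continuous_on (sphere 0 1) ?m"
  proof (rule continuous_on_Lipschitz_real[of _ _ ?S])
    fix u u' :: 'a
    show "\<bar>?m u - ?m u'\<bar> \<le> ?S * norm (u - u')"
      using diff[of u u'] diff[of u' u] by (simp add: norm_minus_commute abs_le_iff)
  qed
  moreover have "sphere (0::'a) 1 \<noteq> {}" using ex_norm_one by auto
  ultimately obtain u0 where u0: "u0 \<in> sphere 0 1" "\<forall>u\<in>sphere 0 1. ?m u0 \<le> ?m u"
    using continuous_attains_inf[OF compact_sphere] by blast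
  have "?m u0 > 0"
  proof (rule integral_sphere_measure_pos[OF int, where W = "W \<inter> {y. u0 \<bullet> y \<noteq> 0}"])
    have "open {y. u0 \<bullet> y \<noteq> 0}" by (intro open_Collect_neq continuous_intros)
    then show "openin (top_of_set (sphere 0 1)) (W \<inter> {y. u0 \<bullet> y \<noteq> 0})"
      using W(1) by (rule openin_Int_open[rotated])
    show "W \<inter> {y. u0 \<bullet> y \<noteq> 0} \<noteq> {}"
    proof
      assume empty: "W \<inter> {y. u0 \<bullet> y \<noteq> 0} = {}"
      obtain v where v: "v \<in> W" using W by auto
      have nv: "norm v = 1" using openin_imp_subset[OF W(1)] v by auto
      obtain W' where W': "open W'" "W = sphere 0 1 \<inter> W'" using W(1) by (auto simp: openin_open)
      have uv: "u0 \<bullet> v = 0" using empty v by auto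
      \<comment> \<open>Tilting \<open>v\<close> slightly towards \<open>u0\<close> stays inside
        \<open>W\<close> but leaves the hyperplane orthogonal to \<open>u0\<close>.\<close>
      have "((\<lambda>t. (v + t *\<^sub>R u0) /\<^sub>R norm (v + t *\<^sub>R u0)) \<longlongrightarrow> (v + 0 *\<^sub>R u0) /\<^sub>R norm (v + 0 *\<^sub>R u0)) (at_right (0::real))"
        using nv by (intro tendsto_intros) auto
      then have "\<forall>\<^sub>F t in at_right (0::real). (v + t *\<^sub>R u0) /\<^sub>R norm (v + t *\<^sub>R u0) \<in> W'"
        using W' v nv by (intro topological_tendstoD) auto
      then obtain t :: real where t: "t > 0" "(v + t *\<^sub>R u0) /\<^sub>R norm (v + t *\<^sub>R u0) \<in> W'"
        using eventually_conj[OF eventually_at_right_less] eventually_happens'[OF trivial_limit_at_right_real] by blast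
      have ip: "u0 \<bullet> (v + t *\<^sub>R u0) = t" using uv u0 by (simp add: inner_add_right dot_square_norm)
      then have ne: "v + t *\<^sub>R u0 \<noteq> 0" using t by auto
      then have "(v + t *\<^sub>R u0) /\<^sub>R norm (v + t *\<^sub>R u0) \<in> W" using t W' by simp
      moreover have "u0 \<bullet> ((v + t *\<^sub>R u0) /\<^sub>R norm (v + t *\<^sub>R u0)) \<noteq> 0"
        using ip t ne by simp
      ultimately show False using empty by blast
    qed
  qed auto
  moreover have "?m u0 * norm u \<le> ?m u" for u
  proof (cases "u = 0")
    case False
    have "u /\<^sub>R norm u \<in> sphere 0 1" using False by simp
    then have "?m u0 \<le> ?m (u /\<^sub>R norm u)" using u0(2) by blast
    also have "?m (u /\<^sub>R norm u) = (LINT y|sphere_measure. (indicator W y * \<bar>u \<bullet> y\<bar>) / norm u)"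
      by (simp add: abs_mult divide_inverse mult_ac)
    also have "\<dots> = ?m u / norm u" by simp
    finally show ?thesis using False by (simp add: field_simps)
  qed simp
  ultimately show ?thesis using that by blast
qed

text \<open>The function has derivative 0 at 0. It is the factor by which an integral of
  \<open>s\<close>-th powers changes when v + u, with u orthogonal to v and \<open>t\<close> the
  quotient of their norms, is rescaled to the length of v.\<close>

lemma powr_quadratic_small:
  fixes s \<eta> :: real
  assumes "\<eta> > 0"
  obtains d where "d > 0" "\<And>t. 0 \<le> t \<Longrightarrow> t < d \<Longrightarrow> \<bar>(1 + t\<^sup>2) powr (-(s/2)) - 1\<bar> \<le> \<eta> * t"
proof -
  have "((\<lambda>t::real. (1 + t\<^sup>2) powr (-(s/2))) has_derivative (\<lambda>x. 0)) (at 0)"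
    by (rule has_derivative_eq_rhs, rule derivative_intros) (auto intro!: derivative_eq_intros)
  then obtain d where "d > 0" and d: "\<And>t. norm (t - 0) < d \<Longrightarrow>
      norm ((1 + t\<^sup>2) powr (-(s/2)) - (1 + 0\<^sup>2) powr (-(s/2)) - 0) \<le> \<eta> * norm (t - 0)"
    unfolding has_derivative_at_alt using assms by blast
  show ?thesis
  proof (rule that[OF \<open>d > 0\<close>])
    fix t :: real assume "0 \<le> t" "t < d"
    then show "\<bar>(1 + t\<^sup>2) powr (-(s/2)) - 1\<bar> \<le> \<eta> * t" using d[of t] by simp
  qed
qed

section \<open>First-order gain and rigidity for orbit maxima\<close>

context finite_orthogonal_group begin

text \<open>The pointwise gain \<open>\<bar>u \<bullet> y\<bar> / card G\<close> is integrated over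
  an open set where \<open>v\<close> is optimal; elsewhere the perturbation does no harm. The bound
  on \<open>norm u\<close> keeps the compared values below \<open>2 * norm v\<close>, so that one
  slope \<open>m\<close> works for all \<open>y\<close>.\<close>

lemma orbit_max_perturbation_gain:
  assumes f: "weight c1 c2 f" and s: "s \<noteq> 0" and v: "v \<noteq> 0"
    and fixv: "\<And>x. (\<And>g. g \<in> stab v \<Longrightarrow> g x = x) \<Longrightarrow> x \<in> span {v}"
    and pos: "cont_pos_sphere (orbit_max v)"
  obtains K where "K > 0" "\<And>u. u \<bullet> v = 0 \<Longrightarrow> norm u \<le> norm v \<Longrightarrow>
      sgn s * power_integral f s (orbit_max v) + K * norm u \<le> sgn s * power_integral f s (orbit_max (v + u))"
proof -
  define N where "N = real (card G)"
  have N: "N > 0" using fin id_mem by (auto simp: N_def card_gt_0_iff)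
  have N1: "N \<ge> 1" using N by (simp add: N_def)
  \<comment> \<open>The directions in which \<open>v\<close> strictly beats every other point of its
    orbit. The direction of \<open>v\<close> is one of them, because all orbit points have the same
    norm.\<close>
  define W where "W = sphere 0 1 \<inter> (\<Inter>g\<in>G - stab v. {y. g v \<bullet> y < v \<bullet> y})"
  have "open (\<Inter>g\<in>G - stab v. {y. g v \<bullet> y < v \<bullet> y})"
    using fin by (intro open_INT ballI open_Collect_less continuous_intros) auto
  then have W: "openin (top_of_set (sphere 0 1)) W" by (auto simp: W_def openin_open)
  have vW: "v /\<^sub>R norm v \<in> W"
  proof -
    have "g v \<bullet> v < v \<bullet> v" if "g \<in> G" "g v \<noteq> v" for g
    proof -
      have "0 < (g v - v) \<bullet> (g v - v)" using that by (simp add: inner_gt_zero_iff)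
      also have "\<dots> = 2 * (v \<bullet> v) - 2 * (g v \<bullet> v)"
        by (simp add: inner_diff_left inner_diff_right inner_act[OF that(1)] inner_commute)
      finally show ?thesis by simp
    qed
    then show ?thesis using v by (auto simp: W_def stab_def)
  qed
  then have Wne: "W \<noteq> {}" by auto
  have eqW: "orbit_max v y = v \<bullet> y" if "y \<in> W" for y
  proof (rule antisym)
    have "g v \<bullet> y \<le> v \<bullet> y" if "g \<in> G" for g
      using \<open>y \<in> W\<close> that by (cases "g v = v") (auto simp: W_def stab_def less_imp_le)
    then show "orbit_max v y \<le> v \<bullet> y" by (simp add: orbit_max_le_iff)
    show "v \<bullet> y \<le> orbit_max v y" using orbit_max_ge[OF id_mem, of v y] by simp
  qed
  obtain C where C: "C > 0" "\<And>u. C * norm u \<le> (LINT y|sphere_measure. indicator W y * \<bar>u \<bullet> y\<bar>)"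
    using cap_integral_lower_bound[OF W Wne] by blast
  obtain a0 where a0: "0 < a0" "\<And>y. norm y = 1 \<Longrightarrow> a0 \<le> orbit_max v y"
    using cont_pos_sphere_bounds[OF pos] by metis
  define m where "m = \<bar>s\<bar> * min (a0 powr (s - 1)) ((2 * norm v) powr (s - 1))"
  have m: "m > 0" using s a0 v by (auto simp: m_def)
  have c1: "c1 > 0" using f by (simp add: weight_def)
  show ?thesis
  proof (rule that[of "c1 * m / N * C"])
    show "c1 * m / N * C > 0" using c1 m N C by simp
    fix u assume u: "u \<bullet> v = 0" and un: "norm u \<le> norm v"
    have pos': "cont_pos_sphere (orbit_max (v + u))"
      using pos orbit_max_add_ge(1)[OF fixv u] continuous_on_orbit_max
      unfolding cont_pos_sphere_def by (meson less_le_trans)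
    have pointwise: "c1 * m / N * (indicator W y * \<bar>u \<bullet> y\<bar>)
        \<le> sgn s * (f y * orbit_max (v + u) y powr s) - sgn s * (f y * orbit_max v y powr s)" if y: "norm y = 1" for y
    proof -
      have a: "a0 \<le> orbit_max v y" and fy: "f y \<ge> c1" "f y > 0"
        using a0 y f weight_pos[OF f y] by (auto simp: weight_def)
      define b where "b = indicator W y * \<bar>u \<bullet> y\<bar> / N"
      have b0: "b \<ge> 0" using N by (simp add: b_def)
      have b1: "orbit_max v y + b \<le> orbit_max (v + u) y"
        using orbit_max_add_ge[OF fixv u, of y] eqW[of y] by (auto simp: b_def N_def indicator_def)
      have "b \<le> norm u"
      proof -
        have "\<bar>u \<bullet> y\<bar> \<le> norm u" using Cauchy_Schwarz_ineq2[of u y] y by simp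
        moreover have "\<bar>u \<bullet> y\<bar> / N \<le> \<bar>u \<bullet> y\<bar> / 1" using N1 by (intro divide_left_mono) auto
        ultimately have "\<bar>u \<bullet> y\<bar> / N \<le> norm u" by simp
        then show ?thesis by (auto simp: b_def indicator_def)
      qed
      moreover have "orbit_max v y \<le> norm v" using orbit_max_le_norm[of v y] y by simp
      ultimately have b2: "orbit_max v y + b \<le> 2 * norm v" using un by simp
      have "sgn s * orbit_max v y powr s + m * b \<le> sgn s * (orbit_max v y + b) powr s"
        unfolding m_def by (rule sgn_powr_increment[OF a0(1) a b0 b2])
      also have "\<dots> \<le> sgn s * orbit_max (v + u) y powr s"
        by (rule sgn_powr_mono) (use a a0 b0 b1 in auto)
      finally have "m * b \<le> sgn s * orbit_max (v + u) y powr s - sgn s * orbit_max v y powr s" by simp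
      then have "f y * (m * b) \<le> f y * (sgn s * orbit_max (v + u) y powr s - sgn s * orbit_max v y powr s)"
        using fy by simp
      moreover have "c1 * (m * b) \<le> f y * (m * b)" using fy m b0 by (intro mult_right_mono) auto
      ultimately show ?thesis by (simp add: b_def algebra_simps)
    qed
    let ?D = "\<lambda>y. sgn s * (f y * orbit_max (v + u) y powr s) - sgn s * (f y * orbit_max v y powr s)"
    have intD: "integrable sphere_measure ?D"
      by (intro Bochner_Integration.integrable_diff integrable_mult_right integrable_power_integral[OF f] pos pos')
    have "c1 * m / N * (C * norm u) \<le> c1 * m / N * (LINT y|sphere_measure. indicator W y * \<bar>u \<bullet> y\<bar>)"
      using C(2)[of u] c1 m N by (intro mult_left_mono) auto
    also have "\<dots> = (LINT y|sphere_measure. c1 * m / N * (indicator W y * \<bar>u \<bullet> y\<bar>))" by simp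
    also have "\<dots> \<le> (LINT y|sphere_measure. ?D y)"
    proof (cases "integrable sphere_measure (\<lambda>y. c1 * m / N * (indicator W y * \<bar>u \<bullet> y\<bar>))")
      case True
      then show ?thesis by (rule integral_mono[OF _ intD]) (use pointwise in simp)
    next
      \<comment> \<open>The integral of a non-integrable function is 0 by convention, so
        nonnegativity of the right-hand side settles this case.\<close>
      case False
      have "0 \<le> c1 * m / N * (indicator W y * \<bar>u \<bullet> y\<bar>)" for y using c1 m N by simp
      then have "0 \<le> ?D y" if "norm y = 1" for y using pointwise[OF that] by (meson order_trans)
      then have "0 \<le> (LINT y|sphere_measure. ?D y)" by (intro integral_nonneg_AE AE_I2) simp
      then show ?thesis using not_integrable_integral_eq[OF False] by linarith
    qed
    also have "\<dots> = sgn s * power_integral f s (orbit_max (v + u)) - sgn s * power_integral f s (orbit_max v)"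
      unfolding power_integral_def
      by (subst Bochner_Integration.integral_diff)
         (auto intro!: integrable_mult_right integrable_power_integral[OF f] pos pos')
    finally show "sgn s * power_integral f s (orbit_max v) + c1 * m / N * C * norm u \<le> sgn s * power_integral f s (orbit_max (v + u))"
      by (simp add: mult_ac)
  qed
qed

text \<open>Writing \<open>w\<close> as \<open>c *\<^sub>R (v + u)\<close> with \<open>u\<close>
  orthogonal to \<open>v\<close>, equality of the lengths forces
  \<open>c powr s = (1 + t\<^sup>2) powr (-(s/2))\<close> for \<open>t = norm u / norm v\<close>, so
  gain and loss are compared in the single parameter \<open>t\<close>.\<close>

lemma orbit_max_strict_increase:
  assumes f: "weight c1 c2 f" and s: "s \<noteq> 0" and v: "v \<noteq> 0"
    and fixv: "\<And>x. (\<And>g. g \<in> stab v \<Longrightarrow> g x = x) \<Longrightarrow> x \<in> span {v}"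
    and pos: "cont_pos_sphere (orbit_max v)"
  obtains \<delta> where "\<delta> > 0" "\<And>w. norm (w - v) < \<delta> \<Longrightarrow> norm w = norm v \<Longrightarrow> w \<noteq> v \<Longrightarrow>
      cont_pos_sphere (orbit_max w) \<and> sgn s * power_integral f s (orbit_max v) < sgn s * power_integral f s (orbit_max w)"
proof -
  define P where "P = power_integral f s (orbit_max v)"
  have P: "P > 0" unfolding P_def by (rule power_integral_pos[OF f pos])
  obtain K where K: "K > 0" and gain: "\<And>u. u \<bullet> v = 0 \<Longrightarrow> norm u \<le> norm v \<Longrightarrow>
      sgn s * P + K * norm u \<le> sgn s * power_integral f s (orbit_max (v + u))"
    unfolding P_def using orbit_max_perturbation_gain[OF f s v fixv pos] by blast
  define k where "k = K * norm v"
  have k: "k > 0" using K v by (simp add: k_def)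
  \<comment> \<open>With this choice the factor \<open>c powr s\<close> costs at most a quarter of
    the gain \<open>k * t\<close>; for \<open>s > 0\<close> the cross term costs at most another
    quarter.\<close>
  define \<eta> where "\<eta> = k / (4 * P)"
  have \<eta>: "\<eta> > 0" using k P by (simp add: \<eta>_def)
  obtain d where d: "d > 0" "\<And>t. 0 \<le> t \<Longrightarrow> t < d \<Longrightarrow> \<bar>(1 + t\<^sup>2) powr (-(s/2)) - 1\<bar> \<le> \<eta> * t"
    using powr_quadratic_small[OF \<eta>] by blast
  \<comment> \<open>The bound 1 yields \<open>norm u \<le> norm v\<close> and
    \<open>c > 1/2\<close>, the bound \<open>d\<close> is the range of the quadratic estimate, and
    \<open>P / k\<close> gives \<open>k * t \<le> P\<close>, which controls the cross term.\<close>
  define t0 where "t0 = min 1 (min d (P / k))"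
  have t0: "t0 > 0" "t0 \<le> 1" "t0 \<le> d" "t0 \<le> P / k" using d k P by (auto simp: t0_def)
  show ?thesis
  \<comment> \<open>The divisor 4 pays for \<open>norm u \<le> 4 * norm (w - v)\<close>, a
    consequence of \<open>c > 1/2\<close>.\<close>
  proof (rule that[of "norm v * t0 / 4"])
    show "norm v * t0 / 4 > 0" using v t0 by simp
    fix w assume w: "norm (w - v) < norm v * t0 / 4" "norm w = norm v" "w \<noteq> v"
    \<comment> \<open>Coefficient of the orthogonal projection of \<open>w\<close> onto the line
      through \<open>v\<close>.\<close>
    define c where "c = (w \<bullet> v) / (v \<bullet> v)"
    define u where "u = w /\<^sub>R c - v"
    have vv: "v \<bullet> v > 0" using v by simp
    have "(w - v) \<bullet> v = (c - 1) * (v \<bullet> v)" using vv by (simp add: c_def inner_diff_left field_simps)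
    then have "\<bar>c - 1\<bar> * (norm v * norm v) \<le> norm (w - v) * norm v"
      using Cauchy_Schwarz_ineq2[of "w - v" v] by (simp add: abs_mult dot_square_norm power2_eq_square)
    then have c1: "\<bar>c - 1\<bar> * norm v \<le> norm (w - v)" using v by (simp add: mult.assoc[symmetric])
    have "\<bar>c - 1\<bar> * norm v < norm v * (t0 / 4)" using c1 w(1) by simp
    then have "\<bar>c - 1\<bar> < t0 / 4" using v by (simp add: mult.commute)
    then have c: "c > 1/2" using t0 by linarith
    have weq: "w = c *\<^sub>R (v + u)" using c by (simp add: u_def)
    have "w \<bullet> v = c * (v \<bullet> v)" using vv by (simp add: c_def)
    then have uv: "u \<bullet> v = 0" using c by (simp add: u_def inner_diff_left)
    have "c *\<^sub>R u = (w - v) + (1 - c) *\<^sub>R v" using c by (simp add: u_def algebra_simps)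
    then have "c * norm u \<le> norm (w - v) + \<bar>c - 1\<bar> * norm v"
      using c norm_triangle_ineq[of "w - v" "(1 - c) *\<^sub>R v"] norm_scaleR[of c u] by (simp add: abs_minus_commute)
    then have "c * norm u \<le> 2 * norm (w - v)" using c1 by simp
    moreover have "1/2 * norm u \<le> c * norm u" using c by (intro mult_right_mono) auto
    ultimately have nu: "norm u < norm v * t0" using w(1) by simp
    define t where "t = norm u / norm v"
    have t: "0 \<le> t" "t < t0" using nu v by (auto simp: t_def field_simps)
    have u0: "u \<noteq> 0"
    proof
      assume "u = 0"
      then have "w = c *\<^sub>R v" using weq by simp
      then have "c = 1" using w(2) c v by simp
      then show False using w(3) \<open>w = c *\<^sub>R v\<close> by simp
    qed
    then have tpos: "t > 0" using v by (simp add: t_def)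
    have "norm u \<le> norm v" using nu t0(2) mult_left_le[of t0 "norm v"] by simp
    define X where "X = power_integral f s (orbit_max (v + u))"
    have gain': "sgn s * P + k * t \<le> sgn s * X"
      using gain[OF uv \<open>norm u \<le> norm v\<close>] v by (simp add: X_def k_def t_def)
    have posu: "cont_pos_sphere (orbit_max (v + u))"
      using pos orbit_max_add_ge(1)[OF fixv uv] continuous_on_orbit_max
      unfolding cont_pos_sphere_def by (meson less_le_trans)
    have Hw: "orbit_max w = (\<lambda>y. c * orbit_max (v + u) y)"
      using c by (subst weq) (auto simp: orbit_max_scale)
    have posw: "cont_pos_sphere (orbit_max w)"
      unfolding Hw by (rule cont_pos_sphere_scale[OF posu]) (use c in simp)
    have cs: "c powr s = (1 + t\<^sup>2) powr (-(s/2))"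
    proof -
      have "(norm w)\<^sup>2 = c\<^sup>2 * ((norm v)\<^sup>2 + (norm u)\<^sup>2)"
        using uv by (simp add: weq power_mult_distrib dot_square_norm[symmetric] inner_add_left inner_add_right inner_commute)
      then have "c\<^sup>2 * (1 + t\<^sup>2) = 1" using w(2) v by (simp add: t_def power_divide field_simps)
      moreover have tt: "1 + t\<^sup>2 > 0" by (simp add: add_pos_nonneg)
      ultimately have "1 + t\<^sup>2 = c powr (-2)" using c by (simp add: powr_minus field_simps)
      then have "(1 + t\<^sup>2) powr (-(s/2)) = (c powr (-2)) powr (-(s/2))" by simp
      also have "\<dots> = c powr s" by (simp add: powr_powr)
      finally show ?thesis by simp
    qed
    have close: "\<bar>c powr s - 1\<bar> \<le> \<eta> * t" unfolding cs using d(2)[of t] t t0 by simp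
    have pw: "power_integral f s (orbit_max w) = c powr s * X"
      unfolding Hw X_def by (rule power_integral_scale) (use c posu in \<open>auto simp: cont_pos_sphere_def less_imp_le\<close>)
    have Xpos: "X > 0" unfolding X_def by (rule power_integral_pos[OF f posu])
    have \<eta>P: "\<eta> * P = k / 4" using P by (simp add: \<eta>_def)
    have "sgn s * P < sgn s * (c powr s * X)"
    proof (cases "s > 0")
      case True
      have "X \<ge> P + k * t" using gain' True by simp
      have "k * t \<le> P"
      proof -
        have "t \<le> P / k" using t t0 by linarith
        then show ?thesis using k by (simp add: field_simps)
      qed
      have nn: "\<eta> * t \<le> 1"
      proof -
        have "\<eta> * t = (k * t) / (4 * P)" by (simp add: \<eta>_def)
        also have "\<dots> \<le> P / (4 * P)" using \<open>k * t \<le> P\<close> P by (intro divide_right_mono) auto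
        also have "\<dots> \<le> 1" using P by simp
        finally show ?thesis .
      qed
      have "(1 - \<eta> * t) * (P + k * t) \<le> c powr s * X"
        by (rule mult_mono) (use close \<open>X \<ge> P + k * t\<close> P k t in \<open>auto simp: abs_le_iff\<close>)
      moreover have "(1 - \<eta> * t) * (P + k * t) = P + k * t - (\<eta> * P) * t - (\<eta> * t) * (k * t)" by (simp add: algebra_simps)
      moreover have "(\<eta> * t) * (k * t) \<le> (\<eta> * t) * P" using \<open>k * t \<le> P\<close> \<eta> t by (intro mult_left_mono) auto
      moreover have "(\<eta> * t) * P = (\<eta> * P) * t" by simp
      moreover have "k * t > 0" using k tpos by simp
      ultimately have "P < c powr s * X" unfolding \<eta>P by linarith
      then show ?thesis using True by simp
    next
      case False
      then have s': "s < 0" using s by simp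
      have X: "X \<le> P - k * t" using gain' s' by simp
      have "c powr s * X \<le> (1 + \<eta> * t) * (P - k * t)"
        by (rule mult_mono) (use close X Xpos \<eta> t in \<open>auto simp: abs_le_iff\<close>)
      moreover have "(1 + \<eta> * t) * (P - k * t) = P - k * t + (\<eta> * P) * t - (\<eta> * t) * (k * t)" by (simp add: algebra_simps)
      moreover have "(\<eta> * t) * (k * t) \<ge> 0" using \<eta> k t by simp
      moreover have "k * t > 0" using k tpos by simp
      ultimately have "c powr s * X < P" unfolding \<eta>P by linarith
      then show ?thesis using s' by simp
    qed
    then show "cont_pos_sphere (orbit_max w) \<and> sgn s * power_integral f s (orbit_max v) < sgn s * power_integral f s (orbit_max w)"
      using posw pw by (simp add: P_def)
  qed
qed

text \<open>Shortening \<open>w\<close> to the length of \<open>v\<close> only lowers the function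
  below \<open>\<psi>\<close>. Strict extremality then identifies the shortened point with
  \<open>v\<close>, and the equality case of monotonicity identifies \<open>\<psi>\<close>.
  Shortening moves \<open>w\<close> by \<open>norm w - norm v\<close>, which is at most its distance
  to \<open>v\<close>; hence the radius \<open>\<delta> / 2\<close>.\<close>

lemma orbit_max_rigidity:
  assumes f: "weight c1 c2 f" and s: "s \<noteq> 0" and v: "v \<noteq> 0"
    and fixv: "\<And>x. (\<And>g. g \<in> stab v \<Longrightarrow> g x = x) \<Longrightarrow> x \<in> span {v}"
    and pos: "cont_pos_sphere (orbit_max v)"
  shows "\<exists>\<delta>>0. \<forall>w \<psi>. norm (w - v) < \<delta> \<longrightarrow> norm v \<le> norm w \<longrightarrow> cont_pos_sphere \<psi> \<longrightarrow>
      (\<forall>y. norm y = 1 \<longrightarrow> orbit_max w y \<le> \<psi> y) \<longrightarrow>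
      sgn s * power_integral f s \<psi> \<le> sgn s * power_integral f s (orbit_max v) \<longrightarrow> (\<forall>y. norm y = 1 \<longrightarrow> \<psi> y = orbit_max v y)"
proof -
  obtain \<delta> where \<delta>: "\<delta> > 0" and inc: "\<And>w. norm (w - v) < \<delta> \<Longrightarrow> norm w = norm v \<Longrightarrow> w \<noteq> v \<Longrightarrow>
      cont_pos_sphere (orbit_max w) \<and> sgn s * power_integral f s (orbit_max v) < sgn s * power_integral f s (orbit_max w)"
    using orbit_max_strict_increase[OF assms] by blast
  show ?thesis
  proof (intro exI[of _ "\<delta> / 2"] conjI allI impI)
    show "\<delta> / 2 > 0" using \<delta> by simp
    fix w y :: 'a and \<psi> :: "'a \<Rightarrow> real" assume w: "norm (w - v) < \<delta> / 2" "norm v \<le> norm w" and \<psi>: "cont_pos_sphere \<psi>"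
      and le: "\<forall>y. norm y = 1 \<longrightarrow> orbit_max w y \<le> \<psi> y"
      and J: "sgn s * power_integral f s \<psi> \<le> sgn s * power_integral f s (orbit_max v)" and y: "norm y = 1"
    have w0: "norm w > 0" using w(2) v by (meson less_le_trans zero_less_norm_iff)
    define l where "l = norm v / norm w"
    have l: "0 < l" "l \<le> 1" using w0 v w(2) by (auto simp: l_def)
    define w1 where "w1 = l *\<^sub>R w"
    have n1: "norm w1 = norm v" using w0 l by (simp add: w1_def l_def)
    have "norm (w1 - w) = norm w - norm v"
    proof -
      have "w1 - w = (l - 1) *\<^sub>R w" by (simp add: w1_def algebra_simps)
      then have "norm (w1 - w) = (1 - l) * norm w" using l by simp
      then show ?thesis using w0 by (simp add: l_def left_diff_distrib)
    qed
    also have "\<dots> \<le> norm (w - v)" by (rule norm_triangle_ineq2)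
    finally have d1: "norm (w1 - v) < \<delta>" using norm_triangle_ineq[of "w1 - w" "w - v"] w(1) by simp
    have le1: "orbit_max w1 y \<le> \<psi> y" if "norm y = 1" for y
    proof -
      have "orbit_max w1 y = l * orbit_max w y" unfolding w1_def using l by (simp add: orbit_max_scale)
      also have "\<dots> \<le> l * \<psi> y" using le that l by simp
      also have "\<dots> \<le> \<psi> y" using l \<psi> that by (simp add: cont_pos_sphere_def mult_le_cancel_right1 mult_left_le_one_le less_imp_le)
      finally show ?thesis .
    qed
    have "w1 = v"
    proof (rule ccontr)
      assume "w1 \<noteq> v"
      from inc[OF d1 n1 this] power_integral_mono[OF f _ \<psi> le1, of s] J show False by force
    qed
    then show "\<psi> y = orbit_max v y"
      using power_integral_eq_imp_eq[OF f pos \<psi> _ J s y] le1 by simp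
  qed
qed

end

subsection \<open>Regular polytopes\<close>

text \<open>Induction on the dimension: a proper face lies in a facet, and \<open>v\<close> is again
  a vertex of that facet.\<close>

lemma vertex_facet_chain:
  fixes P :: "'a::euclidean_space set"
  assumes "polytope P" "aff_dim P = int k" "{v} face_of P"
  shows "\<exists>F. F 0 = {v} \<and> F k = P \<and> (\<forall>i\<le>k. F i face_of P \<and> aff_dim (F i) = int i) \<and> (\<forall>i<k. F i \<subseteq> F (Suc i))"
  using assms
proof (induction k arbitrary: P)
  case 0
  then obtain a where "P = {a}" by (auto simp: aff_dim_eq_0)
  then have "P = {v}" using face_of_imp_subset[OF 0(3)] by auto
  then show ?case using 0 by (intro exI[of _ "\<lambda>_. P"]) (auto simp: face_of_refl)
next
  case (Suc k)
  have "{v} \<noteq> P" using Suc.prems(2) by auto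
  then obtain Q where Q: "Q facet_of P" "{v} \<subseteq> Q"
    using face_of_polyhedron_subset_facet[OF polytope_imp_polyhedron[OF Suc.prems(1)] Suc.prems(3)] by blast
  have QP: "Q face_of P" "aff_dim Q = int k" using Q Suc.prems(2) by (auto simp: facet_of_def)
  have "polytope Q" using face_of_polytope_polytope[OF Suc.prems(1) QP(1)] .
  moreover have "{v} face_of Q"
    using face_of_subset[OF Suc.prems(3) Q(2) face_of_imp_subset[OF QP(1)]] .
  ultimately obtain F where F: "F 0 = {v}" "F k = Q" "\<And>i. i \<le> k \<Longrightarrow> F i face_of Q \<and> aff_dim (F i) = int i"
      "\<And>i. i < k \<Longrightarrow> F i \<subseteq> F (Suc i)"
    using Suc.IH[OF _ QP(2)] by blast
  have "polyhedron P" using Suc.prems(1) by (simp add: polytope_imp_polyhedron)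
  then have "P face_of P" by (simp add: face_of_refl polyhedron_imp_convex)
  then show ?case
    using F QP Suc.prems(2) face_of_imp_subset[OF QP(1)]
    by (intro exI[of _ "F(Suc k := P)"]) (auto simp: le_Suc_eq less_Suc_eq intro: face_of_trans)
qed

section \<open>The symmetry group and its action on vertices and facets\<close>

lemma sym_group_comp: "g \<in> sym_group T \<Longrightarrow> h \<in> sym_group T \<Longrightarrow> (\<lambda>x. g (h x)) \<in> sym_group T"
  using orthogonal_transformation_compose[of g h] by (auto simp: sym_group_def o_def image_image[symmetric])

lemma sym_group_inv:
  fixes T :: "'a::euclidean_space set"
  assumes "g \<in> sym_group T" shows "inv g \<in> sym_group T"
proof -
  have "inv g ` T = inv g ` (g ` T)" using assms by (simp add: sym_group_def)
  also have "\<dots> = T"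
    using assms by (intro image_inv_f_f orthogonal_transformation_inj) (simp add: sym_group_def)
  finally show ?thesis using assms by (simp add: sym_group_def orthogonal_transformation_inv)
qed

locale regular_poly =
  fixes T :: "'a::euclidean_space set"
  assumes reg: "regular_polytope T"
begin

lemma polytope_T: "polytope T" and interior_T: "interior T \<noteq> {}"
  using reg by (auto simp: regular_polytope_def)

lemma compact_T: "compact T" and convex_T: "convex T" and polyhedron_T: "polyhedron T"
  using polytope_T by (auto simp: polytope_imp_compact polytope_imp_convex polytope_imp_polyhedron)

lemma aff_dim_T: "aff_dim T = int DIM('a)"
  using interior_T by (simp add: aff_dim_nonempty_interior)

lemma vanishing_on_T:
  assumes "\<And>x. x \<in> T \<Longrightarrow> z \<bullet> x = c" shows "z = 0"
proof (rule ccontr)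
  assume "z \<noteq> 0"
  have "T \<subseteq> {x. z \<bullet> x = c}" using assms by auto
  then have "interior T \<subseteq> interior {x. z \<bullet> x = c}" by (rule interior_mono)
  then show False using interior_T interior_hyperplane[OF \<open>z \<noteq> 0\<close>] by simp
qed

lemma image_extreme:
  assumes g: "g \<in> sym_group T" and v: "v extreme_point_of T" shows "g v extreme_point_of T"
proof -
  have "linear g" "inj g" using g by (auto simp: sym_group_def orthogonal_transformation_linear orthogonal_transformation_inj)
  then have "g ` {v} face_of g ` T" using v by (simp only: face_of_linear_image face_of_singleton)
  then show ?thesis using g by (simp add: sym_group_def face_of_singleton)
qed

text \<open>A symmetry permutes the finitely many vertices and is determined by their images, since
  the vertices span the space.\<close>

lemma finite_sym_group: "finite (sym_group T)"
proof -
  let ?V = "{v. v extreme_point_of T}"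
  have fV: "finite ?V" by (rule finite_polyhedron_extreme_points[OF polyhedron_T])
  have hull: "T = convex hull ?V" by (rule Krein_Milman_Minkowski[OF compact_T convex_T])
  have "inj_on (\<lambda>g. restrict g ?V) (sym_group T)"
  proof (rule inj_onI)
    fix g h assume gh: "g \<in> sym_group T" "h \<in> sym_group T" "restrict g ?V = restrict h ?V"
    have lin: "linear g" "linear h" using gh by (auto simp: sym_group_def orthogonal_transformation_linear)
    have eqV: "g v = h v" if "v \<in> ?V" for v using gh(3) that by (metis restrict_apply')
    have eqT: "g x = h x" if "x \<in> span ?V" for x
      using linear_eq_on[OF lin that] eqV by blast
    have "span ?V = UNIV"
    proof (rule ccontr)
      assume "span ?V \<noteq> UNIV"
      then obtain a where a: "a \<noteq> 0" "\<And>x. x \<in> span ?V \<Longrightarrow> a \<bullet> x = 0"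
        using span_not_univ_subset_hyperplane[of ?V] by auto
      have "x \<in> span ?V" if "x \<in> T" for x using hull that convex_hull_subset_span[of ?V] by blast
      then show False using vanishing_on_T[of a 0] a by blast
    qed
    then show "g = h" using eqT by auto
  qed
  moreover have "(\<lambda>g. restrict g ?V) ` sym_group T \<subseteq> ?V \<rightarrow>\<^sub>E ?V"
  proof
    fix h assume "h \<in> (\<lambda>g. restrict g ?V) ` sym_group T"
    then obtain g where "g \<in> sym_group T" "h = restrict g ?V" by blast
    then show "h \<in> ?V \<rightarrow>\<^sub>E ?V" using image_extreme unfolding \<open>h = _\<close> restrict_PiE_iff by blast
  qed
  ultimately show ?thesis using finite_PiE[OF fV, of "\<lambda>_. ?V"] fV by (meson finite_imageD finite_subset)
qed

sublocale finite_orthogonal_group "sym_group T"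
proof
  show "(\<lambda>x. x) \<in> sym_group T" by (simp add: sym_group_def)
qed (auto simp: finite_sym_group sym_group_comp sym_group_inv, simp add: sym_group_def)

lemma act_T: "g \<in> sym_group T \<Longrightarrow> x \<in> T \<Longrightarrow> g x \<in> T"
  by (auto simp: sym_group_def)

text \<open>Each incident pair of vertex and facet is completed to a flag. This is the form in which
  flag transitivity enters: through the lowest and the highest member of a flag.\<close>

lemma transitive_incident:
  assumes "F facet_of T" "v extreme_point_of T" "v \<in> F" "F' facet_of T" "v' extreme_point_of T" "v' \<in> F'"
  obtains g where "g \<in> sym_group T" "g v = v'" "g ` F = F'"
proof -
  have flag: "\<exists>Fl. is_flag T Fl \<and> Fl 0 = {v} \<and> Fl (DIM('a) - 1) = F"
    if F: "F facet_of T" and v: "v extreme_point_of T" "v \<in> F" for F v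
  proof -
    have FT: "F face_of T" "aff_dim F = int (DIM('a) - 1)"
      using F aff_dim_T by (auto simp: facet_of_def of_nat_diff Suc_leI)
    have "{v} face_of F"
      using face_of_subset[of "{v}" T F] v face_of_imp_subset[OF FT(1)] by (simp add: face_of_singleton)
    from vertex_facet_chain[OF face_of_polytope_polytope[OF polytope_T FT(1)] FT(2) this]
    obtain Fl where Fl: "Fl 0 = {v}" "Fl (DIM('a) - 1) = F" "\<And>i. i \<le> DIM('a) - 1 \<Longrightarrow> Fl i face_of F \<and> aff_dim (Fl i) = int i"
      "\<And>i. i < DIM('a) - 1 \<Longrightarrow> Fl i \<subseteq> Fl (Suc i)" by blast
    have "Fl i face_of T" "aff_dim (Fl i) = int i" if "i < DIM('a)" for i
      using Fl(3)[of i] face_of_trans[OF _ FT(1)] that by auto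
    then have "is_flag T Fl" using Fl(4) by (simp add: is_flag_def less_diff_conv)
    then show ?thesis using Fl by blast
  qed
  obtain A where A: "is_flag T A" "A 0 = {v}" "A (DIM('a) - 1) = F" using flag assms(1-3) by blast
  obtain B where B: "is_flag T B" "B 0 = {v'}" "B (DIM('a) - 1) = F'" using flag assms(4-6) by blast
  obtain g where g: "g \<in> sym_group T" "\<And>i. i < DIM('a) \<Longrightarrow> g ` (A i) = B i"
    using reg A(1) B(1) unfolding regular_polytope_def by blast
  have "g ` {v} = {v'}" using g(2)[of 0] A B by simp
  moreover have "g ` F = F'" using g(2)[of "DIM('a) - 1"] A B by simp
  ultimately show ?thesis using that g(1) by simp
qed

lemma facet_image:
  assumes g: "g \<in> sym_group T" and F: "F facet_of T" shows "g ` F facet_of T"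
proof -
  have lin: "linear g" "inj g" using g by (auto simp: sym_group_def orthogonal_transformation_linear orthogonal_transformation_inj)
  have "g ` F face_of g ` T" using F lin by (simp add: face_of_linear_image facet_of_def)
  moreover have "aff_dim (g ` F) = aff_dim F" using aff_dim_injective_linear_image[OF lin] .
  ultimately show ?thesis using F g by (auto simp: facet_of_def sym_group_def)
qed

lemma vertex_in_facet:
  assumes "v extreme_point_of T" obtains F where "F facet_of T" "v \<in> F"
proof -
  have "{v} face_of T" using assms by (simp add: face_of_singleton)
  moreover have "{v} \<noteq> T" using interior_T by (metis interior_singleton)
  ultimately show ?thesis using face_of_polyhedron_subset_facet[OF polyhedron_T] that by blast
qed

text \<open>The two existence statements about \<open>k\<close> say that the stabilizer of
  \<open>v\<close> is transitive on the facets through \<open>v\<close>, and the stabilizer of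
  \<open>a\<close> on the vertices of its facet. The statement about \<open>u\<close> says that the
  vertices of one facet span the space.\<close>

lemma vertex_facet_data:
  obtains v a where "0 \<in> interior T" "v \<in> T" "v extreme_point_of T"
    "T = convex hull ((\<lambda>g. g v) ` sym_group T)" "v \<bullet> a = 1"
    "\<And>x. x \<in> T \<longleftrightarrow> (\<forall>g\<in>sym_group T. g a \<bullet> x \<le> 1)"
    "\<And>g. g \<in> sym_group T \<Longrightarrow> v \<bullet> g a = 1 \<Longrightarrow> \<exists>k\<in>sym_group T. k v = v \<and> k a = g a"
    "\<And>g. g \<in> sym_group T \<Longrightarrow> g v \<bullet> a = 1 \<Longrightarrow> \<exists>k\<in>sym_group T. k a = a \<and> k v = g v"
    "\<forall>u. (\<forall>g\<in>sym_group T. g v \<bullet> a = 1 \<longrightarrow> g v \<bullet> u = 0) \<longrightarrow> u = 0"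
    "\<forall>z. (\<forall>g\<in>sym_group T. g z = z) \<longrightarrow> z = 0"
    "\<exists>F. F facet_of T \<and> F = T \<inter> {x. a \<bullet> x = 1} \<and> affine hull F \<subseteq> {x. a \<bullet> x = 1} \<and> aff_dim F = int (DIM('a) - 1)"
proof -
  have "T \<noteq> {}" using interior_T interior_subset by blast
  then obtain v where v: "v extreme_point_of T" using extreme_point_exists_convex[OF compact_T convex_T] by blast
  have vT: "v \<in> T" using v by (simp add: extreme_point_of_def)
  obtain F where F: "F facet_of T" "v \<in> F" using vertex_in_facet[OF v] .
  have trans_v: "\<exists>g\<in>sym_group T. g v = w" if w: "w extreme_point_of T" for w
  proof -
    obtain F' where F': "F' facet_of T" "w \<in> F'" using vertex_in_facet[OF w] .
    show ?thesis using transitive_incident[OF F(1) v F(2) F'(1) w F'(2)] by blast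
  qed
  have hull: "T = convex hull ((\<lambda>g. g v) ` sym_group T)"
  proof
    have "T = convex hull {w. w extreme_point_of T}" by (rule Krein_Milman_Minkowski[OF compact_T convex_T])
    also have "\<dots> \<subseteq> convex hull ((\<lambda>g. g v) ` sym_group T)"
      using trans_v by (intro hull_mono) blast
    finally show "T \<subseteq> convex hull ((\<lambda>g. g v) ` sym_group T)" .
    show "convex hull ((\<lambda>g. g v) ` sym_group T) \<subseteq> T"
      using act_T vT by (intro hull_minimal convex_T) auto
  qed
  have fixed0: "z = 0" if z: "\<And>g. g \<in> sym_group T \<Longrightarrow> g z = z" for z
  proof (rule vanishing_on_T[of z "v \<bullet> z"])
    have "g v \<bullet> z = v \<bullet> z" if "g \<in> sym_group T" for g
      using inner_act[OF that, of v z] z[OF that] by simp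
    then have "(\<lambda>g. g v) ` sym_group T \<subseteq> {x. z \<bullet> x = v \<bullet> z}" by (auto simp: inner_commute)
    then have "T \<subseteq> {x. z \<bullet> x = v \<bullet> z}" by (subst hull) (rule hull_minimal[where S = convex, OF _ convex_hyperplane])
    then show "z \<bullet> x = v \<bullet> z" if "x \<in> T" for x using that by blast
  qed
  have zero: "0 \<in> interior T"
  proof -
    obtain x0 where x0: "x0 \<in> interior T" using interior_T by auto
    let ?N = "real (card (sym_group T))"
    have N: "?N > 0" using fin id_mem by (auto simp: card_gt_0_iff)
    \<comment> \<open>Every symmetry stabilizes 0, so stabilizer sums cover averages over the full
      group. The average \<open>z\<close> of an interior point is interior by convexity and fixed by
      the group, hence 0.\<close>
    have stab0: "stab 0 = sym_group T" using lin by (auto simp: stab_def linear_0)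
    define z where "z = (\<Sum>g\<in>sym_group T. (1 / ?N) *\<^sub>R g x0)"
    have "z \<in> interior T"
      unfolding z_def
    proof (rule convex_sum[OF fin convex_interior[OF convex_T]])
      show "(\<Sum>g\<in>sym_group T. 1 / ?N) = 1" using N by simp
      fix g assume g: "g \<in> sym_group T"
      have "g ` interior T = interior (g ` T)"
        by (rule interior_injective_linear_image[OF lin[OF g], symmetric])
           (use g in \<open>simp add: sym_group_def orthogonal_transformation_inj\<close>)
      then show "g x0 \<in> interior T" using x0 g by (auto simp: sym_group_def)
    qed (use N in simp)
    moreover have "z = 0"
    proof (rule fixed0)
      fix g assume g: "g \<in> sym_group T"
      have "z = (1 / ?N) *\<^sub>R (\<Sum>g\<in>sym_group T. g x0)" by (simp add: z_def scaleR_sum_right)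
      then show "g z = z" using sum_stab_fixed[of g 0 x0] g by (simp add: stab0 linear_cmul[OF lin[OF g]])
    qed
    ultimately show ?thesis by simp
  qed
  have body: "origin_body T" using zero compact_T convex_T interior_T by (simp add: origin_body_def convex_body_def)
  have "F exposed_face_of T" using exposed_face_of_polyhedron[OF polyhedron_T] F by (simp add: facet_of_def)
  then obtain a' b where ab: "T \<subseteq> {x. a' \<bullet> x \<le> b}" "F = T \<inter> {x. a' \<bullet> x = b}"
    by (auto simp: exposed_face_of_def)
  have FT: "F \<noteq> T" using F(1) by (auto simp: facet_of_irrefl)
  have "b > 0"
  proof (rule ccontr)
    \<comment> \<open>A ball around 0 inside \<open>T\<close> then forces both \<open>a'\<close> and
      \<open>b\<close> to vanish, and the exposed face would be all of \<open>T\<close>.\<close>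
    assume "\<not> b > 0"
    obtain r where r: "r > 0" "cball 0 r \<subseteq> T" using origin_body_inball[OF body] .
    have "a' = 0"
    proof (rule ccontr)
      assume a0: "a' \<noteq> 0"
      have "(r / norm a') *\<^sub>R a' \<in> T" using r a0 by (auto intro!: subsetD[OF r(2)])
      then have "(r / norm a') * (a' \<bullet> a') \<le> b" using ab(1) by auto
      moreover have "(r / norm a') * (a' \<bullet> a') > 0" using r a0 by simp
      ultimately show False using \<open>\<not> b > 0\<close> by linarith
    qed
    moreover have "0 \<le> b" using ab(1) origin_body_zero[OF body] by auto
    ultimately show False using ab FT \<open>\<not> b > 0\<close> by auto
  qed
  define a where "a = a' /\<^sub>R b"
  have aT: "a \<bullet> x \<le> 1" if "x \<in> T" for x using ab(1) that \<open>b > 0\<close> by (auto simp: a_def field_simps)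
  have Fa: "F = T \<inter> {x. a \<bullet> x = 1}" using ab(2) \<open>b > 0\<close> by (auto simp: a_def field_simps)
  have affF: "affine hull F \<subseteq> {x. a \<bullet> x = 1}"
    using Fa by (intro hull_minimal affine_hyperplane) auto
  have dimF: "aff_dim F = int (DIM('a) - 1)"
    using F aff_dim_T by (auto simp: facet_of_def of_nat_diff Suc_leI)
  \<comment> \<open>The affine hull of the facet misses 0, so adjoining 0 raises its dimension to
    that of the whole space.\<close>
  have spanF: "u = 0" if u: "\<And>x. x \<in> F \<Longrightarrow> u \<bullet> x = 0" for u
  proof -
    have "0 \<notin> affine hull F" using affF by auto
    then have "aff_dim (insert 0 F) = int DIM('a)"
      using dimF by (simp add: aff_dim_insert of_nat_diff Suc_leI)
    then have "affine hull (insert 0 F) = UNIV" by (simp add: aff_dim_eq_full)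
    moreover have "affine hull (insert 0 F) \<subseteq> {x. u \<bullet> x = 0}"
      using u by (intro hull_minimal affine_hyperplane) auto
    ultimately have "u \<bullet> u = 0" by blast
    then show ?thesis by simp
  qed
  \<comment> \<open>A normal scaled to take the value 1 on a facet is determined by it, because the
    facet spans the space.\<close>
  have normal_eq: "k a = g a" if kg: "k \<in> sym_group T" "g \<in> sym_group T" "k ` F = g ` F" for k g
  proof -
    have "(k a - g a) \<bullet> g x = 0" if "x \<in> F" for x
    proof -
      have "g x \<in> k ` F" unfolding kg(3) using that by (rule imageI)
      then obtain x' where x': "x' \<in> F" "g x = k x'" by blast
      have "g a \<bullet> g x = 1" using that Fa inner_act[OF kg(2)] by auto
      moreover have "k a \<bullet> k x' = 1" using x' Fa inner_act[OF kg(1)] by auto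
      ultimately show ?thesis using x' by (simp add: inner_diff_left)
    qed
    then have "inv g (k a - g a) \<bullet> x = 0" if "x \<in> F" for x
      using inner_act_inv[OF kg(2), of x "k a - g a"] that by (simp add: inner_commute)
    then have "inv g (k a - g a) = 0" by (rule spanF)
    then have "g (inv g (k a - g a)) = g 0" by simp
    then show ?thesis using act_inv[OF kg(2)] linear_0[OF lin[OF kg(2)]] by simp
  qed
  have memF: "inv g x \<in> F" if "g \<in> sym_group T" "x \<in> T" "g a \<bullet> x = 1" for g x
    using that Fa act_T[OF inv_mem[OF that(1)]] by (auto simp: inner_act_inv)
  have halfspaces: "x \<in> T \<longleftrightarrow> (\<forall>g\<in>sym_group T. g a \<bullet> x \<le> 1)" for x
  proof
    show "x \<in> T \<Longrightarrow> \<forall>g\<in>sym_group T. g a \<bullet> x \<le> 1"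
      using aT act_T[OF inv_mem] by (auto simp: inner_act_inv)
    assume le: "\<forall>g\<in>sym_group T. g a \<bullet> x \<le> 1"
    show "x \<in> T"
    proof (rule ccontr)
      assume "x \<notin> T"
      then have x0: "x \<noteq> 0" using origin_body_zero[OF body] by auto
      \<comment> \<open>An outside point is pulled back along its ray to the boundary point
        \<open>z\<close>. A facet through \<open>z\<close> is an image of \<open>F\<close>, and the
        corresponding image of \<open>a\<close> takes the value \<open>c > 1\<close> at
        \<open>x\<close>.\<close>
      define c where "c = gauge_fun T x"
      have c: "c > 1" using gauge_fun_le_iff[OF body x0, of 1] \<open>x \<notin> T\<close> by (simp add: c_def)
      define z where "z = x /\<^sub>R c"
      have zT: "z \<in> T" unfolding z_def c_def by (rule gauge_fun_mem[OF body x0])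
      have "z \<notin> interior T"
      proof
        assume "z \<in> interior T"
        then obtain e where e: "e > 0" "cball z e \<subseteq> T" by (auto simp: mem_interior_cball)
        define t where "t = e / norm z"
        have z0: "z \<noteq> 0" using x0 c by (simp add: z_def)
        have t: "t > 0" using e z0 by (simp add: t_def)
        have "(1 + t) *\<^sub>R z \<in> cball z e" using e z0 t by (simp add: dist_norm algebra_simps t_def)
        then have "(1 + t) *\<^sub>R z \<in> T" using e by blast
        moreover have "(1 + t) *\<^sub>R z = x /\<^sub>R (c / (1 + t))" using c t by (simp add: z_def field_simps)
        ultimately have "gauge_fun T x \<le> c / (1 + t)"
          using gauge_fun_le_iff[OF body x0, of "c / (1 + t)"] c t by simp
        moreover have "c / (1 + t) < c" using c t by (simp add: divide_less_eq)
        ultimately show False by (simp add: c_def)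
      qed
      then have "z \<in> T - rel_interior T" using zT by (simp add: rel_interior_interior[OF ] affine_hull_nonempty_interior[OF interior_T] rel_interior_nonempty_interior interior_T)
      then obtain F' where F': "F' facet_of T" "z \<in> F'" using rel_boundary_of_polyhedron[OF polyhedron_T] by auto
      have "F' \<noteq> {}" "compact F'" "convex F'"
        using F'(2) face_of_imp_compact[OF convex_T compact_T facet_of_imp_face_of[OF F'(1)]]
          face_of_imp_convex[OF facet_of_imp_face_of[OF F'(1)]] convex_T by auto
      then obtain w where w: "w extreme_point_of F'" using extreme_point_exists_convex by blast
      have wF: "w \<in> F'" using w by (simp add: extreme_point_of_def)
      have wT: "w extreme_point_of T" using extreme_point_of_face[OF facet_of_imp_face_of[OF F'(1)]] w by blast
      obtain g where g: "g \<in> sym_group T" "g v = w" "g ` F = F'"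
        using transitive_incident[OF F(1) v F(2) F'(1) wT wF] .
      then obtain y where "y \<in> F" "z = g y" using F' by auto
      then have "g a \<bullet> z = 1" using Fa inner_act[OF g(1)] by auto
      then have "g a \<bullet> x = c" using c by (simp add: z_def field_simps)
      then show False using le g c by auto
    qed
  qed
  have C1: "\<exists>k\<in>sym_group T. k v = v \<and> k a = g a" if g: "g \<in> sym_group T" "v \<bullet> g a = 1" for g
  proof -
    have "g ` F facet_of T" by (rule facet_image[OF g(1) F(1)])
    moreover have "v \<in> g ` F"
      using memF[OF g(1) vT] g act_inv[OF g(1), of v] by (metis imageI inner_commute)
    ultimately obtain k where "k \<in> sym_group T" "k v = v" "k ` F = g ` F"
      using transitive_incident[OF F(1) v F(2) _ v] by blast
    then show ?thesis using normal_eq g(1) by blast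
  qed
  have C2: "\<exists>k\<in>sym_group T. k a = a \<and> k v = g v" if g: "g \<in> sym_group T" "g v \<bullet> a = 1" for g
  proof -
    have gvF: "g v \<in> F" using Fa g act_T[OF g(1) vT] by (auto simp: inner_commute)
    obtain k where k: "k \<in> sym_group T" "k v = g v" "k ` F = F"
      using transitive_incident[OF F(1) v F(2) F(1) image_extreme[OF g(1) v] gvF] .
    then show ?thesis using normal_eq[OF k(1) id_mem] by auto
  qed
  have C3: "u = 0" if u: "\<And>g. g \<in> sym_group T \<Longrightarrow> g v \<bullet> a = 1 \<Longrightarrow> g v \<bullet> u = 0" for u
  proof (rule spanF)
    fix x assume x: "x \<in> F"
    have "F face_of T" using F by (simp add: facet_of_def)
    then have "compact F" "convex F"
      using face_of_imp_compact[OF convex_T compact_T] convex_T face_of_imp_convex by blast+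
    then have "F = convex hull {w. w extreme_point_of F}" by (rule Krein_Milman_Minkowski)
    also have "\<dots> \<subseteq> {x. u \<bullet> x = 0}"
    proof (intro hull_minimal convex_hyperplane subsetI, clarify)
      fix w assume w: "w extreme_point_of F"
      have "w \<in> F" using w by (simp add: extreme_point_of_def)
      have "w extreme_point_of T" using extreme_point_of_face[OF \<open>F face_of T\<close>] w by blast
      then obtain g where "g \<in> sym_group T" "g v = w" using trans_v by blast
      then show "u \<bullet> w = 0" using u[of g] \<open>w \<in> F\<close> Fa by (auto simp: inner_commute)
    qed
    finally show "u \<bullet> x = 0" using x by blast
  qed
  have va: "v \<bullet> a = 1" using F(2) Fa by (auto simp: inner_commute)
  show ?thesis
  proof (rule that[of v a, OF zero vT v hull va])
    show "\<exists>F. F facet_of T \<and> F = T \<inter> {x. a \<bullet> x = 1} \<and> affine hull F \<subseteq> {x. a \<bullet> x = 1} \<and> aff_dim F = int (DIM('a) - 1)"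
      using F(1) Fa affF dimF by blast
  next
    show "\<forall>u. (\<forall>g\<in>sym_group T. g v \<bullet> a = 1 \<longrightarrow> g v \<bullet> u = 0) \<longrightarrow> u = 0" using C3 by blast
  next
    show "\<forall>z. (\<forall>g\<in>sym_group T. g z = z) \<longrightarrow> z = 0" using fixed0 by blast
  qed (rule halfspaces C1 C2; assumption)+
qed

text \<open>Both statements on fixed lines remove a multiple of \<open>v\<close> or \<open>a\<close>
  from a fixed vector and show that the remainder \<open>u\<close> is zero. For \<open>v\<close>,
  \<open>u\<close> is orthogonal to every facet normal active there, and a vertex leaves no room to
  move along such a direction; for \<open>a\<close>, \<open>u\<close> is orthogonal to all vertices
  of the facet, which span.\<close>

lemma polytope_data:
  obtains v a where "origin_body T" "v \<noteq> 0" "a \<noteq> 0" "v \<bullet> a = 1"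
    "\<And>y. support_fun T y = orbit_max v y" "\<And>y. y \<noteq> 0 \<Longrightarrow> gauge_fun T y = orbit_max a y"
    "\<forall>x. (\<forall>g\<in>stab v. g x = x) \<longrightarrow> x \<in> span {v}"
    "\<forall>x. (\<forall>g\<in>stab a. g x = x) \<longrightarrow> x \<in> span {a}"
    "span ((\<lambda>g. g v) ` sym_group T) = UNIV"
    "\<forall>z. (\<forall>g\<in>sym_group T. g z = z) \<longrightarrow> z = 0"
    "tangential T \<Longrightarrow> norm a = 1"
proof -
  obtain v a where zero: "0 \<in> interior T" and vT: "v \<in> T" and v: "v extreme_point_of T"
    and hull: "T = convex hull ((\<lambda>g. g v) ` sym_group T)" and va: "v \<bullet> a = 1"
    and half: "\<And>x. x \<in> T \<longleftrightarrow> (\<forall>g\<in>sym_group T. g a \<bullet> x \<le> 1)"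
    and C1: "\<And>g. g \<in> sym_group T \<Longrightarrow> v \<bullet> g a = 1 \<Longrightarrow> \<exists>k\<in>sym_group T. k v = v \<and> k a = g a"
    and C2: "\<And>g. g \<in> sym_group T \<Longrightarrow> g v \<bullet> a = 1 \<Longrightarrow> \<exists>k\<in>sym_group T. k a = a \<and> k v = g v"
    and C3: "\<forall>u. (\<forall>g\<in>sym_group T. g v \<bullet> a = 1 \<longrightarrow> g v \<bullet> u = 0) \<longrightarrow> u = 0"
    and fixed0: "\<forall>z. (\<forall>g\<in>sym_group T. g z = z) \<longrightarrow> z = 0"
    and C4: "\<exists>F. F facet_of T \<and> F = T \<inter> {x. a \<bullet> x = 1} \<and> affine hull F \<subseteq> {x. a \<bullet> x = 1} \<and> aff_dim F = int (DIM('a) - 1)"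
    by (rule vertex_facet_data) (rule that)
  have body: "origin_body T" using zero compact_T convex_T interior_T by (simp add: origin_body_def convex_body_def)
  have nz: "v \<noteq> 0" "a \<noteq> 0" using va by auto
  have supp: "support_fun T y = orbit_max v y" for y
  proof (rule antisym)
    have "(\<lambda>g. g v) ` sym_group T \<subseteq> {x. y \<bullet> x \<le> orbit_max v y}"
      using orbit_max_ge by (auto simp: inner_commute)
    then have "T \<subseteq> {x. y \<bullet> x \<le> orbit_max v y}" by (subst hull) (rule hull_minimal[where S = convex, OF _ convex_halfspace_le])
    then show "support_fun T y \<le> orbit_max v y"
      using vT by (intro support_fun_le) (auto simp: inner_commute)
    show "orbit_max v y \<le> support_fun T y"
      unfolding orbit_max_le_iff using inner_le_support_fun[OF compact_T act_T[OF _ vT]] by blast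
  qed
  have gauge: "gauge_fun T y = orbit_max a y" if y: "y \<noteq> 0" for y
  proof -
    have iff: "gauge_fun T y \<le> c \<longleftrightarrow> orbit_max a y \<le> c" if "c > 0" for c
      unfolding gauge_fun_le_iff[OF body y that] half orbit_max_le_iff using that by (simp add: field_simps)
    have gp: "gauge_fun T y > 0" by (rule gauge_fun_pos[OF body y])
    have "orbit_max a y > 0"
    proof (rule ccontr)
      assume "\<not> orbit_max a y > 0"
      then show False using iff[of "gauge_fun T y / 2"] gp by simp
    qed
    then show ?thesis using iff[of "orbit_max a y"] iff[of "gauge_fun T y"] gp by simp
  qed
  have fixv: "x \<in> span {v}" if x: "\<And>g. g \<in> stab v \<Longrightarrow> g x = x" for x
  proof -
    \<comment> \<open>Since \<open>v \<bullet> a = 1\<close>, this \<open>u\<close> is orthogonal to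
      \<open>a\<close>, and then to every normal active at \<open>v\<close>, as these are images of
      \<open>a\<close> under the stabilizer of \<open>v\<close>.\<close>
    define u where "u = x - (a \<bullet> x) *\<^sub>R v"
    have gu: "g a \<bullet> u = 0" if g: "g \<in> sym_group T" "g a \<bullet> v = 1" for g
    proof -
      obtain k where k: "k \<in> sym_group T" "k v = v" "k a = g a" using C1[OF g(1)] g(2) by (auto simp: inner_commute)
      then have "k x = x" using x by (simp add: stab_def)
      then have "g a \<bullet> x = a \<bullet> x" using inner_act[OF k(1), of a x] k by simp
      then show ?thesis using g(2) by (simp add: u_def inner_diff_right)
    qed
    \<comment> \<open>Constraints active at \<open>v\<close> are constant along \<open>u\<close>;
      the others are strict and survive small steps. The signs \<open>c = 1\<close> and
      \<open>c = -1\<close> together put \<open>v\<close> inside a segment of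
      \<open>T\<close>.\<close>
    have ev: "\<forall>\<^sub>F t in at_right (0::real). v + (c * t) *\<^sub>R u \<in> T" for c
    proof -
      have "\<forall>g\<in>sym_group T. \<forall>\<^sub>F t in at_right (0::real). g a \<bullet> (v + (c * t) *\<^sub>R u) \<le> 1"
      proof
        fix g assume g: "g \<in> sym_group T"
        show "\<forall>\<^sub>F t in at_right (0::real). g a \<bullet> (v + (c * t) *\<^sub>R u) \<le> 1"
        proof (cases "g a \<bullet> v = 1")
          case True then show ?thesis using gu[OF g] by (simp add: inner_add_right)
        next
          case False
          then have lt: "g a \<bullet> v < 1" using half vT g by force
          have "((\<lambda>t. g a \<bullet> (v + (c * t) *\<^sub>R u)) \<longlongrightarrow> g a \<bullet> (v + (c * 0) *\<^sub>R u)) (at_right 0)"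
            by (intro tendsto_intros)
          then have "\<forall>\<^sub>F t in at_right (0::real). g a \<bullet> (v + (c * t) *\<^sub>R u) < 1"
            by (rule order_tendstoD(2)) (use lt in simp)
          then show ?thesis by eventually_elim simp
        qed
      qed
      then show ?thesis using eventually_ball_finite[OF fin] by (simp add: half)
    qed
    have "u = 0"
    proof (rule ccontr)
      assume u: "u \<noteq> 0"
      obtain t :: real where t: "t > 0" "v + (1 * t) *\<^sub>R u \<in> T" "v + ((-1) * t) *\<^sub>R u \<in> T"
        using eventually_happens'[OF trivial_limit_at_right_real eventually_conj[OF eventually_at_right_less[of 0] eventually_conj[OF ev[of 1] ev[of "-1"]]]]
        by blast
      have "v \<in> open_segment (v + (1 * t) *\<^sub>R u) (v + ((-1) * t) *\<^sub>R u)"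
        unfolding in_segment using t u by (auto intro!: exI[of _ "1/2"] simp: algebra_simps scaleR_left_distrib[symmetric])
      then show False using v t by (auto simp: extreme_point_of_def)
    qed
    then show ?thesis by (simp add: u_def span_singleton)
  qed
  have fixa: "x \<in> span {a}" if x: "\<And>g. g \<in> stab a \<Longrightarrow> g x = x" for x
  proof -
    define u where "u = x - (v \<bullet> x) *\<^sub>R a"
    have "\<forall>g\<in>sym_group T. g v \<bullet> a = 1 \<longrightarrow> g v \<bullet> u = 0"
    proof (intro ballI impI)
      fix g assume g: "g \<in> sym_group T" "g v \<bullet> a = 1"
      obtain k where k: "k \<in> sym_group T" "k a = a" "k v = g v" using C2[OF g] by auto
      then have "k x = x" using x by (simp add: stab_def)
      then have "g v \<bullet> x = v \<bullet> x" using inner_act[OF k(1), of v x] k by simp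
      then show "g v \<bullet> u = 0" using g(2) by (simp add: u_def inner_diff_right)
    qed
    then have "u = 0" using C3 by blast
    then show ?thesis by (simp add: u_def span_singleton)
  qed
  have sp: "span ((\<lambda>g. g v) ` sym_group T) = UNIV"
  proof (rule ccontr)
    assume "span ((\<lambda>g. g v) ` sym_group T) \<noteq> UNIV"
    then obtain u where "u \<noteq> 0" "\<And>x. x \<in> span ((\<lambda>g. g v) ` sym_group T) \<Longrightarrow> u \<bullet> x = 0"
      using span_not_univ_subset_hyperplane[of "(\<lambda>g. g v) ` sym_group T"] by auto
    then have "\<forall>g\<in>sym_group T. g v \<bullet> u = 0" by (metis imageI inner_commute span_base)
    then show False using C3 \<open>u \<noteq> 0\<close> by blast
  qed
  have tang: "norm a = 1" if tan: "tangential T"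
  proof -
    obtain F where F: "F facet_of T" "F = T \<inter> {x. a \<bullet> x = 1}" "affine hull F \<subseteq> {x. a \<bullet> x = 1}" "aff_dim F = int (DIM('a) - 1)"
      using C4 by blast
    obtain y where y: "affine hull F \<inter> sphere 0 1 = {y}" using tan F(1) unfolding tangential_def by blast
    have "affine hull F = {x. a \<bullet> x = 1}"
    proof (rule affine_dim_equal)
      show "affine hull F \<noteq> {}" using y by auto
      show "aff_dim (affine hull F) = aff_dim {x. a \<bullet> x = 1}"
        using F(4) nz by (simp add: of_nat_diff Suc_leI)
    qed (auto simp: affine_hyperplane F(3))
    then have y1: "a \<bullet> y = 1" "norm y = 1" and uniq: "\<And>z. a \<bullet> z = 1 \<Longrightarrow> norm z = 1 \<Longrightarrow> z = y"
      using y by auto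
    text \<open>The reflection of the touching point in the line spanned by \<open>a\<close> is again a touching point.\<close>
    define z where "z = (2 / (a \<bullet> a)) *\<^sub>R a - y"
    have aa: "a \<bullet> a > 0" using nz by simp
    have "a \<bullet> z = 1" using aa y1 by (simp add: z_def inner_diff_right)
    moreover have "z \<bullet> z = y \<bullet> y"
      using aa y1 by (simp add: z_def inner_diff_left inner_diff_right inner_commute field_simps)
    then have "norm z = 1" using y1 by (simp add: norm_eq_sqrt_inner)
    ultimately have "z = y" by (rule uniq)
    then have "2 *\<^sub>R y = (2 / (a \<bullet> a)) *\<^sub>R a" by (simp add: z_def scaleR_2 diff_eq_eq)
    then have "norm (2 *\<^sub>R y) = norm ((2 / (a \<bullet> a)) *\<^sub>R a)" by simp
    then have "2 = 2 / (norm a * norm a) * norm a" using y1 by (simp add: dot_square_norm power2_eq_square)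
    then show ?thesis using nz by (simp add: field_simps)
  qed
  show ?thesis by (rule that[OF body nz va supp gauge _ _ sp fixed0 tang]) (use fixv fixa in auto)
qed

text \<open>A quantitative form of irreducibility. If the orbit of \<open>x\<close> had no positive
  inner product with \<open>y\<close>, then, since the orbit sums to zero, all of them would vanish,
  and the orbit would span a proper invariant subspace. Compactness of the product of two spheres
  turns positivity into a uniform \<open>k\<close>.\<close>

lemma irreducible_bound:
  obtains k where "k > 0" "\<And>x y. k * norm x * norm y \<le> orbit_max x y"
proof -
  obtain v a where fixv: "\<forall>x. (\<forall>g\<in>stab v. g x = x) \<longrightarrow> x \<in> span {v}"
    and sp: "span ((\<lambda>g. g v) ` sym_group T) = UNIV"
    and fixed0: "\<forall>z. (\<forall>g\<in>sym_group T. g z = z) \<longrightarrow> z = 0"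
    by (rule polytope_data) (rule that)
  have pos: "orbit_max x y > 0" if xy: "norm x = 1" "norm y = 1" for x y
  proof (rule ccontr)
    assume "\<not> orbit_max x y > 0"
    then have le: "g x \<bullet> y \<le> 0" if "g \<in> sym_group T" for g using orbit_max_ge[OF that, of x y] by simp
    define L where "L = span ((\<lambda>g. g x) ` sym_group T)"
    have stab0: "stab 0 = sym_group T" using lin by (auto simp: stab_def linear_0)
    have Linv: "h z \<in> L" if "h \<in> sym_group T" "z \<in> L" for h z
    proof -
      have "h z \<in> span (h ` (\<lambda>g. g x) ` sym_group T)"
        using that(2) by (simp add: L_def linear_span_image[OF lin[OF that(1)]])
      also have "\<dots> \<subseteq> L" unfolding L_def by (rule span_mono) (auto simp: image_image intro!: image_eqI[OF _ comp_mem[OF that(1)]])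
      finally show ?thesis .
    qed
    have sum0: "(\<Sum>g\<in>sym_group T. g x) = 0"
      using fixed0 sum_stab_fixed[of _ 0 x] stab0 by simp
    have "(\<Sum>g\<in>sym_group T. g x \<bullet> y) = 0" using sum0 by (simp flip: inner_sum_left)
    then have all0: "g x \<bullet> y = 0" if "g \<in> sym_group T" for g
      using sum_nonneg_eq_0_iff[OF fin, of "\<lambda>g. - (g x \<bullet> y)"] le that by (auto simp: sum_negf)
    have yL: "z \<bullet> y = 0" if "z \<in> L" for z
    proof -
      have "L \<subseteq> {z. y \<bullet> z = 0}" unfolding L_def
        by (rule span_minimal[OF _ subspace_hyperplane]) (auto simp: all0 inner_commute[of y])
      then show ?thesis using that by (auto simp: inner_commute)
    qed
    \<comment> \<open>The component \<open>p\<close> of \<open>v\<close> in the invariant subspace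
      \<open>L\<close> is fixed by the stabilizer of \<open>v\<close>, hence a multiple of
      \<open>v\<close>. So \<open>v\<close>, and with it its whole orbit, either lies in
      \<open>L\<close> or is orthogonal to \<open>L\<close>; since that orbit spans the space, both
      are impossible.\<close>
    obtain p q where pq: "p \<in> span L" "\<And>w. w \<in> span L \<Longrightarrow> orthogonal q w" "v = p + q"
      using orthogonal_subspace_decomp_exists by blast
    have spL: "span L = L" unfolding L_def by (rule span_span)
    have "\<forall>h\<in>stab v. h p = p"
    proof
      fix h assume "h \<in> stab v"
      then have h: "h \<in> sym_group T" "h v = v" by (auto simp: stab_def)
      have 1: "h p - p \<in> L" using Linv[OF h(1), of p] pq(1) span_diff[of "h p" L p] unfolding spL by blast
      have "h p + h q = p + q" using h(2) pq(3) linear_add[OF lin[OF h(1)]] by metis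
      then have eq: "h p - p = q - h q" by (simp add: algebra_simps)
      have "(q - h q) \<bullet> w = 0" if w: "w \<in> L" for w
      proof -
        have "q \<bullet> w = 0" using pq(2) w spL by (auto simp: orthogonal_def)
        moreover have "h q \<bullet> w = 0"
          using pq(2) Linv[OF inv_mem[OF h(1)] w] spL by (auto simp: orthogonal_def inner_act_inv[OF h(1)])
        ultimately show ?thesis by (simp add: inner_diff_left)
      qed
      from this[OF 1] show "h p = p" using eq by simp
    qed
    then have "p \<in> span {v}" using fixv by blast
    then obtain c where c: "p = c *\<^sub>R v" by (auto simp: span_singleton)
    show False
    proof (cases "c = 0")
      case False
      have "v \<in> L" using pq(1) c False spL by (metis L_def span_clauses(4) scaleR_scaleR left_inverse scaleR_one)
      then have "span ((\<lambda>g. g v) ` sym_group T) \<subseteq> L"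
        using Linv by (intro span_minimal) (auto simp: L_def)
      then have "y \<in> L" using sp by auto
      then have "y \<bullet> y = 0" by (rule yL)
      then show False using xy by auto
    next
      case True
      have xL: "x \<in> L" unfolding L_def by (rule span_base) (rule image_eqI[OF _ id_mem], simp)
      have "v = q" using c True pq(3) by simp
      then have vL: "v \<bullet> w = 0" if "w \<in> L" for w using pq(2) that spL by (auto simp: orthogonal_def)
      have "g v \<bullet> x = 0" if "g \<in> sym_group T" for g
        using vL[OF Linv[OF inv_mem[OF that] xL]] inner_act_inv[OF that] by simp
      then have "span ((\<lambda>g. g v) ` sym_group T) \<subseteq> {z. x \<bullet> z = 0}"
        by (intro span_minimal subspace_hyperplane) (auto simp: inner_commute[of x])
      then have "x \<bullet> x = 0" using sp by blast
      then show False using xy by auto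
    qed
  qed
  let ?S = "sphere (0::'a) 1 \<times> sphere (0::'a) 1"
  have "continuous_on ?S (\<lambda>p. orbit_max (fst p) (snd p))"
  proof (rule continuous_on_Lipschitz_real[of _ _ 2])
    fix p p' assume pp: "p \<in> ?S" "p' \<in> ?S"
    have "orbit_max (fst p) (snd p) - orbit_max (fst p') (snd p') \<le> 2 * norm (p - p')" if "p \<in> ?S" "p' \<in> ?S" for p p'
      using orbit_max_diff_le[of "fst p" "snd p" "fst p'" "snd p'"] that norm_fst_le[of "fst (p - p')" "snd (p - p')"] norm_snd_le[of "snd (p - p')" "fst (p - p')"]
      unfolding prod.collapse by (auto simp: mem_Times_iff)
    from this[OF pp] this[OF pp(2,1)]
    show "\<bar>orbit_max (fst p) (snd p) - orbit_max (fst p') (snd p')\<bar> \<le> 2 * norm (p - p')"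
      by (simp add: norm_minus_commute abs_le_iff)
  qed
  moreover have "compact ?S" by (intro compact_Times compact_sphere)
  moreover have "?S \<noteq> {}" using ex_norm_one by auto
  ultimately obtain p where p: "p \<in> ?S" "\<And>q. q \<in> ?S \<Longrightarrow> orbit_max (fst p) (snd p) \<le> orbit_max (fst q) (snd q)"
    using continuous_attains_inf[of ?S] by blast
  define k where "k = orbit_max (fst p) (snd p)"
  have k: "k > 0" using pos p(1) by (auto simp: k_def)
  have sym: "orbit_max x (c *\<^sub>R y) = c * orbit_max x y" if "c \<ge> 0" for x y c
  proof (rule antisym)
    show "orbit_max x (c *\<^sub>R y) \<le> c * orbit_max x y"
      unfolding orbit_max_le_iff using orbit_max_ge that by (auto simp: mult_left_mono)
    obtain g where "g \<in> sym_group T" "orbit_max x y = g x \<bullet> y" by (rule orbit_max_attained)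
    then show "c * orbit_max x y \<le> orbit_max x (c *\<^sub>R y)" using orbit_max_ge[of g x "c *\<^sub>R y"] by simp
  qed
  have "k * norm x * norm y \<le> orbit_max x y" for x y
  proof (cases "x = 0 \<or> y = 0")
    case True
    then show ?thesis using orbit_max_ge[OF id_mem, of x y] by auto
  next
    case False
    have "k \<le> orbit_max (x /\<^sub>R norm x) (y /\<^sub>R norm y)"
      using p(2)[of "(x /\<^sub>R norm x, y /\<^sub>R norm y)"] False by (simp add: k_def)
    also have "\<dots> = orbit_max x y / (norm x * norm y)"
      by (simp add: sym orbit_max_scale divide_inverse)
    finally show ?thesis using False by (simp add: field_simps)
  qed
  with k show ?thesis using that by blast
qed

end

subsection \<open>Existence and localization of maximizers\<close>

lemma Vq_le_iff:
  assumes "origin_body A" "origin_body B"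
  shows "Vq q A \<le> Vq q B \<longleftrightarrow> power_integral (\<lambda>_. 1) (-q) (gauge_fun A) \<le> power_integral (\<lambda>_. 1) (-q) (gauge_fun B)"
  using power_integral_pos[OF weight_one gauge_fun_cont_pos_sphere[OF assms(2)], of "-q"]
  by (simp add: Vq_eq_power_integral assms ennreal_le_iff)

lemma mult_converges_hausdist:
  assumes A: "\<And>n. origin_body (A n)" and B: "origin_body B" and lim: "mult_converges A B"
    and R: "\<And>n. A n \<subseteq> cball 0 R" and e: "e > 0"
  shows "\<forall>\<^sub>F n in sequentially. hausdist (A n) B < e"
proof -
  obtain R' where R': "R' > 0" "B \<subseteq> cball 0 R'" using origin_body_outball[OF B] .
  define M where "M = max \<bar>R\<bar> R'"
  have M: "M > 0" "A n \<subseteq> cball 0 M" "B \<subseteq> cball 0 M" for n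
    using R' R[of n] by (force simp: M_def)+
  have "\<forall>\<^sub>F n in sequentially. mult_close (e / (2 * M)) (A n) B"
    using lim e M by (simp add: mult_converges_def)
  then show ?thesis
  proof eventually_elim
    case (elim n)
    have "hausdist (A n) B \<le> e / (2 * M) * M"
      by (rule hausdist_mult_close_le[OF elim A B _ M(2,3)]) (use e M in simp)
    also have "\<dots> < e" using e M by simp
    finally show ?case .
  qed
qed

lemma Sup_limit_sequence:
  fixes F :: "'b \<Rightarrow> ennreal"
  assumes "S \<noteq> {}"
  obtains x where "\<And>n. x n \<in> S" "(\<lambda>n::nat. F (x n)) \<longlonglongrightarrow> (SUP y\<in>S. F y)"
proof -
  obtain u :: "nat \<Rightarrow> ennreal" where u: "incseq u" "range u \<subseteq> F ` S" "(SUP y\<in>S. F y) = (SUP i. u i)"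
    using ennreal_Sup_countable_SUP[of "F ` S"] assms by auto
  have "\<forall>n. \<exists>x. x \<in> S \<and> u n = F x" using u(2) by blast
  then obtain x where x: "\<And>n. x n \<in> S" "\<And>n. u n = F (x n)" by metis
  have "u \<longlonglongrightarrow> (SUP i. u i)" using u(1) by (rule LIMSEQ_SUP)
  moreover have "(\<lambda>n. F (x n)) = u" using x(2) by auto
  ultimately show ?thesis using that[of x] x(1) u(3) by simp
qed

context regular_poly begin

lemma origin_body_T: "origin_body T"
  by (rule polytope_data) assumption

lemma admissible_iff:
  assumes f: "weight c1 c2 f"
  shows "admissible T f p d \<Omega> \<longleftrightarrow> origin_body \<Omega> \<and> (\<forall>g\<in>sym_group T. g ` \<Omega> = \<Omega>) \<and>
     power_integral f p (support_fun \<Omega>) = power_integral f p (support_fun T) \<and> hausdist \<Omega> T < d"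
proof -
  have "Ipf f p \<Omega> = Ipf f p T \<longleftrightarrow> power_integral f p (support_fun \<Omega>) = power_integral f p (support_fun T)"
    if "origin_body \<Omega>" for \<Omega>
    using power_integral_pos[OF f support_fun_cont_pos_sphere[OF that], of p]
      power_integral_pos[OF f support_fun_cont_pos_sphere[OF origin_body_T], of p]
    by (simp add: Ipf_eq_power_integral[OF f] that origin_body_T ennreal_inj)
  then show ?thesis by (auto simp: admissible_def origin_body_def)
qed

lemma admissible_T:
  assumes "weight c1 c2 f" "d > 0" shows "admissible T f p d T"
proof -
  have "hausdist T T \<le> 0" using origin_body_zero[OF origin_body_T] by (intro hausdist_leI) auto
  then show ?thesis using assms by (simp add: admissible_iff[OF assms(1)] origin_body_T) (simp add: sym_group_def)
qed

lemma limit_body: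
  assumes A: "\<And>n. origin_body (A n)" and inv: "\<And>n. \<forall>g\<in>sym_group T. g ` A n = A n"
    and r: "r > 0" "\<And>n. cball 0 r \<subseteq> A n" and R: "\<And>n. A n \<subseteq> cball 0 R"
  obtains k B where "strict_mono (k :: nat \<Rightarrow> nat)" "origin_body B" "mult_converges (A \<circ> k) B"
    "\<forall>g\<in>sym_group T. g ` B = B"
proof -
  obtain k B where kB: "strict_mono (k :: nat \<Rightarrow> nat)" "origin_body B" "mult_converges (A \<circ> k) B"
    by (rule Blaschke_selection[OF A r R])
  have sub: "g ` B \<subseteq> B" if "g \<in> sym_group T" for g
    by (rule mult_converges_invariant[OF lin[OF that] _ kB(3,2)]) (use inv that in simp)
  have "g ` B = B" if g: "g \<in> sym_group T" for g
  proof
    show "B \<subseteq> g ` B"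
      using sub[OF inv_mem[OF g]] act_inv[OF g] by (metis image_eqI image_subset_iff subsetI)
  qed (rule sub[OF g])
  with kB show ?thesis using that by blast
qed

text \<open>The bounds give a convergent maximizing sequence, but the condition on the distance is
  open. Restricting to competitors at least as good as \<open>T\<close> keeps the sequence within
  \<open>e < d\<close> of \<open>T\<close>, so the limit is still admissible.\<close>

lemma maximizer_exists:
  assumes f: "weight c1 c2 f" and d: "0 < d" and r: "r > 0" and e: "e < d"
    and bounds: "\<And>\<Omega>. admissible T f p d \<Omega> \<Longrightarrow> cball 0 r \<subseteq> \<Omega> \<and> \<Omega> \<subseteq> cball 0 R"
    and loc: "\<And>\<Omega>. admissible T f p d \<Omega> \<Longrightarrow> Vq q T \<le> Vq q \<Omega> \<Longrightarrow> hausdist \<Omega> T \<le> e"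
  shows "\<exists>\<Omega>. admissible T f p d \<Omega> \<and> (\<forall>\<Omega>'. admissible T f p d \<Omega>' \<longrightarrow> Vq q \<Omega>' \<le> Vq q \<Omega>)"
proof -
  let ?S = "{\<Omega>. admissible T f p d \<Omega> \<and> Vq q T \<le> Vq q \<Omega>}"
  have "T \<in> ?S" using admissible_T[OF f d] by simp
  then obtain A where A: "\<And>n. A n \<in> ?S" and supA: "(\<lambda>n. Vq q (A n)) \<longlonglongrightarrow> (SUP \<Omega>\<in>?S. Vq q \<Omega>)"
    using Sup_limit_sequence[of ?S "Vq q"] by blast
  have adm: "origin_body (A n)" "\<forall>g\<in>sym_group T. g ` A n = A n"
    "power_integral f p (support_fun (A n)) = power_integral f p (support_fun T)" for n
    using A[of n] by (auto simp: admissible_iff[OF f])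
  have rR: "cball 0 r \<subseteq> A n" "A n \<subseteq> cball 0 R" for n using A[of n] bounds by auto
  obtain k B where k: "strict_mono k" and B: "origin_body B" and lim: "mult_converges (A \<circ> k) B"
    and inv': "\<forall>g\<in>sym_group T. g ` B = B"
    by (rule limit_body[where A = A, OF adm(1,2) r rR]) (rule that)
  have Ak: "origin_body ((A \<circ> k) n)" for n using adm by simp
  have "(\<lambda>n. power_integral f p (support_fun ((A \<circ> k) n))) \<longlonglongrightarrow> power_integral f p (support_fun B)"
    by (rule tendsto_power_integral_support_fun[OF f Ak B lim])
  then have IB: "power_integral f p (support_fun B) = power_integral f p (support_fun T)"
    using adm(3) by (simp add: LIMSEQ_const_iff)
  have "(\<lambda>n. Vq q ((A \<circ> k) n)) \<longlonglongrightarrow> Vq q B"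
    unfolding Vq_eq_power_integral[OF Ak] Vq_eq_power_integral[OF B]
    by (intro tendsto_ennrealI tendsto_power_integral_gauge_fun[OF weight_one Ak B lim])
  moreover have "(\<lambda>n. Vq q ((A \<circ> k) n)) \<longlonglongrightarrow> (SUP \<Omega>\<in>?S. Vq q \<Omega>)"
    using LIMSEQ_subseq_LIMSEQ[OF supA k] by (simp add: o_def)
  ultimately have VB: "Vq q B = (SUP \<Omega>\<in>?S. Vq q \<Omega>)" using LIMSEQ_unique by blast
  have le: "Vq q \<Omega> \<le> Vq q B" if "admissible T f p d \<Omega>" for \<Omega>
  proof (cases "Vq q T \<le> Vq q \<Omega>")
    case True then show ?thesis unfolding VB using that by (intro SUP_upper) simp
  next
    case False
    moreover have "Vq q T \<le> Vq q B" unfolding VB using \<open>T \<in> ?S\<close> by (rule SUP_upper)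
    ultimately show ?thesis by simp
  qed
  have "\<forall>\<^sub>F n in sequentially. hausdist ((A \<circ> k) n) B < d - e"
    by (rule mult_converges_hausdist[OF Ak B lim]) (use rR e in auto)
  then obtain n where n: "hausdist (A (k n)) B < d - e"
    by (auto dest!: eventually_happens'[OF sequentially_bot])
  \<comment> \<open>A member of the sequence is within \<open>e\<close> of \<open>T\<close> and
    closer than \<open>d - e\<close> to the limit, so the strict bound \<open>d\<close>
    survives.\<close>
  have "hausdist B T \<le> hausdist B (A (k n)) + hausdist (A (k n)) T"
    by (rule hausdist_triangle) (use B adm(1)[of "k n"] origin_body_T origin_body_compact origin_body_zero in blast)+
  also have "\<dots> < (d - e) + e" using n loc[of "A (k n)"] A[of "k n"] by (simp add: hausdist_commute)
  finally have "admissible T f p d B" using B inv' IB by (simp add: admissible_iff[OF f])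
  then show ?thesis using le by blast
qed

section \<open>Uniform inner and outer radii of competitors\<close>

lemma hausdist_support_fun_le:
  assumes "origin_body A" "origin_body B" "norm y = 1"
  shows "support_fun A y \<le> support_fun B y + hausdist A B"
proof -
  obtain x where x: "x \<in> A" "support_fun A y = x \<bullet> y"
    using support_fun_attained[OF origin_body_compact[OF assms(1)]] origin_body_zero[OF assms(1)] by blast
  obtain z where z: "z \<in> B" "dist x z \<le> hausdist A B"
    using hausdistD[OF origin_body_compact[OF assms(1)] origin_body_compact[OF assms(2)] _ x(1)] origin_body_zero[OF assms(2)] by blast
  have "(x - z) \<bullet> y \<le> dist x z" using norm_cauchy_schwarz[of "x - z" y] assms(3) by (simp add: dist_norm)
  then show ?thesis
    using x z inner_le_support_fun[OF origin_body_compact[OF assms(2)] z(1), of y] by (simp add: inner_diff_left)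
qed

text \<open>A Hausdorff distance below \<open>r/2\<close> lowers the support function by less than
  \<open>r/2\<close>, so half of the inscribed ball of \<open>T\<close> remains.\<close>

lemma uniform_bounds_near_T:
  obtains d r R where "d > 0" "r > 0"
    "\<And>\<Omega>. origin_body \<Omega> \<Longrightarrow> hausdist \<Omega> T < d \<Longrightarrow> cball 0 r \<subseteq> \<Omega> \<and> \<Omega> \<subseteq> cball 0 R"
proof -
  obtain r where r: "r > 0" "cball 0 r \<subseteq> T" using origin_body_inball[OF origin_body_T] .
  obtain R where R: "R > 0" "T \<subseteq> cball 0 R" using origin_body_outball[OF origin_body_T] .
  show ?thesis
  proof (rule that[of "r/2" "r/2" "R + r"])
    fix \<Omega> assume \<Omega>: "origin_body \<Omega>" and h: "hausdist \<Omega> T < r/2"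
    have "x \<in> \<Omega>" if x: "norm x \<le> r/2" for x
      unfolding mem_iff_support_fun[OF origin_body_compact[OF \<Omega>] origin_body_convex[OF \<Omega>] ex_in_conv[THEN iffD1, OF exI, OF origin_body_zero[OF \<Omega>]]]
    proof (intro allI impI)
      fix y :: 'a assume y: "norm y = 1"
      have "r \<le> support_fun T y" using support_fun_ge[OF compact_T r(2), of y] r y by simp
      also have "\<dots> \<le> support_fun \<Omega> y + hausdist T \<Omega>" by (rule hausdist_support_fun_le[OF origin_body_T \<Omega> y])
      finally have "r/2 \<le> support_fun \<Omega> y" using h by (simp add: hausdist_commute)
      moreover have "x \<bullet> y \<le> r/2" using norm_cauchy_schwarz[of x y] x y by simp
      ultimately show "x \<bullet> y \<le> support_fun \<Omega> y" by linarith
    qed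
    moreover have "norm x \<le> R + r" if x: "x \<in> \<Omega>" for x
    proof -
      obtain t where t: "t \<in> T" "dist x t \<le> hausdist \<Omega> T"
        using hausdistD[OF origin_body_compact[OF \<Omega>] compact_T _ x] origin_body_zero[OF origin_body_T] by blast
      have "norm x \<le> norm t + dist x t" using norm_triangle_ineq[of t "x - t"] by (simp add: dist_norm)
      also have "\<dots> \<le> R + r" using t R h r by auto
      finally show ?thesis .
    qed
    ultimately show "cball 0 (r/2) \<subseteq> \<Omega> \<and> \<Omega> \<subseteq> cball 0 (R + r)" by auto
  qed (use r in auto)
qed

text \<open>For a farthest point \<open>x\<close> of an invariant body, irreducibility gives
  \<open>k * norm x \<le> support_fun \<Omega> y \<le> norm x\<close> on the sphere. Comparing the
  constraint with constant functions confines \<open>norm x\<close> between \<open>\<rho>\<close>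
  and \<open>\<rho> / k\<close>, whatever the distance bound \<open>d\<close>.\<close>

lemma uniform_bounds_constraint:
  assumes f: "weight c1 c2 f" and p: "p \<noteq> 0"
  obtains r R where "r > 0" "\<And>\<Omega> d. admissible T f p d \<Omega> \<Longrightarrow> cball 0 r \<subseteq> \<Omega> \<and> \<Omega> \<subseteq> cball 0 R"
proof -
  obtain k where k: "k > 0" "\<And>x y. k * norm x * norm y \<le> orbit_max x y" by (rule irreducible_bound) (rule that)
  have one: "cont_pos_sphere (\<lambda>_::'a. 1)" by (simp add: cont_pos_sphere_def)
  have const: "cont_pos_sphere (\<lambda>_::'a. c)" if "c > 0" for c :: real
    using that by (simp add: cont_pos_sphere_def)
  define I where "I = power_integral f p (\<lambda>_. 1)"
  have I: "I > 0" unfolding I_def by (rule power_integral_pos[OF f one])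
  have pmc: "power_integral f p (\<lambda>_. c) = c powr p * I" if "c > 0" for c
    using power_integral_scale[OF that, of "\<lambda>_. 1" f p] by (simp add: I_def)
  define P where "P = power_integral f p (support_fun T)"
  have P: "P > 0" unfolding P_def by (rule power_integral_pos[OF f support_fun_cont_pos_sphere[OF origin_body_T]])
  \<comment> \<open>The radius of the centred ball with the same constraint integral as
    \<open>T\<close>.\<close>
  define \<rho> where "\<rho> = (P / I) powr (1 / p)"
  have \<rho>: "\<rho> > 0" using P I by (simp add: \<rho>_def)
  have P\<rho>: "P = \<rho> powr p * I" using P I p by (simp add: \<rho>_def powr_powr)
  have cancel: "c \<le> c'" if "0 < c" "0 < c'" "sgn p * (c powr p * I) \<le> sgn p * (c' powr p * I)" for c c'
  proof (rule ccontr)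
    assume "\<not> c \<le> c'"
    then have "sgn p * c' powr p < sgn p * c powr p" using that p by (intro sgn_powr_strict_mono) auto
    then have "(sgn p * c' powr p) * I < (sgn p * c powr p) * I" using I by (intro mult_strict_right_mono)
    then show False using that by (simp add: mult.assoc)
  qed
  show ?thesis
  proof (rule that[of "k * \<rho>" "\<rho> / k"])
    show "k * \<rho> > 0" using k \<rho> by simp
    fix \<Omega> d assume adm: "admissible T f p d \<Omega>"
    have \<Omega>: "origin_body \<Omega>" and inv: "\<And>g. g \<in> sym_group T \<Longrightarrow> g ` \<Omega> = \<Omega>"
      and eqP: "power_integral f p (support_fun \<Omega>) = P" using adm by (auto simp: admissible_iff[OF f] P_def)
    note cpt = origin_body_compact[OF \<Omega>] and pos = support_fun_cont_pos_sphere[OF \<Omega>]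
    have ne: "\<Omega> \<noteq> {}" using origin_body_zero[OF \<Omega>] by auto
    obtain x where x: "x \<in> \<Omega>" "\<And>z. z \<in> \<Omega> \<Longrightarrow> norm z \<le> norm x"
      using continuous_attains_sup[OF cpt ne, of norm] by (auto intro!: continuous_intros)
    obtain r0 where r0: "r0 > 0" "cball 0 r0 \<subseteq> \<Omega>" using origin_body_inball[OF \<Omega>] .
    obtain z :: 'a where "norm z = r0" using r0(1) vector_choose_size[of r0] by auto
    then have "norm x \<ge> r0" using x(2)[of z] r0 by auto
    then have nx: "norm x > 0" using r0 by linarith
    have lo: "k * norm x \<le> support_fun \<Omega> y" if y: "norm y = 1" for y
    proof -
      have "g x \<bullet> y \<le> support_fun \<Omega> y" if "g \<in> sym_group T" for g
        by (rule inner_le_support_fun[OF cpt]) (use inv[OF that] x in blast)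
      then have "orbit_max x y \<le> support_fun \<Omega> y" by (simp add: orbit_max_le_iff)
      then show ?thesis using k(2)[of x y] y by simp
    qed
    have hi: "support_fun \<Omega> y \<le> norm x" if y: "norm y = 1" for y
    proof (rule support_fun_le[OF ne])
      fix z assume "z \<in> \<Omega>"
      then show "z \<bullet> y \<le> norm x" using norm_cauchy_schwarz[of z y] y x(2)[of z] by simp
    qed
    have "sgn p * power_integral f p (\<lambda>_. k * norm x) \<le> sgn p * P"
      unfolding eqP[symmetric] by (rule power_integral_mono[OF f const pos lo]) (use k nx in auto)
    then have "sgn p * ((k * norm x) powr p * I) \<le> sgn p * (\<rho> powr p * I)"
      using pmc[of "k * norm x"] k(1) nx P\<rho> by (metis mult_pos_pos)
    then have 1: "k * norm x \<le> \<rho>"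
      by (rule cancel[rotated 2]) (use k(1) nx \<rho> in simp_all)
    have "sgn p * P \<le> sgn p * power_integral f p (\<lambda>_. norm x)"
      unfolding eqP[symmetric] by (rule power_integral_mono[OF f pos const hi]) (use nx in auto)
    then have "sgn p * (\<rho> powr p * I) \<le> sgn p * (norm x powr p * I)" using pmc[OF nx] P\<rho> by metis
    then have 2: "\<rho> \<le> norm x" by (rule cancel[rotated 2]) (use nx \<rho> in simp_all)
    have "\<Omega> \<subseteq> cball 0 (\<rho> / k)"
    proof
      fix z assume "z \<in> \<Omega>"
      then have "k * norm z \<le> \<rho>" using x(2)[of z] k(1) 1 by (meson mult_left_mono less_imp_le order_trans)
      then show "z \<in> cball 0 (\<rho> / k)" using k(1) by (simp add: field_simps)
    qed
    moreover have "cball 0 (k * \<rho>) \<subseteq> \<Omega>"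
    proof
      fix z :: 'a assume z: "z \<in> cball 0 (k * \<rho>)"
      show "z \<in> \<Omega>"
        unfolding mem_iff_support_fun[OF cpt origin_body_convex[OF \<Omega>] ne]
      proof (intro allI impI)
        fix y :: 'a assume y: "norm y = 1"
        have "z \<bullet> y \<le> k * \<rho>" using norm_cauchy_schwarz[of z y] y z by simp
        also have "\<dots> \<le> k * norm x" using 2 k by simp
        finally show "z \<bullet> y \<le> support_fun \<Omega> y" using lo[OF y] by linarith
      qed
    qed
    ultimately show "cball 0 (k * \<rho>) \<subseteq> \<Omega> \<and> \<Omega> \<subseteq> cball 0 (\<rho> / k)" by blast
  qed
qed

text \<open>All admissible bodies lie with \<open>T\<close> in one ball of radius \<open>R\<close>,
  so they are within \<open>2 * R\<close> of \<open>T\<close>; the neighbourhood radius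
  \<open>2 * R + 1\<close> leaves the gap that existence requires. This serves the parameters
  outside the asymptotic regime.\<close>

lemma local_maximizer_exists:
  assumes f: "weight c1 c2 f" and p: "p \<noteq> 0"
  shows "\<exists>\<Omega>. local_maximizer T f p q \<Omega>"
proof -
  obtain r R where r: "r > 0" and rR: "\<And>\<Omega> d. admissible T f p d \<Omega> \<Longrightarrow> cball 0 r \<subseteq> \<Omega> \<and> \<Omega> \<subseteq> cball 0 R"
    by (rule uniform_bounds_constraint[OF f p]) (rule that)
  have TR: "T \<subseteq> cball 0 R" using rR[OF admissible_T[OF f zero_less_one]] by blast
  have R: "R \<ge> 0" using TR origin_body_zero[OF origin_body_T] by auto
  have "\<exists>\<Omega>. admissible T f p (2 * R + 1) \<Omega> \<and> (\<forall>\<Omega>'. admissible T f p (2 * R + 1) \<Omega>' \<longrightarrow> Vq q \<Omega>' \<le> Vq q \<Omega>)"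
  proof (rule maximizer_exists[OF f _ r _ rR, where d = "2 * R + 1" and e = "2 * R" and q = q])
    fix \<Omega> assume "admissible T f p (2 * R + 1) \<Omega>"
    then have \<Omega>: "origin_body \<Omega>" "\<Omega> \<subseteq> cball 0 R" using rR by (auto simp: admissible_iff[OF f])
    have *: "dist x y \<le> 2 * R" if "x \<in> \<Omega>" "y \<in> T" for x y
    proof -
      have "norm x \<le> R" "norm y \<le> R" using that \<Omega> TR by auto
      then show ?thesis using norm_triangle_ineq4[of x y] by (simp add: dist_norm)
    qed
    have "0 \<in> \<Omega>" "0 \<in> T" using origin_body_zero \<Omega> origin_body_T by auto
    then show "hausdist \<Omega> T \<le> 2 * R" by (intro hausdist_leI) (auto intro: *)
  qed (use R in auto)
  then show ?thesis unfolding local_maximizer_def using R by (metis add_nonneg_pos mult_nonneg_nonneg zero_le_numeral zero_less_one)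
qed

text \<open>The radius \<open>d\<close> is fixed before the accuracy \<open>e\<close> and the
  exponent, so one neighbourhood serves all large \<open>q\<close>. A failure at some
  \<open>e\<close> would produce bodies \<open>A n\<close> with exponents at least \<open>n\<close>
  that stay away from \<open>T\<close>. Since \<open>p\<close> is fixed, the constraint passes to
  their limit \<open>B\<close>; concentration and rigidity then give \<open>B = T\<close>.\<close>

lemma localization_large_q:
  assumes f: "weight c1 c2 f" and p: "p \<noteq> 0"
  obtains d where "d > 0" "\<And>e. e > 0 \<Longrightarrow> \<exists>Q. \<forall>q\<ge>Q. \<forall>\<Omega>. admissible T f p d \<Omega> \<longrightarrow> Vq q T \<le> Vq q \<Omega> \<longrightarrow> hausdist \<Omega> T \<le> e"
    "\<exists>r>0. \<exists>R. \<forall>\<Omega>. admissible T f p d \<Omega> \<longrightarrow> cball 0 r \<subseteq> \<Omega> \<and> \<Omega> \<subseteq> cball 0 R"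
proof -
  obtain v where v: "v \<noteq> 0" and supp: "\<And>y. support_fun T y = orbit_max v y"
    and fixv: "\<forall>x. (\<forall>g\<in>stab v. g x = x) \<longrightarrow> x \<in> span {v}"
    by (rule polytope_data) (rule that)
  obtain d1 r R where d1: "d1 > 0" and r: "r > 0"
    and rR: "\<And>\<Omega>. origin_body \<Omega> \<Longrightarrow> hausdist \<Omega> T < d1 \<Longrightarrow> cball 0 r \<subseteq> \<Omega> \<and> \<Omega> \<subseteq> cball 0 R"
    by (rule uniform_bounds_near_T) (rule that)
  have suppeq: "support_fun T = orbit_max v" using supp by auto
  have posv: "cont_pos_sphere (orbit_max v)"
    using support_fun_cont_pos_sphere[OF origin_body_T] suppeq by simp
  obtain \<delta> where \<delta>: "\<delta> > 0" and rigid: "\<And>w \<psi> y. norm (w - v) < \<delta> \<Longrightarrow> norm v \<le> norm w \<Longrightarrow> cont_pos_sphere \<psi> \<Longrightarrow>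
      \<forall>y. norm y = 1 \<longrightarrow> orbit_max w y \<le> \<psi> y \<Longrightarrow>
      sgn p * power_integral f p \<psi> \<le> sgn p * power_integral f p (orbit_max v) \<Longrightarrow> norm y = 1 \<Longrightarrow> \<psi> y = orbit_max v y"
    using orbit_max_rigidity[OF f p v _ posv] fixv by metis
  have vT: "v \<in> T"
    unfolding mem_iff_support_fun[OF compact_T convex_T ex_in_conv[THEN iffD1, OF exI, OF origin_body_zero[OF origin_body_T]]] supp
    using orbit_max_ge[OF id_mem] by blast
  have Tv: "norm t \<le> norm v" if "t \<in> T" for t
  proof (cases "t = 0")
    case False
    have "norm t * norm t = t \<bullet> t" by (simp add: dot_square_norm power2_eq_square)
    also have "\<dots> \<le> orbit_max v t" using inner_le_support_fun[OF compact_T that, of t] supp by simp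
    also have "\<dots> \<le> norm v * norm t" by (rule orbit_max_le_norm)
    finally show ?thesis using False by simp
  qed simp
  \<comment> \<open>Below, \<open>norm w\<close> is at most \<open>norm v + 2\<close> and the
    squared distance from \<open>w\<close> to a suitable orbit point of \<open>v\<close> at most
    \<open>4 * d * norm w\<close>; the 8 makes this strictly smaller than the square of the rigidity
    radius.\<close>
  define d where "d = min d1 (min 1 (\<delta>\<^sup>2 / (8 * (norm v + 2))))"
  have d: "d > 0" "d \<le> d1" "d \<le> 1" using d1 \<delta> v by (auto simp: d_def intro!: divide_pos_pos add_nonneg_pos)
  have d\<delta>: "4 * d * (norm v + 2) < \<delta>\<^sup>2"
  proof -
    have "d \<le> \<delta>\<^sup>2 / (8 * (norm v + 2))" by (simp add: d_def)
    then have "d * (8 * (norm v + 2)) \<le> \<delta>\<^sup>2"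
      by (subst (asm) pos_le_divide_eq) (auto intro!: add_nonneg_pos)
    moreover have "\<delta>\<^sup>2 > 0" using \<delta> by simp
    moreover have "0 < d * (norm v + 2)" using d(1) by (intro mult_pos_pos add_nonneg_pos) auto
    ultimately show ?thesis by (simp add: algebra_simps)
  qed
  have main: "\<exists>Q. \<forall>q\<ge>Q. \<forall>\<Omega>. admissible T f p d \<Omega> \<longrightarrow> Vq q T \<le> Vq q \<Omega> \<longrightarrow> hausdist \<Omega> T \<le> e" if e: "e > 0" for e
  proof (rule ccontr)
    assume "\<not> ?thesis"
    then have "\<forall>n::nat. \<exists>q \<Omega>. q \<ge> real n \<and> admissible T f p d \<Omega> \<and> Vq q T \<le> Vq q \<Omega> \<and> \<not> hausdist \<Omega> T \<le> e"
      by meson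
    then obtain q A where q: "\<And>n. q n \<ge> real n" and adm: "\<And>n. admissible T f p d (A n)"
      and VA: "\<And>n. Vq (q n) T \<le> Vq (q n) (A n)" and far: "\<And>n. \<not> hausdist (A n) T \<le> e" by metis
    have A: "origin_body (A n)" "\<forall>g\<in>sym_group T. g ` A n = A n"
      "power_integral f p (support_fun (A n)) = power_integral f p (support_fun T)" "hausdist (A n) T < d" for n
      using adm[of n] by (auto simp: admissible_iff[OF f])
    have bd: "cball 0 r \<subseteq> A n" "A n \<subseteq> cball 0 R" for n using rR[OF A(1)[of n]] A(4)[of n] d(2) by auto
    obtain k B where k: "strict_mono k" and B: "origin_body B" and lim: "mult_converges (A \<circ> k) B"
      and inv': "\<forall>g\<in>sym_group T. g ` B = B"
      by (rule limit_body[where A = A, OF A(1,2) r bd]) (rule that)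
    have inv: "g ` B = B" if "g \<in> sym_group T" for g using inv' that by blast
    have Ak: "origin_body ((A \<circ> k) n)" for n using A(1) by simp
    have close: "\<forall>\<^sub>F n in sequentially. mult_close e' (A (k n)) B" if "e' > 0" for e'
      using lim that by (simp add: mult_converges_def)
    have "(\<lambda>n. power_integral f p (support_fun ((A \<circ> k) n))) \<longlonglongrightarrow> power_integral f p (support_fun B)"
      by (rule tendsto_power_integral_support_fun[OF f Ak B lim])
    then have IB: "power_integral f p (support_fun B) = power_integral f p (orbit_max v)"
      using A(3) by (simp add: LIMSEQ_const_iff suppeq)
    have "\<exists>w\<in>B. norm v \<le> norm w"
    proof (rule ccontr)
      assume "\<not> (\<exists>w\<in>B. norm v \<le> norm w)"
      moreover obtain x where x: "x \<in> B" "\<And>z. z \<in> B \<Longrightarrow> norm z \<le> norm x"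
        using continuous_attains_sup[OF origin_body_compact[OF B], of norm] origin_body_zero[OF B]
        by (auto intro!: continuous_intros)
      ultimately have xv: "norm x < norm v" by force
      obtain z0 where z0: "z0 \<in> B" "z0 \<noteq> 0"
      proof -
        obtain r0 where r0: "r0 > 0" "cball 0 r0 \<subseteq> B" using origin_body_inball[OF B] .
        obtain z :: 'a where "norm z = r0" using r0(1) vector_choose_size[of r0] by auto
        then show ?thesis using that[of z] r0 by auto
      qed
      have nx: "norm x > 0" using x(2)[OF z0(1)] z0(2) by (meson less_le_trans zero_less_norm_iff)
      \<comment> \<open>Two levels \<open>b < c\<close> strictly between \<open>norm x\<close> and
        \<open>norm v\<close>: the gauge of \<open>T\<close> drops below \<open>1 / c\<close> in the
        direction of \<open>v\<close>, while the gauges of the approximating bodies stay at least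
        \<open>1 / b\<close>.\<close>
      define b where "b = (norm x + norm v) / 2"
      define c where "c = (b + norm v) / 2"
      have bc: "norm x < b" "b < c" "c < norm v" using xv by (auto simp: b_def c_def)
      have c: "c > 0" using bc nx by linarith
      have gT: "gauge_fun T (v /\<^sub>R norm v) < 1 / c"
      proof -
        have "(v /\<^sub>R norm v) /\<^sub>R (1 / norm v) \<in> T" using vT v by simp
        then have "gauge_fun T (v /\<^sub>R norm v) \<le> 1 / norm v"
          using gauge_fun_le_iff[OF origin_body_T, of "v /\<^sub>R norm v" "1 / norm v"] v by simp
        also have "\<dots> < 1 / c" using bc c v by (intro divide_strict_left_mono mult_pos_pos) auto
        finally show ?thesis .
      qed
      have nv: "norm (v /\<^sub>R norm v) = 1" using v by simp
      have cb: "1 / c < 1 / b" using bc nx c by (intro divide_strict_left_mono mult_pos_pos) linarith+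
      obtain q0 where Q: "\<forall>q\<ge>q0. \<forall>\<phi>::'a \<Rightarrow> real. cont_pos_sphere \<phi> \<longrightarrow> (\<forall>y. norm y = 1 \<longrightarrow> 1 / b \<le> \<phi> y) \<longrightarrow>
          power_integral (\<lambda>_. 1) (-q) \<phi> < power_integral (\<lambda>_. 1) (-q) (gauge_fun T)"
        by (rule exE[OF power_integral_large_exponent[OF weight_one gauge_fun_cont_pos_sphere[OF origin_body_T] nv gT cb]])
      note q0 = Q[rule_format]
      \<comment> \<open>The gauge of \<open>B\<close> is at least \<open>1 / norm x\<close>;
        dilation by \<open>b / norm x\<close> lowers this bound exactly to
        \<open>1 / b\<close>.\<close>
      define e' where "e' = b / norm x - 1"
      have e': "e' > 0" using bc nx by (simp add: e'_def)
      have "\<forall>\<^sub>F n in sequentially. mult_close e' (A (k n)) B \<and> n \<ge> nat \<lceil>q0\<rceil>"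
        by (intro eventually_conj close[OF e'] eventually_ge_at_top)
      then obtain n where n: "mult_close e' (A (k n)) B" "n \<ge> nat \<lceil>q0\<rceil>"
        using eventually_happens'[OF sequentially_bot] by blast
      have "power_integral (\<lambda>_. 1) (- q (k n)) (gauge_fun (A (k n))) < power_integral (\<lambda>_. 1) (- q (k n)) (gauge_fun T)"
      proof (rule q0[OF _ gauge_fun_cont_pos_sphere[OF A(1)]])
        have "q0 \<le> real n" using n(2) by linarith
        also have "\<dots> \<le> real (k n)" using seq_suble[OF k, of n] by simp
        finally show "q0 \<le> q (k n)" using q[of "k n"] by linarith
        fix y :: 'a assume y: "norm y = 1"
        then have y0: "y \<noteq> 0" by auto
        have "gauge_fun B y \<ge> 1 / norm x"
        proof -
          have "norm (y /\<^sub>R gauge_fun B y) \<le> norm x" using x(2) gauge_fun_mem[OF B y0] by blast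
          then show ?thesis using gauge_fun_pos[OF B y0] y nx by (simp add: field_simps)
        qed
        moreover have "gauge_fun B y \<le> (1 + e') * gauge_fun (A (k n)) y"
          by (rule mult_close_gauge_fun[OF _ B A(1) e' y0]) (use n(1) mult_close_sym in blast)
        ultimately have "1 / norm x \<le> b / norm x * gauge_fun (A (k n)) y" by (simp add: e'_def)
        then have "1 \<le> b * gauge_fun (A (k n)) y" using nx by (simp add: field_simps)
        moreover have "b > 0" using nx bc by linarith
        ultimately show "1 / b \<le> gauge_fun (A (k n)) y" by (simp add: field_simps)
      qed
      then show False using VA[of "k n"] Vq_le_iff[OF origin_body_T A(1)[of "k n"], of "q (k n)"] by simp
    qed
    then obtain w where w: "w \<in> B" "norm v \<le> norm w" by blast
    have w0: "norm w > 0" using w(2) v by (meson less_le_trans zero_less_norm_iff)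
    \<comment> \<open>Shrinking \<open>w\<close> by \<open>1 + e'\<close> moves it by at most
      \<open>d\<close>; together with the Hausdorff distance this leaves \<open>w\<close> within
      \<open>2 * d\<close> of \<open>T\<close>.\<close>
    define e' where "e' = d / norm w"
    have e': "e' > 0" using d w0 by (simp add: e'_def)
    obtain n where n: "mult_close e' (A (k n)) B"
      using close[OF e'] eventually_happens'[OF sequentially_bot] by blast
    have wA: "w /\<^sub>R (1 + e') \<in> A (k n)" using n w by (simp add: mult_close_def)
    obtain t where t: "t \<in> T" "dist (w /\<^sub>R (1 + e')) t \<le> hausdist (A (k n)) T"
      using hausdistD[OF origin_body_compact[OF A(1)] compact_T _ wA] vT by blast
    have "dist w (w /\<^sub>R (1 + e')) \<le> d"
    proof -
      have "w - w /\<^sub>R (1 + e') = (e' / (1 + e')) *\<^sub>R w"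
        using e' by (simp add: scaleR_left_diff_distrib[of 1, symmetric, simplified] field_simps)
      then have "dist w (w /\<^sub>R (1 + e')) = e' / (1 + e') * norm w" using e' by (simp add: dist_norm)
      also have "\<dots> \<le> e' * norm w" using e' by (intro mult_right_mono) (auto simp: field_simps)
      also have "\<dots> = d" using w0 by (simp add: e'_def)
      finally show ?thesis .
    qed
    then have wt: "norm (w - t) \<le> 2 * d"
      using t(2) A(4)[of "k n"] dist_triangle[of w t "w /\<^sub>R (1 + e')"] by (simp add: dist_norm)
    have wv: "norm w \<le> norm v + 2"
      using norm_triangle_ineq[of "w - t" t] wt Tv[OF t(1)] d(3) by simp
    \<comment> \<open>A point of \<open>T\<close> near \<open>w\<close> forces the support function
      of \<open>T\<close> at \<open>w\<close> to be almost \<open>(norm w)\<^sup>2\<close>. As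
      \<open>norm v \<le> norm w\<close>, the optimal orbit point \<open>g v\<close> must be close
      to \<open>w\<close>.\<close>
    have "(norm w)\<^sup>2 - 2 * d * norm w \<le> t \<bullet> w"
    proof -
      have "(w - t) \<bullet> w \<le> norm (w - t) * norm w" by (rule norm_cauchy_schwarz)
      also have "\<dots> \<le> 2 * d * norm w" using wt by (intro mult_right_mono) auto
      finally show ?thesis by (simp add: inner_diff_left dot_square_norm)
    qed
    also have "t \<bullet> w \<le> orbit_max v w" using inner_le_support_fun[OF compact_T t(1), of w] supp by simp
    finally have ow: "(norm w)\<^sup>2 - 2 * d * norm w \<le> orbit_max v w" .
    obtain g where g: "g \<in> sym_group T" "orbit_max v w = g v \<bullet> w" by (rule orbit_max_attained)
    \<comment> \<open>Rotating back brings the point close to \<open>v\<close> itself; it stays in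
      \<open>B\<close> by invariance.\<close>
    define w' where "w' = inv g w"
    have w': "w' \<in> B" "norm w' = norm w"
      using inv[OF inv_mem[OF g(1)]] w(1) norm_act[OF inv_mem[OF g(1)]] by (auto simp: w'_def)
    have "norm (w' - v) < \<delta>"
    proof -
      have gw': "g w' = w" by (simp add: w'_def act_inv[OF g(1)])
      have "norm (w' - v) = norm (w - g v)"
        using norm_act[OF g(1), of "w' - v"] linear_diff[OF lin[OF g(1)], of w' v] gw' by simp
      moreover have "(norm (w - g v))\<^sup>2 < \<delta>\<^sup>2"
      proof -
        have "(norm (w - g v))\<^sup>2 = (norm w)\<^sup>2 + (norm v)\<^sup>2 - 2 * (g v \<bullet> w)"
          using norm_act[OF g(1), of v] by (simp add: dot_square_norm[symmetric] inner_diff_left inner_diff_right inner_commute inner_act[OF g(1)])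
        also have "\<dots> \<le> 4 * d * norm w"
          using ow g(2) power_mono[OF w(2) norm_ge_zero, of 2] by linarith
        also have "\<dots> \<le> 4 * d * (norm v + 2)" using wv d by (intro mult_left_mono) auto
        finally show ?thesis using d\<delta> by simp
      qed
      ultimately show ?thesis using \<delta> power2_less_imp_less[of "norm (w - g v)" \<delta>] by simp
    qed
    moreover have "orbit_max w' y \<le> support_fun B y" for y
      unfolding orbit_max_le_iff
    proof
      fix h assume "h \<in> sym_group T"
      then have "h w' \<in> B" using inv w' by blast
      then show "h w' \<bullet> y \<le> support_fun B y" by (rule inner_le_support_fun[OF origin_body_compact[OF B]])
    qed
    ultimately have "support_fun B y = support_fun T y" if "norm y = 1" for y
      unfolding supp using rigid[of w' "support_fun B" y] support_fun_cont_pos_sphere[OF B] IB w w' that by simp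
    then have "B = T" by (rule support_fun_eq_imp_eq[OF B origin_body_T])
    then have "\<forall>\<^sub>F n in sequentially. hausdist ((A \<circ> k) n) T < e"
      using mult_converges_hausdist[OF Ak B lim _ e, of R] bd by simp
    then obtain n where "hausdist (A (k n)) T < e" by (auto dest!: eventually_happens'[OF sequentially_bot])
    then show False using far[of "k n"] by simp
  qed
  show ?thesis
  proof (rule that[OF d(1) main])
    have "cball 0 r \<subseteq> \<Omega> \<and> \<Omega> \<subseteq> cball 0 R" if "admissible T f p d \<Omega>" for \<Omega>
      using that rR[of \<Omega>] d(2) by (auto simp: admissible_iff[OF f])
    then show "\<exists>r>0. \<exists>R. \<forall>\<Omega>. admissible T f p d \<Omega> \<longrightarrow> cball 0 r \<subseteq> \<Omega> \<and> \<Omega> \<subseteq> cball 0 R" using r by blast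
  qed
qed

text \<open>The dual of the previous argument. Now \<open>q\<close> is fixed, so the volume
  comparison passes to the limit \<open>B\<close>, while the constraint with its varying exponent
  acts by concentration. Tangency gives \<open>norm a = 1\<close> and
  \<open>support_fun T a \<le> 1\<close>, so a limit with support function above 1 everywhere would
  violate the constraint.\<close>

lemma localization_negative_p:
  assumes f: "weight c1 c2 f" and q: "q > 0" and tan: "tangential T"
  obtains d where "d > 0" "\<And>e. e > 0 \<Longrightarrow> \<exists>P. \<forall>p\<le>P. \<forall>\<Omega>. admissible T f p d \<Omega> \<longrightarrow> Vq q T \<le> Vq q \<Omega> \<longrightarrow> hausdist \<Omega> T \<le> e"
    "\<And>p. \<exists>r>0. \<exists>R. \<forall>\<Omega>. admissible T f p d \<Omega> \<longrightarrow> cball 0 r \<subseteq> \<Omega> \<and> \<Omega> \<subseteq> cball 0 R"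
proof -
  obtain v a where va: "a \<noteq> 0" and supp: "\<And>y. support_fun T y = orbit_max v y"
    and gauge: "\<And>y. y \<noteq> 0 \<Longrightarrow> gauge_fun T y = orbit_max a y"
    and fixa: "\<forall>x. (\<forall>g\<in>stab a. g x = x) \<longrightarrow> x \<in> span {a}"
    and tn: "tangential T \<Longrightarrow> norm a = 1"
    by (rule polytope_data) (rule that)
  have na: "norm a = 1" by (rule tn[OF tan])
  obtain d1 r R where d1: "d1 > 0" and r: "r > 0"
    and rR: "\<And>\<Omega>. origin_body \<Omega> \<Longrightarrow> hausdist \<Omega> T < d1 \<Longrightarrow> cball 0 r \<subseteq> \<Omega> \<and> \<Omega> \<subseteq> cball 0 R"
    by (rule uniform_bounds_near_T) (rule that)
  have gauge1: "gauge_fun T y = orbit_max a y" if "norm y = 1" for y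
    by (rule gauge) (use that in auto)
  have posa: "cont_pos_sphere (orbit_max a)"
    by (rule cont_pos_sphere_cong[OF gauge_fun_cont_pos_sphere[OF origin_body_T] gauge1])
  have pma: "power_integral (\<lambda>_. 1) s (gauge_fun T) = power_integral (\<lambda>_. 1) s (orbit_max a)" for s
    by (rule power_integral_cong[OF gauge1])
  have q': "- q \<noteq> 0" using q by simp
  obtain \<delta> where \<delta>: "\<delta> > 0" and rigid: "\<And>w \<psi> y. norm (w - a) < \<delta> \<Longrightarrow> norm a \<le> norm w \<Longrightarrow> cont_pos_sphere \<psi> \<Longrightarrow>
      \<forall>y. norm y = 1 \<longrightarrow> orbit_max w y \<le> \<psi> y \<Longrightarrow>
      sgn (-q) * power_integral (\<lambda>_. 1) (-q) \<psi> \<le> sgn (-q) * power_integral (\<lambda>_. 1) (-q) (orbit_max a) \<Longrightarrow> norm y = 1 \<Longrightarrow> \<psi> y = orbit_max a y"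
    using orbit_max_rigidity[OF weight_one q' va _ posa] fixa by metis
  have hTa: "support_fun T a \<le> 1"
  proof (rule support_fun_le)
    show "T \<noteq> {}" using origin_body_zero[OF origin_body_T] by auto
    fix x assume x: "x \<in> T"
    show "x \<bullet> a \<le> 1"
    proof (cases "x = 0")
      case False
      have "gauge_fun T x \<le> 1" using gauge_fun_le_iff[OF origin_body_T False, of 1] x by simp
      then show ?thesis using orbit_max_ge[OF id_mem, of a x] gauge[OF False] by (simp add: inner_commute)
    qed simp
  qed
  \<comment> \<open>The squared distance from \<open>y\<close> to a suitable image of
    \<open>a\<close> will be at most \<open>4 * d\<close>, here below the square of the rigidity
    radius.\<close>
  define d where "d = min d1 (\<delta>\<^sup>2 / 8)"
  have d: "d > 0" "d \<le> d1" "4 * d < \<delta>\<^sup>2"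
    using d1 \<delta> by (auto simp: d_def min_def field_simps)
  have main: "\<exists>P. \<forall>p\<le>P. \<forall>\<Omega>. admissible T f p d \<Omega> \<longrightarrow> Vq q T \<le> Vq q \<Omega> \<longrightarrow> hausdist \<Omega> T \<le> e" if e: "e > 0" for e
  proof (rule ccontr)
    assume "\<not> ?thesis"
    then have "\<forall>n::nat. \<exists>p \<Omega>. p \<le> - real n \<and> admissible T f p d \<Omega> \<and> Vq q T \<le> Vq q \<Omega> \<and> \<not> hausdist \<Omega> T \<le> e"
      by meson
    then obtain p A where p: "\<And>n. p n \<le> - real n" and adm: "\<And>n. admissible T f (p n) d (A n)"
      and VA: "\<And>n. Vq q T \<le> Vq q (A n)" and far: "\<And>n. \<not> hausdist (A n) T \<le> e" by metis
    have A: "origin_body (A n)" "\<forall>g\<in>sym_group T. g ` A n = A n"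
      "power_integral f (p n) (support_fun (A n)) = power_integral f (p n) (support_fun T)" "hausdist (A n) T < d" for n
      using adm[of n] by (auto simp: admissible_iff[OF f])
    have bd: "cball 0 r \<subseteq> A n" "A n \<subseteq> cball 0 R" for n using rR[OF A(1)[of n]] A(4)[of n] d(2) by auto
    obtain k B where k: "strict_mono k" and B: "origin_body B" and lim: "mult_converges (A \<circ> k) B"
      and inv': "\<forall>g\<in>sym_group T. g ` B = B"
      by (rule limit_body[where A = A, OF A(1,2) r bd]) (rule that)
    have inv: "g ` B = B" if "g \<in> sym_group T" for g using inv' that by blast
    have Ak: "origin_body ((A \<circ> k) n)" for n using A(1) by simp
    have close: "\<forall>\<^sub>F n in sequentially. mult_close e' (A (k n)) B" if "e' > 0" for e'
      using lim that by (simp add: mult_converges_def)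
    have "(\<lambda>n. power_integral (\<lambda>_. 1) (-q) (gauge_fun ((A \<circ> k) n))) \<longlonglongrightarrow> power_integral (\<lambda>_. 1) (-q) (gauge_fun B)"
      by (rule tendsto_power_integral_gauge_fun[OF weight_one Ak B lim])
    then have VB: "power_integral (\<lambda>_. 1) (-q) (gauge_fun T) \<le> power_integral (\<lambda>_. 1) (-q) (gauge_fun B)"
      by (rule LIMSEQ_le_const) (use VA Vq_le_iff[OF origin_body_T A(1)] in auto)
    have "\<exists>y. norm y = 1 \<and> support_fun B y \<le> 1"
    proof (rule ccontr)
      assume no: "\<not> (\<exists>y. norm y = 1 \<and> support_fun B y \<le> 1)"
      have "continuous_on (sphere 0 1) (support_fun B)" "sphere (0::'a) 1 \<noteq> {}"
        using support_fun_cont_pos_sphere[OF B] ex_norm_one by (auto simp: cont_pos_sphere_def)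
      then obtain y0 where y0: "norm y0 = 1" "\<And>y. norm y = 1 \<Longrightarrow> support_fun B y0 \<le> support_fun B y"
        using continuous_attains_inf[OF compact_sphere, of 0 1 "support_fun B"] by auto
      define m where "m = support_fun B y0"
      have m: "m > 1" using no y0(1) by (force simp: m_def)
      define b where "b = (1 + m) / 2"
      have b: "1 < b" "b < m" using m by (auto simp: b_def)
      have bb: "(1 + b) / 2 < b" using b by simp
      have hA: "support_fun T a < (1 + b) / 2" using hTa b by simp
      obtain q0 where q0: "\<And>q \<phi>. q \<ge> q0 \<Longrightarrow> cont_pos_sphere \<phi> \<Longrightarrow> \<forall>y. norm y = 1 \<longrightarrow> b \<le> \<phi> y \<Longrightarrow>
          power_integral f (-q) \<phi> < power_integral f (-q) (support_fun T)"
        using power_integral_large_exponent[OF f support_fun_cont_pos_sphere[OF origin_body_T] na hA bb] by blast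
      \<comment> \<open>Shrinking by the factor \<open>m / b\<close> lowers the minimum
        \<open>m\<close> of the support function of \<open>B\<close> to \<open>b\<close>, which is
        still above 1.\<close>
      define e' where "e' = m / b - 1"
      have e': "e' > 0" using b by (simp add: e'_def)
      have "\<forall>\<^sub>F n in sequentially. mult_close e' (A (k n)) B \<and> n \<ge> nat \<lceil>q0\<rceil>"
        by (intro eventually_conj close[OF e'] eventually_ge_at_top)
      then obtain n where n: "mult_close e' (A (k n)) B" "n \<ge> nat \<lceil>q0\<rceil>"
        using eventually_happens'[OF sequentially_bot] by blast
      \<comment> \<open>The concentration estimate has exponent \<open>-q\<close>; its
        \<open>q\<close> is \<open>- p (k n)\<close>, which is at least \<open>k n\<close> and
        therefore exceeds any threshold.\<close>
      have "power_integral f (- (- p (k n))) (support_fun (A (k n))) < power_integral f (- (- p (k n))) (support_fun T)"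
      proof (rule q0[OF _ support_fun_cont_pos_sphere[OF A(1)]]; (intro allI impI)?)
        have "q0 \<le> real n" using n(2) by linarith
        also have "\<dots> \<le> real (k n)" using seq_suble[OF k, of n] by simp
        finally show "q0 \<le> - p (k n)" using p[of "k n"] by linarith
        fix y :: 'a assume y: "norm y = 1"
        have "support_fun B y \<le> (1 + e') * support_fun (A (k n)) y"
          by (rule mult_close_support_fun[OF _ B A(1) e']) (use n(1) mult_close_sym in blast)
        then have "m \<le> m / b * support_fun (A (k n)) y" using y0(2)[OF y] by (simp add: e'_def m_def)
        then have "m * b \<le> m * support_fun (A (k n)) y" using b by (simp add: field_simps)
        then show "b \<le> support_fun (A (k n)) y" using m by simp
      qed
      then show False using A(3)[of "k n"] by simp
    qed
    then obtain y where y: "norm y = 1" "support_fun B y \<le> 1" by blast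
    obtain n where n: "mult_close d (A (k n)) B"
      using close[OF d(1)] eventually_happens'[OF sequentially_bot] by blast
    have "support_fun T y \<le> support_fun (A (k n)) y + hausdist T (A (k n))"
      by (rule hausdist_support_fun_le[OF origin_body_T A(1) y(1)])
    moreover have "support_fun (A (k n)) y \<le> (1 + d) * support_fun B y"
      by (rule mult_close_support_fun[OF n A(1) B d(1)])
    moreover have "(1 + d) * support_fun B y \<le> (1 + d) * 1" using y(2) d by (intro mult_left_mono) auto
    ultimately have hTy: "support_fun T y \<le> 1 + 2 * d" using A(4)[of "k n"] by (simp add: hausdist_commute)
    have y0: "y \<noteq> 0" using y(1) by auto
    \<comment> \<open>The boundary point of \<open>T\<close> on the ray through \<open>y\<close>
      bounds the support function from below, so a support value near 1 forces a gauge value not far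
      below 1.\<close>
    have "1 / gauge_fun T y \<le> support_fun T y"
      using inner_le_support_fun[OF compact_T gauge_fun_mem[OF origin_body_T y0], of y] y(1)
      by (simp add: dot_square_norm divide_inverse)
    then have "1 \<le> support_fun T y * gauge_fun T y"
      using gauge_fun_pos[OF origin_body_T y0] by (simp add: field_simps)
    also have "\<dots> \<le> (1 + 2 * d) * gauge_fun T y"
      using hTy gauge_fun_pos[OF origin_body_T y0] by (intro mult_right_mono) auto
    finally have "1 \<le> (1 + 2 * d) * gauge_fun T y" .
    moreover have "(1 - 2 * d) * (1 + 2 * d) \<le> 1" using d by (simp add: algebra_simps)
    ultimately have "(1 - 2 * d) * (1 + 2 * d) \<le> gauge_fun T y * (1 + 2 * d)" by (simp add: mult.commute)
    then have ga: "1 - 2 * d \<le> orbit_max a y" using d gauge[OF y0] by simp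
    obtain g where g: "g \<in> sym_group T" "orbit_max a y = g a \<bullet> y" by (rule orbit_max_attained)
    define y' where "y' = inv g y"
    have y': "norm y' = 1" using norm_act[OF inv_mem[OF g(1)]] y(1) by (simp add: y'_def)
    have "norm (y' - a) < \<delta>"
    proof -
      have gy': "g y' = y" by (simp add: y'_def act_inv[OF g(1)])
      have "norm (y' - a) = norm (y - g a)"
        using norm_act[OF g(1), of "y' - a"] linear_diff[OF lin[OF g(1)], of y' a] gy' by simp
      moreover have "(norm (y - g a))\<^sup>2 < \<delta>\<^sup>2"
      proof -
        have "(norm (y - g a))\<^sup>2 = (norm y)\<^sup>2 + (norm a)\<^sup>2 - 2 * (g a \<bullet> y)"
          by (simp add: dot_square_norm[symmetric] inner_diff_left inner_diff_right inner_commute inner_act[OF g(1)])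
        also have "\<dots> \<le> 4 * d" using ga g(2) y(1) na by simp
        finally show ?thesis using d(3) by simp
      qed
      ultimately show ?thesis using \<delta> power2_less_imp_less[of "norm (y - g a)" \<delta>] by simp
    qed
    \<comment> \<open>The bound \<open>support_fun B y \<le> 1\<close> says that \<open>y\<close>
      lies in the polar body of \<open>B\<close>. The polar body is invariant, so it contains the
      orbit of \<open>y\<close>, and its support function is the gauge of \<open>B\<close>.\<close>
    moreover have "orbit_max y' x \<le> gauge_fun B x" if x: "norm x = 1" for x
      unfolding orbit_max_le_iff
    proof
      fix h assume h: "h \<in> sym_group T"
      have x0: "x \<noteq> 0" using x by auto
      define z where "z = x /\<^sub>R gauge_fun B x"
      have "z \<in> B" unfolding z_def by (rule gauge_fun_mem[OF B x0])
      then have "g (inv h z) \<in> B" using inv[OF g(1)] inv[OF inv_mem[OF h]] by blast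
      then have "g (inv h z) \<bullet> y \<le> 1"
        using inner_le_support_fun[OF origin_body_compact[OF B], of "g (inv h z)" y] y(2) by simp
      then have "h y' \<bullet> z \<le> 1"
        using inner_act_inv[OF g(1), of "inv h z" y] inner_act_inv[OF h, of y' z] by (simp add: y'_def inner_commute)
      then show "h y' \<bullet> x \<le> gauge_fun B x" using gauge_fun_pos[OF B x0] by (simp add: z_def field_simps)
    qed
    moreover have "sgn (-q) * power_integral (\<lambda>_. 1) (-q) (gauge_fun B) \<le> sgn (-q) * power_integral (\<lambda>_. 1) (-q) (orbit_max a)"
      using VB q by (simp add: pma)
    ultimately have "gauge_fun B x = gauge_fun T x" if "norm x = 1" for x
      using rigid[of y' "gauge_fun B" x] gauge_fun_cont_pos_sphere[OF B] y' na that gauge1[OF that] by simp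
    then have "B = T" by (rule gauge_fun_eq_imp_eq[OF B origin_body_T])
    then have "\<forall>\<^sub>F n in sequentially. hausdist ((A \<circ> k) n) T < e"
      using mult_converges_hausdist[OF Ak B lim _ e, of R] bd by simp
    then obtain n where "hausdist (A (k n)) T < e" by (auto dest!: eventually_happens'[OF sequentially_bot])
    then show False using far[of "k n"] by simp
  qed
  show ?thesis
  proof (rule that[OF d(1) main])
    fix p
    have "cball 0 r \<subseteq> \<Omega> \<and> \<Omega> \<subseteq> cball 0 R" if "admissible T f p d \<Omega>" for \<Omega>
      using that rR[of \<Omega>] d(2) by (auto simp: admissible_iff[OF f])
    then show "\<exists>r>0. \<exists>R. \<forall>\<Omega>. admissible T f p d \<Omega> \<longrightarrow> cball 0 r \<subseteq> \<Omega> \<and> \<Omega> \<subseteq> cball 0 R" using r by blast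
  qed
qed

section \<open>Choice of the maximizers and their convergence\<close>

definition maximizer_within :: "('a \<Rightarrow> real) \<Rightarrow> real \<Rightarrow> real \<Rightarrow> real \<Rightarrow> 'a set \<Rightarrow> bool" where
  "maximizer_within f p q d \<Omega> \<longleftrightarrow>
     admissible T f p d \<Omega> \<and> (\<forall>\<Omega>'. admissible T f p d \<Omega>' \<longrightarrow> Vq q \<Omega>' \<le> Vq q \<Omega>)"

text \<open>One rule of choice for all parameters: take a maximizer at the prescribed radius
  \<open>d\<close> when there is one, and any local maximizer otherwise. The first alternative is
  what convergence relies on.\<close>

lemma local_maximizer_choice:
  assumes f: "weight c1 c2 f" and p: "p \<noteq> 0" and d: "d > 0"
  shows "\<exists>\<Omega>. local_maximizer T f p q \<Omega> \<and> ((\<exists>\<Omega>'. maximizer_within f p q d \<Omega>') \<longrightarrow> maximizer_within f p q d \<Omega>)"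
proof (cases "\<exists>\<Omega>'. maximizer_within f p q d \<Omega>'")
  case True
  then obtain \<Omega> where "maximizer_within f p q d \<Omega>" by blast
  moreover from this have "local_maximizer T f p q \<Omega>"
    using d unfolding local_maximizer_def maximizer_within_def by blast
  ultimately show ?thesis by blast
next
  case False
  then show ?thesis using local_maximizer_exists[OF f p] by blast
qed

text \<open>The pair \<open>c t\<close> of exponents and the filter \<open>F\<close> let one
  statement serve both limits. Localization at accuracy \<open>d/2\<close> yields existence of a
  maximizer at radius \<open>d\<close>, and localization at \<open>e/2\<close> yields its
  convergence, because \<open>T\<close> itself is a competitor.\<close>

lemma maximizer_within_eventually:
  fixes c :: "real \<Rightarrow> real \<times> real" and F :: "real filter"
  assumes f: "weight c1 c2 f" and d: "d > 0"
    and loc: "\<And>e. e > 0 \<Longrightarrow> \<forall>\<^sub>F t in F. \<forall>\<Omega>. admissible T f (fst (c t)) d \<Omega> \<longrightarrow> Vq (snd (c t)) T \<le> Vq (snd (c t)) \<Omega> \<longrightarrow> hausdist \<Omega> T \<le> e"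
    and bounds: "\<And>t. \<exists>r>0. \<exists>R. \<forall>\<Omega>. admissible T f (fst (c t)) d \<Omega> \<longrightarrow> cball 0 r \<subseteq> \<Omega> \<and> \<Omega> \<subseteq> cball 0 R"
    and choice: "\<forall>\<^sub>F t in F. (\<exists>\<Omega>'. maximizer_within f (fst (c t)) (snd (c t)) d \<Omega>') \<longrightarrow> maximizer_within f (fst (c t)) (snd (c t)) d (\<Omega> t)"
  shows "((\<lambda>t. hausdist (\<Omega> t) T) \<longlongrightarrow> 0) F"
proof (rule tendstoI)
  fix e :: real assume e: "e > 0"
  have "\<forall>\<^sub>F t in F. \<forall>\<Omega>. admissible T f (fst (c t)) d \<Omega> \<longrightarrow> Vq (snd (c t)) T \<le> Vq (snd (c t)) \<Omega> \<longrightarrow> hausdist \<Omega> T \<le> d/2"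
    by (rule loc) (use d in simp)
  moreover have "\<forall>\<^sub>F t in F. \<forall>\<Omega>. admissible T f (fst (c t)) d \<Omega> \<longrightarrow> Vq (snd (c t)) T \<le> Vq (snd (c t)) \<Omega> \<longrightarrow> hausdist \<Omega> T \<le> e/2"
    by (rule loc) (use e in simp)
  ultimately show "\<forall>\<^sub>F t in F. dist (hausdist (\<Omega> t) T) 0 < e"
    using choice
  proof eventually_elim
    case (elim t)
    obtain r R where r: "r > 0" and rR: "\<And>\<Omega>. admissible T f (fst (c t)) d \<Omega> \<Longrightarrow> cball 0 r \<subseteq> \<Omega> \<and> \<Omega> \<subseteq> cball 0 R"
      using bounds by blast
    have half: "d / 2 < d" using d by simp
    obtain \<Omega>' where "maximizer_within f (fst (c t)) (snd (c t)) d \<Omega>'"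
      using maximizer_exists[OF f d r half rR, where q = "snd (c t)"] elim(1) unfolding maximizer_within_def by blast
    then have M: "maximizer_within f (fst (c t)) (snd (c t)) d (\<Omega> t)" using elim(3) by blast
    then have adm: "admissible T f (fst (c t)) d (\<Omega> t)" by (simp add: maximizer_within_def)
    have "Vq (snd (c t)) T \<le> Vq (snd (c t)) (\<Omega> t)"
      using M admissible_T[OF f d] unfolding maximizer_within_def by blast
    then have "hausdist (\<Omega> t) T \<le> e/2" using elim(2) adm by blast
    moreover have "0 \<le> hausdist (\<Omega> t) T"
    proof -
      have "origin_body (\<Omega> t)" using adm by (simp add: admissible_iff[OF f])
      then obtain y where "y \<in> T" "dist 0 y \<le> hausdist (\<Omega> t) T"
        using hausdistD[OF origin_body_compact compact_T, of "\<Omega> t" 0] origin_body_zero origin_body_T by blast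
      then show ?thesis using zero_le_dist order_trans by blast
    qed
    ultimately show ?case using e by (simp add: dist_real_def)
  qed
qed

end

theorem theorem1p4:
  fixes T :: "'a::euclidean_space set" and f :: "'a \<Rightarrow> real" and c1 c2 :: real
  assumes dim: "DIM('a) \<ge> 2"
    and reg: "regular_polytope T"
    and f_meas: "f \<in> borel_measurable sphere_measure"
    and f_inv: "\<And>g y. g \<in> sym_group T \<Longrightarrow> y \<in> sphere 0 1 \<Longrightarrow> f (g y) = f y"
    and c1: "c1 > 0" and c2: "c2 > 0"
    and f_bounds: "\<And>y. y \<in> sphere 0 1 \<Longrightarrow> c1 \<le> f y \<and> f y \<le> c2"
  shows
    "(tangential T \<longrightarrow>
       (\<exists>\<Omega> :: real \<Rightarrow> real \<Rightarrow> 'a set.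
          (\<forall>p q. p * q \<noteq> 0 \<longrightarrow> local_maximizer T f p q (\<Omega> p q)) \<and>
          (\<forall>q > 0. ((\<lambda>p. hausdist (\<Omega> p q) T) \<longlongrightarrow> 0) at_bot)))
     \<and>
     (\<exists>\<Omega> :: real \<Rightarrow> real \<Rightarrow> 'a set.
        (\<forall>p q. p * q \<noteq> 0 \<longrightarrow> local_maximizer T f p q (\<Omega> p q)) \<and>
        (\<forall>p. p \<noteq> 0 \<longrightarrow>
           (\<exists>P. regular_polytope P \<and> similar_to P T \<and>
                ((\<lambda>q. hausdist (\<Omega> p q) P) \<longlongrightarrow> 0) at_top)))"
proof -
  interpret regular_poly T by unfold_locales (rule reg)
  have f: "weight c1 c2 f" unfolding weight_def using f_meas c1 f_bounds by simp
  \<comment> \<open>The radius \<open>D\<close> is kept general, because it depends on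
    \<open>q\<close> in the first part and on \<open>p\<close> in the second.\<close>
  have choice: "\<exists>\<Omega>. \<forall>p q. p \<noteq> 0 \<longrightarrow> local_maximizer T f p q (\<Omega> p q) \<and>
      ((\<exists>\<Omega>'. maximizer_within f p q (D p q) \<Omega>') \<longrightarrow> maximizer_within f p q (D p q) (\<Omega> p q))"
    if "\<And>p q. D p q > 0" for D :: "real \<Rightarrow> real \<Rightarrow> real"
  proof -
    have "\<forall>p q. \<exists>\<Omega>. p \<noteq> 0 \<longrightarrow> local_maximizer T f p q \<Omega> \<and>
      ((\<exists>\<Omega>'. maximizer_within f p q (D p q) \<Omega>') \<longrightarrow> maximizer_within f p q (D p q) \<Omega>)"
      using local_maximizer_choice[OF f _ that] by blast
    then show ?thesis by (simp only: choice_iff)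
  qed
  have part1: "\<exists>\<Omega> :: real \<Rightarrow> real \<Rightarrow> 'a set.
          (\<forall>p q. p * q \<noteq> 0 \<longrightarrow> local_maximizer T f p q (\<Omega> p q)) \<and>
          (\<forall>q > 0. ((\<lambda>p. hausdist (\<Omega> p q) T) \<longlongrightarrow> 0) at_bot)" if tan: "tangential T"
  proof -
    have "\<forall>q. \<exists>d>0. q > 0 \<longrightarrow>
       (\<forall>e>0. \<exists>P. \<forall>p\<le>P. \<forall>\<Omega>. admissible T f p d \<Omega> \<longrightarrow> Vq q T \<le> Vq q \<Omega> \<longrightarrow> hausdist \<Omega> T \<le> e) \<and>
       (\<forall>p. \<exists>r>0. \<exists>R. \<forall>\<Omega>. admissible T f p d \<Omega> \<longrightarrow> cball 0 r \<subseteq> \<Omega> \<and> \<Omega> \<subseteq> cball 0 R)" (is "\<forall>q. ?P q")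
    proof
      fix q :: real
      show "?P q"
      proof (cases "q > 0")
        case True
        show ?thesis by (rule localization_negative_p[OF f True tan]) blast
      next
        case False
        \<comment> \<open>Nothing is claimed for \<open>q \<le> 0\<close>; the value 1 is a
          placeholder that makes \<open>D\<close> positive everywhere.\<close>
        then show ?thesis by (intro exI[of _ 1]) simp
      qed
    qed
    then obtain D where D: "\<And>q. D q > 0"
      and loc: "\<And>q e. q > 0 \<Longrightarrow> e > 0 \<Longrightarrow> \<exists>P. \<forall>p\<le>P. \<forall>\<Omega>. admissible T f p (D q) \<Omega> \<longrightarrow> Vq q T \<le> Vq q \<Omega> \<longrightarrow> hausdist \<Omega> T \<le> e"
      and bounds: "\<And>q p. q > 0 \<Longrightarrow> \<exists>r>0. \<exists>R. \<forall>\<Omega>. admissible T f p (D q) \<Omega> \<longrightarrow> cball 0 r \<subseteq> \<Omega> \<and> \<Omega> \<subseteq> cball 0 R"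
      by metis
    obtain \<Omega> where \<Omega>: "\<And>p q. p \<noteq> 0 \<Longrightarrow> local_maximizer T f p q (\<Omega> p q)"
      "\<And>p q. p \<noteq> 0 \<Longrightarrow> (\<exists>\<Omega>'. maximizer_within f p q (D q) \<Omega>') \<longrightarrow> maximizer_within f p q (D q) (\<Omega> p q)"
      using choice[of "\<lambda>p q. D q"] D by blast
    have "((\<lambda>p. hausdist (\<Omega> p q) T) \<longlongrightarrow> 0) at_bot" if q: "q > 0" for q
    proof (rule maximizer_within_eventually[OF f D[of q], where c = "\<lambda>p. (p, q)"])
      show "\<forall>\<^sub>F p in at_bot. (\<exists>\<Omega>'. maximizer_within f (fst (p, q)) (snd (p, q)) (D q) \<Omega>') \<longrightarrow> maximizer_within f (fst (p, q)) (snd (p, q)) (D q) (\<Omega> p q)"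
        \<comment> \<open>Staying below -1 excludes the exponent \<open>p = 0\<close>, for which no
          choice has been made.\<close>
        using eventually_le_at_bot[of "-1"] by eventually_elim (use \<Omega>(2) in auto)
      show "\<forall>\<^sub>F p in at_bot. \<forall>\<Omega>. admissible T f (fst (p, q)) (D q) \<Omega> \<longrightarrow> Vq (snd (p, q)) T \<le> Vq (snd (p, q)) \<Omega> \<longrightarrow> hausdist \<Omega> T \<le> e"
        if "e > 0" for e
        using loc[OF q that] unfolding eventually_at_bot_linorder fst_conv snd_conv .
      show "\<exists>r>0. \<exists>R. \<forall>\<Omega>. admissible T f (fst (p, q)) (D q) \<Omega> \<longrightarrow> cball 0 r \<subseteq> \<Omega> \<and> \<Omega> \<subseteq> cball 0 R" for p
        using bounds[OF q, of p] unfolding fst_conv .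
    qed
    then show ?thesis using \<Omega>(1) by (intro exI[of _ \<Omega>]) auto
  qed
  have part2: "\<exists>\<Omega> :: real \<Rightarrow> real \<Rightarrow> 'a set.
        (\<forall>p q. p * q \<noteq> 0 \<longrightarrow> local_maximizer T f p q (\<Omega> p q)) \<and>
        (\<forall>p. p \<noteq> 0 \<longrightarrow> ((\<lambda>q. hausdist (\<Omega> p q) T) \<longlongrightarrow> 0) at_top)"
  proof -
    have "\<forall>p. \<exists>d>0. p \<noteq> 0 \<longrightarrow>
       (\<forall>e>0. \<exists>Q. \<forall>q\<ge>Q. \<forall>\<Omega>. admissible T f p d \<Omega> \<longrightarrow> Vq q T \<le> Vq q \<Omega> \<longrightarrow> hausdist \<Omega> T \<le> e) \<and>
       (\<exists>r>0. \<exists>R. \<forall>\<Omega>. admissible T f p d \<Omega> \<longrightarrow> cball 0 r \<subseteq> \<Omega> \<and> \<Omega> \<subseteq> cball 0 R)" (is "\<forall>p. ?P p")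
    proof
      fix p :: real
      show "?P p"
      proof (cases "p = 0")
        case True
        then show ?thesis by (intro exI[of _ 1]) simp
      next
        case False
        show ?thesis by (rule localization_large_q[OF f False]) blast
      qed
    qed
    then obtain D where D: "\<And>p. D p > 0"
      and loc: "\<And>p e. p \<noteq> 0 \<Longrightarrow> e > 0 \<Longrightarrow> \<exists>Q. \<forall>q\<ge>Q. \<forall>\<Omega>. admissible T f p (D p) \<Omega> \<longrightarrow> Vq q T \<le> Vq q \<Omega> \<longrightarrow> hausdist \<Omega> T \<le> e"
      and bounds: "\<And>p. p \<noteq> 0 \<Longrightarrow> \<exists>r>0. \<exists>R. \<forall>\<Omega>. admissible T f p (D p) \<Omega> \<longrightarrow> cball 0 r \<subseteq> \<Omega> \<and> \<Omega> \<subseteq> cball 0 R"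
      by metis
    obtain \<Omega> where \<Omega>: "\<And>p q. p \<noteq> 0 \<Longrightarrow> local_maximizer T f p q (\<Omega> p q)"
      "\<And>p q. p \<noteq> 0 \<Longrightarrow> (\<exists>\<Omega>'. maximizer_within f p q (D p) \<Omega>') \<longrightarrow> maximizer_within f p q (D p) (\<Omega> p q)"
      using choice[of "\<lambda>p q. D p"] D by blast
    have "((\<lambda>q. hausdist (\<Omega> p q) T) \<longlongrightarrow> 0) at_top" if p: "p \<noteq> 0" for p
    proof (rule maximizer_within_eventually[OF f D[of p], where c = "\<lambda>q. (p, q)"])
      show "\<forall>\<^sub>F q in at_top. (\<exists>\<Omega>'. maximizer_within f (fst (p, q)) (snd (p, q)) (D p) \<Omega>') \<longrightarrow> maximizer_within f (fst (p, q)) (snd (p, q)) (D p) (\<Omega> p q)"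
        using \<Omega>(2)[OF p] by auto
      show "\<forall>\<^sub>F q in at_top. \<forall>\<Omega>. admissible T f (fst (p, q)) (D p) \<Omega> \<longrightarrow> Vq (snd (p, q)) T \<le> Vq (snd (p, q)) \<Omega> \<longrightarrow> hausdist \<Omega> T \<le> e"
        if "e > 0" for e
        using loc[OF p that] unfolding eventually_at_top_linorder fst_conv snd_conv .
      show "\<exists>r>0. \<exists>R. \<forall>\<Omega>. admissible T f (fst (p, q)) (D p) \<Omega> \<longrightarrow> cball 0 r \<subseteq> \<Omega> \<and> \<Omega> \<subseteq> cball 0 R" for q
        using bounds[OF p] unfolding fst_conv .
    qed
    then show ?thesis using \<Omega>(1) by (intro exI[of _ \<Omega>]) auto
  qed
  \<comment> \<open>In the second part the limit polytope is \<open>T\<close> itself.\<close>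
  have "similar_to T T"
    unfolding similar_to_def by (intro exI[of _ 1] exI[of _ 0] exI[of _ "\<lambda>x. x"]) simp
  then show ?thesis using part1 part2 reg by blast
qed

end
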